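(* Let $k\geq 1$ be an integer and $0<\Delta\leq 1$. Assume the Generalized Riemann Hypothesis. Let $F(X)$ and $G_X(t_1,\dots,t_{2k})$ be positive valued functions, and assume that \[ M_{\bm{t}}(X) \asymp F(X)\, G_X(t_1,\dots,t_{2k}) \] holds for all $\bm{t}=(t_1,\dots,t_{2k})\in\mathbb{R}^{2k}$ with $|t_j|\leq X^{\Delta}$ for all $1\leq j\leq 2k$ (for large $X$), where \[ M_{\bm{t}}(X):=\sum_{\substack{0<d\leq X \\ d\ \text{odd, squarefree}}}\left|L(1/2+it_1,\chi_{8d}) \cdots L(1/2+it_{2k},\chi_{8d})\right|. \] Then \[ \int_{-X^\Delta}^{X^\Delta} \cdots \int_{-X^\Delta}^{X^\Delta} \frac{G_X(t_1,\dots,t_{2k})}{\prod_{j=1}^{2k}(|t_j|+1)}\, dt_1\cdots dt_{2k} \gg \frac{X(\log X)^{2k^2-k}}{F(X)}. \]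
   Context: For an odd squarefree positive integer $d$, $\chi_{8d}(n)=\left(\frac{8d}{n}\right)$ denotes the quadratic character given by the Kronecker symbol, and $L(s,\chi_{8d})$ is its Dirichlet $L$-function. $A\asymp B$ means $A\ll B\ll A$. *)

theory Defs
  imports
    "HOL-Complex_Analysis.Complex_Analysis"
    "HOL-Computational_Algebra.Squarefree"
    "HOL-Number_Theory.Residues"
    "HOL-Real_Asymp.Real_Asymp"
begin

definition kronecker_prime :: "int \<Rightarrow> nat \<Rightarrow> int" where
  "kronecker_prime a p =
     (if p = 2 then (if even a then 0 else if a mod 8 = 1 \<or> a mod 8 = 7 then 1 else -1)
      else Legendre a (int p))"

(* The sign factor is the symbol at the unit -1: it is -1 for negative a and 1 otherwise. *)
definition kronecker :: "int \<Rightarrow> int \<Rightarrow> int" where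
  "kronecker a n =
     (if n = 0 then (if \<bar>a\<bar> = 1 then 1 else 0)
      else (if n < 0 \<and> a < 0 then -1 else 1) *
           (\<Prod>p\<in>prime_factors (nat \<bar>n\<bar>). kronecker_prime a p ^ multiplicity p (nat \<bar>n\<bar>)))"

definition chi8 :: "nat \<Rightarrow> nat \<Rightarrow> complex" where
  "chi8 d n = of_int (kronecker (8 * int d) (int n))"

definition dirichlet_character :: "nat \<Rightarrow> (nat \<Rightarrow> complex) \<Rightarrow> bool" where
  "dirichlet_character q chi \<longleftrightarrow>
     q > 0 \<and>
     (\<forall>m n. chi (m * n) = chi m * chi n) \<and>
     (\<forall>n. chi (n + q) = chi n) \<and>
     (\<forall>n. chi n \<noteq> 0 \<longleftrightarrow> coprime n q)"

(* Dirichlet L-functions are only needed to the right of the line Re s = 0. The point 1 is left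
   out because of the pole in the case of a principal character; for other characters it is
   merely a removable singularity. *)
definition L_domain :: "complex set" where
  "L_domain = {s. Re s > 0} - {1}"

definition continues_dirichlet_series :: "(nat \<Rightarrow> complex) \<Rightarrow> (complex \<Rightarrow> complex) \<Rightarrow> bool" where
  "continues_dirichlet_series chi f \<longleftrightarrow>
     f holomorphic_on L_domain \<and>
     (\<forall>s. Re s > 1 \<longrightarrow> (\<lambda>n. chi (Suc n) * of_nat (Suc n) powr (- s)) sums f s)"

(* The value is meaningful for s in L_domain: there the continuation is unique
   (continues_dirichlet_series_unique), and it exists whenever chi is periodic
   (continues_dirichlet_series_exists), in particular for every Dirichlet character. *)
definition dirichlet_L :: "(nat \<Rightarrow> complex) \<Rightarrow> complex \<Rightarrow> complex" where
  "dirichlet_L chi = (SOME f. continues_dirichlet_series chi f)"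

definition generalized_riemann_hypothesis :: bool where
  "generalized_riemann_hypothesis \<longleftrightarrow>
     (\<forall>q chi s. dirichlet_character q chi \<and> 0 < Re s \<and> Re s < 1 \<and> dirichlet_L chi s = 0
        \<longrightarrow> Re s = 1 / 2)"

(* Tuples (t_1, ..., t_2k) are functions on {1..2*k}, extended by undefined outside,
   as in the product measure over that index set. *)
definition shift_box :: "nat \<Rightarrow> real \<Rightarrow> (nat \<Rightarrow> real) set" where
  "shift_box k T = (\<Pi>\<^sub>E j\<in>{1..2*k}. {-T..T})"

definition shifted_moment :: "nat \<Rightarrow> (nat \<Rightarrow> real) \<Rightarrow> real \<Rightarrow> real" where
  "shifted_moment k t X =
     (\<Sum>d\<in>{d::nat. 0 < d \<and> real d \<le> X \<and> odd d \<and> squarefree d}.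
        norm (\<Prod>j\<in>{1..2*k}. dirichlet_L (chi8 d) (1 / 2 + \<i> * of_real (t j))))"

lemma open_L_domain: "open L_domain"
  unfolding L_domain_def by (intro open_Diff open_halfspace_Re_gt) auto

lemma connected_L_domain: "connected L_domain"
  unfolding L_domain_def
  by (intro connected_open_delete open_halfspace_Re_gt convex_connected convex_halfspace_Re_gt) auto

lemma continues_dirichlet_series_unique:
  assumes "continues_dirichlet_series chi f" "continues_dirichlet_series chi g" "s \<in> L_domain"
  shows "f s = g s"
proof (rule analytic_continuation_open[of "{s. Re s > 1}" L_domain f g])
  show "open {s. Re s > 1}" by (rule open_halfspace_Re_gt)
  show "{s. Re s > 1} \<noteq> {}" by (auto intro!: exI[of _ 2])
  show "{s. Re s > 1} \<subseteq> L_domain" by (auto simp: L_domain_def)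
  show "f holomorphic_on L_domain" "g holomorphic_on L_domain"
    using assms by (auto simp: continues_dirichlet_series_def)
  show "f z = g z" if "z \<in> {s. Re s > 1}" for z
    using assms(1,2) that sums_unique2 unfolding continues_dirichlet_series_def by blast
qed (use assms open_L_domain connected_L_domain in auto)

lemma powr_step_bound:
  fixes u q :: real and s :: complex
  assumes u: "u > 0" and q: "q > 0" and s: "Re s > 0"
    and x: "x \<in> closed_segment (complex_of_real u) (of_real (u + q))"
  shows "norm (x powr (-s) - of_real u powr (-s)) \<le> norm s * u powr (- Re s - 1) * q"
proof -
  let ?S = "closed_segment (complex_of_real u) (of_real (u + q))"
  have S: "z \<in> \<real> \<and> u \<le> Re z \<and> Re z \<le> u + q" if "z \<in> ?S" for z
    using that u q unfolding closed_segment_of_real by (auto simp: closed_segment_eq_real_ivl)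
  have "norm (x powr (-s) - of_real u powr (-s))
          \<le> (norm s * u powr (- Re s - 1)) * norm (x - of_real u)"
  proof (rule field_differentiable_bound[where S = ?S and f' = "\<lambda>z. - s * z powr (- s - 1)"])
    fix z assume z: "z \<in> ?S"
    have "z \<notin> \<real>\<^sub>\<le>\<^sub>0" using S[OF z] u by (auto simp: complex_nonpos_Reals_iff)
    then show "((\<lambda>z. z powr (-s)) has_field_derivative - s * z powr (- s - 1)) (at z within ?S)"
      by (rule has_field_derivative_at_within[OF has_field_derivative_powr])
    have "Re z powr (- Re s - 1) \<le> u powr (- Re s - 1)"
      using S[OF z] u s by (intro powr_mono2') auto
    then show "norm (- s * z powr (- s - 1)) \<le> norm s * u powr (- Re s - 1)"
      using S[OF z] u by (auto simp: norm_mult norm_powr_real_powr intro!: mult_left_mono)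
  qed (use x in auto)
  also have "norm (x - of_real u) \<le> q"
  proof -
    obtain r where r: "x = of_real r" using S[OF x] by (auto elim: Reals_cases)
    have "x - of_real u = of_real (r - u)" by (simp add: r)
    then show ?thesis using S[OF x] r by (simp only: norm_of_real) auto
  qed
  finally show ?thesis by (simp add: mult_left_mono)
qed

lemma powr_mean_bound:
  fixes u q :: real and s :: complex
  assumes u: "u > 0" and q: "q > 0" and s: "Re s > 0" and s1: "s \<noteq> 1"
  shows "norm (of_real u powr (-s)
           - (of_real u powr (1-s) - of_real (u+q) powr (1-s)) / (of_real q * (s - 1)))
         \<le> norm s * u powr (- Re s - 1) * q"
proof -
  let ?S = "closed_segment (complex_of_real u) (of_real (u + q))"
  define f where "f = (\<lambda>x::complex. x powr (1-s) / (1-s) - x * of_real u powr (-s))"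
  have S: "z \<in> \<real> \<and> u \<le> Re z" if "z \<in> ?S" for z
    using that u q unfolding closed_segment_of_real by (auto simp: closed_segment_eq_real_ivl)
  have "norm (f (of_real (u+q)) - f (of_real u))
          \<le> (norm s * u powr (- Re s - 1) * q) * norm (complex_of_real (u+q) - of_real u)"
  proof (rule field_differentiable_bound[where S = ?S
        and f' = "\<lambda>z. z powr (- s) - of_real u powr (-s)"])
    fix z assume z: "z \<in> ?S"
    have "z \<notin> \<real>\<^sub>\<le>\<^sub>0" using S[OF z] u by (auto simp: complex_nonpos_Reals_iff)
    then have "((\<lambda>z. z powr (1-s)) has_field_derivative (1 - s) * z powr (1 - s - 1)) (at z within ?S)"
      by (rule has_field_derivative_at_within[OF has_field_derivative_powr])
    then have "((\<lambda>z. z powr (1-s) / (1-s)) has_field_derivative (1 - s) * z powr (1 - s - 1) / (1 - s)) (at z within ?S)"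
      by (rule DERIV_cdivide)
    moreover have "(1 - s) * z powr (1 - s - 1) / (1 - s) = z powr (- s)"
      using s1 by simp
    ultimately have D: "((\<lambda>z. z powr (1-s) / (1-s)) has_field_derivative z powr (- s)) (at z within ?S)"
      by simp
    have "((\<lambda>z. z * of_real u powr (-s)) has_field_derivative 1 * of_real u powr (-s)) (at z within ?S)"
      by (rule DERIV_cmult_right[OF DERIV_ident])
    from DERIV_diff[OF D this]
    show "(f has_field_derivative z powr (- s) - of_real u powr (-s)) (at z within ?S)"
      unfolding f_def by simp
    show "norm (z powr (- s) - of_real u powr (-s)) \<le> norm s * u powr (- Re s - 1) * q"
      by (rule powr_step_bound[OF u q s z])
  qed auto
  also have "norm (complex_of_real (u+q) - of_real u) = q" using q by simp
  finally have *: "norm (f (of_real (u+q)) - f (of_real u)) \<le> norm s * u powr (- Re s - 1) * q * q" .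
  have "of_real u powr (-s)
           - (of_real u powr (1-s) - of_real (u+q) powr (1-s)) / (of_real q * (s - 1))
        = - (f (of_real (u+q)) - f (of_real u)) / of_real q"
  proof -
    have alg: "P - (A - B) / (Q * (s - 1)) = - ((B / (1-s) - (U + Q) * P) - (A / (1-s) - U * P)) / Q"
      if "Q \<noteq> 0" for P A B Q U :: complex
    proof -
      have "(A - B) / (Q * (s - 1)) = (B / (1-s) - A / (1-s)) / Q"
        using that s1 by (simp add: divide_simps; simp add: algebra_simps)
      moreover have "P = (((U + Q) * P) - U * P) / Q" using that by (simp add: field_simps)
      ultimately show ?thesis by (simp add: diff_divide_distrib add_divide_distrib)
    qed
    show ?thesis unfolding f_def using q by (simp only: of_real_add alg of_real_eq_0_iff)
  qed
  then have "norm (of_real u powr (-s)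
           - (of_real u powr (1-s) - of_real (u+q) powr (1-s)) / (of_real q * (s - 1)))
         = norm (f (of_real (u+q)) - f (of_real u)) / q"
    using q by (simp only: norm_divide norm_minus_cancel norm_of_real abs_of_pos)
  also have "\<dots> \<le> norm s * u powr (- Re s - 1) * q"
    using * q by (simp add: divide_le_eq)
  finally show ?thesis .
qed

(* Every periodic coefficient sequence has a continuation: sum over blocks of length q after
   comparing each term with an integral over an interval of length q. *)
lemma continues_dirichlet_series_exists:
  assumes q: "q > 0" and per: "\<And>n. chi (n + q) = chi n"
  shows "\<exists>f. continues_dirichlet_series chi f"
proof -
  define u where "u = (\<lambda>m a::nat. real (m * q + Suc a))"
  have u: "u m a \<ge> real (Suc m)" for m a
  proof -
    have "m * 1 \<le> m * q" using q by (intro mult_left_mono) auto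
    then show ?thesis unfolding u_def of_nat_le_iff by linarith
  qed
  have u0: "u m a > 0" for m a using u[of m a] by simp
  have uS: "u (Suc m) a = u m a + real q" for m a by (simp add: u_def algebra_simps)
  have per': "chi (m * q + n) = chi n" for m n
  proof (induction m)
    case (Suc m)
    have "Suc m * q + n = (m * q + n) + q" by simp
    then show ?case using per[of "m * q + n"] Suc by (simp only:)
  qed simp
  define e where "e = (\<lambda>m a s. of_real (u m a) powr (-s)
     - (of_real (u m a) powr (1-s) - of_real (u (Suc m) a) powr (1-s)) / (of_real (real q) * (s - 1)) :: complex)"
  define h where "h = (\<lambda>m s. \<Sum>a<q. chi (Suc a) * e m a s)"
  define B where "B = (\<Sum>a<q. norm (chi (Suc a)))"
  have B0: "B \<ge> 0" unfolding B_def by (intro sum_nonneg) auto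
  have ebound: "norm (e m a s) \<le> norm s * real (Suc m) powr (- Re s - 1) * q"
    if "s \<in> L_domain" for m a s
  proof -
    have "norm (e m a s) \<le> norm s * u m a powr (- Re s - 1) * real q"
      unfolding e_def uS using that q u0 by (intro powr_mean_bound) (auto simp: L_domain_def)
    also have "\<dots> \<le> norm s * real (Suc m) powr (- Re s - 1) * q"
      using that u[of m a] by (intro mult_right_mono mult_left_mono powr_mono2') (auto simp: L_domain_def)
    finally show ?thesis .
  qed
  have hbound: "norm (h m s) \<le> B * (norm s * real (Suc m) powr (- Re s - 1) * q)"
    if "s \<in> L_domain" for m s
    unfolding h_def B_def sum_distrib_right
    by (intro sum_norm_le) (use ebound[OF that] in \<open>auto simp: norm_mult intro!: mult_left_mono\<close>)
  define H where "H = (\<lambda>s. \<Sum>m. h m s)"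
  have H_hol: "H holomorphic_on L_domain"
  proof (rule holomorphic_uniform_sequence[OF open_L_domain, where f = "\<lambda>n s. \<Sum>m<n. h m s"])
    show "(\<lambda>s. \<Sum>m<n. h m s) holomorphic_on L_domain" for n
      unfolding h_def e_def using u0 q
      by (intro holomorphic_intros) (auto simp: L_domain_def less_imp_neq[symmetric])
    fix z assume z: "z \<in> L_domain"
    obtain d0 where d0: "d0 > 0" "cball z d0 \<subseteq> L_domain"
      using open_L_domain z open_contains_cball by blast
    define d where "d = min d0 (Re z / 2)"
    have zr: "Re z > 0" using z by (auto simp: L_domain_def)
    have d: "d > 0" "cball z d \<subseteq> L_domain" using d0 zr by (auto simp: d_def)
    define r where "r = Re z / 2"
    have r0: "r > 0" using zr by (simp add: r_def)
    have Rew: "Re w \<ge> r" "norm w \<le> norm z + d" if "w \<in> cball z d" for w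
    proof -
      have *: "norm (z - w) \<le> d" using that by (simp add: dist_norm)
      have "\<bar>Re (z - w)\<bar> \<le> d" using abs_Re_le_cmod[of "z - w"] * by linarith
      moreover have "d \<le> Re z / 2" by (simp add: d_def)
      moreover have "Re z - Re w \<le> \<bar>Re (z - w)\<bar>" by simp
      ultimately show "Re w \<ge> r" unfolding r_def by linarith
      have "norm w \<le> norm z + norm (z - w)" by (metis norm_minus_commute norm_triangle_sub)
      then show "norm w \<le> norm z + d" using * by linarith
    qed
    have "uniform_limit (cball z d) (\<lambda>n s. \<Sum>m<n. h m s) H sequentially"
      unfolding H_def
    proof (rule Weierstrass_m_test)
      show "norm (h m w) \<le> B * ((norm z + d) * real (Suc m) powr (- r - 1) * q)"
        if w: "w \<in> cball z d" for m w
      proof -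
        have "real (Suc m) powr (- Re w - 1) \<le> real (Suc m) powr (- r - 1)"
          using Rew[OF w] by (intro powr_mono) auto
        then have "B * (norm w * real (Suc m) powr (- Re w - 1) * q)
             \<le> B * ((norm z + d) * real (Suc m) powr (- r - 1) * q)"
          using Rew[OF w] B0 d by (intro mult_left_mono mult_right_mono mult_mono) auto
        then show ?thesis using hbound[of w m] w d by force
      qed
      have "summable (\<lambda>n. real n powr (- r - 1))"
        using r0 by (subst summable_real_powr_iff) auto
      then have "summable (\<lambda>n. real (Suc n) powr (- r - 1))"
        by (subst summable_Suc_iff)
      then show "summable (\<lambda>m. B * ((norm z + d) * real (Suc m) powr (- r - 1) * q))"
        by (intro summable_mult summable_mult2)
    qed
    with d show "\<exists>d>0. cball z d \<subseteq> L_domain \<and>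
        uniform_limit (cball z d) (\<lambda>n s. \<Sum>m<n. h m s) H sequentially" by blast
  qed
  define T where "T = (\<lambda>s. \<Sum>a<q. chi (Suc a) * (of_real (u 0 a) powr (1-s) / (of_real (real q) * (s-1))))"
  have T_hol: "T holomorphic_on L_domain"
    unfolding T_def using u0 q
    by (intro holomorphic_intros) (auto simp: L_domain_def less_imp_neq[symmetric])
  have "(\<lambda>n. chi (Suc n) * of_nat (Suc n) powr (- s)) sums (H s + T s)" if s: "Re s > 1" for s
  proof -
    define g where "g = (\<lambda>n. chi (Suc n) * of_nat (Suc n) powr (- s))"
    have "s \<noteq> 1" using s by auto
    then have sL: "s \<in> L_domain" using s by (auto simp: L_domain_def)
    have chi_bound: "norm (chi (Suc n)) \<le> B" for n
    proof -
      have "Suc n = (n div q) * q + Suc (n mod q)" by simp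
      then have "chi (Suc n) = chi (Suc (n mod q))" by (metis per')
      moreover have "norm (chi (Suc (n mod q))) \<le> B"
        unfolding B_def using q
        by (intro member_le_sum[where f = "\<lambda>a. norm (chi (Suc a))"]) auto
      ultimately show ?thesis by simp
    qed
    have "summable (\<lambda>n. real n powr (- Re s))" using s by (subst summable_real_powr_iff) auto
    then have "summable (\<lambda>n. real (Suc n) powr (- Re s))" by (subst summable_Suc_iff)
    then have "summable (\<lambda>n. B * real (Suc n) powr (- Re s))" by (rule summable_mult)
    then have gs: "summable g"
    proof (rule summable_comparison_test')
      fix n :: nat assume "n \<ge> 0"
      have "norm (of_nat (Suc n) powr (- s) :: complex) = real (Suc n) powr (- Re s)"
        by (subst norm_powr_real_powr) auto
      then show "norm (g n) \<le> B * real (Suc n) powr (- Re s)"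
        unfolding g_def norm_mult using chi_bound[of n] B0 by (intro mult_mono) auto
    qed
    have block: "sum g {m * q..<m * q + q} = (\<Sum>a<q. chi (Suc a) * of_real (u m a) powr (-s))" for m
    proof -
      have "sum g {m * q..<m * q + q} = (\<Sum>a<q. g (m * q + a))"
        by (rule sum.reindex_bij_witness[of _ "\<lambda>a. m * q + a" "\<lambda>n. n - m * q"]) auto
      also have "\<dots> = (\<Sum>a<q. chi (Suc a) * of_real (u m a) powr (-s))"
      proof (rule sum.cong)
        fix a
        have "chi (Suc (m * q + a)) = chi (Suc a)" using per'[of m "Suc a"] by simp
        then show "g (m * q + a) = chi (Suc a) * of_real (u m a) powr (-s)"
          unfolding g_def u_def by simp
      qed simp
      finally show ?thesis .
    qed
    have gsum: "(\<lambda>m. \<Sum>a<q. chi (Suc a) * of_real (u m a) powr (-s)) sums suminf g"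
      using sums_group[OF summable_sums[OF gs] q] block by simp
    have tele: "(\<lambda>m. (of_real (u m a) powr (1-s) - of_real (u (Suc m) a) powr (1-s)) / (of_real (real q) * (s - 1)))
       sums (of_real (u 0 a) powr (1-s) / (of_real (real q) * (s-1)))" for a
    proof -
      have "(\<lambda>m. of_real (u m a) powr (1-s)) \<longlonglongrightarrow> (0::complex)"
      proof (rule Lim_null_comparison)
        have "(\<lambda>m. real (Suc m) powr (1 - Re s)) \<longlonglongrightarrow> 0"
          using s by real_asymp
        then show "(\<lambda>m. real (Suc m) powr (1 - Re s)) \<longlonglongrightarrow> 0" .
        have "norm (of_real (u m a) powr (1-s) :: complex) \<le> real (Suc m) powr (1 - Re s)" for m
          using u0[of m a] u[of m a] s
          by (subst norm_powr_real_powr) (auto intro!: powr_mono2')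
        then show "\<forall>\<^sub>F m in sequentially. norm (of_real (u m a) powr (1-s) :: complex)
              \<le> real (Suc m) powr (1 - Re s)" by simp
      qed
      from telescope_sums'[OF this] show ?thesis
        by (intro sums_divide) simp
    qed
    have "(\<lambda>m. \<Sum>a<q. chi (Suc a) * ((of_real (u m a) powr (1-s) - of_real (u (Suc m) a) powr (1-s))
              / (of_real (real q) * (s - 1)))) sums T s"
      unfolding T_def by (intro sums_sum sums_mult tele)
    from sums_diff[OF gsum this] have "(\<lambda>m. h m s) sums (suminf g - T s)"
      unfolding h_def e_def by (simp add: sum_subtractf[symmetric] right_diff_distrib)
    then have "H s = suminf g - T s" unfolding H_def by (rule sums_unique[symmetric])
    then have "suminf g = H s + T s" by simp
    then show ?thesis using summable_sums[OF gs] by (simp add: g_def)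
  qed
  with H_hol T_hol have "continues_dirichlet_series chi (\<lambda>s. H s + T s)"
    unfolding continues_dirichlet_series_def by (auto intro!: holomorphic_intros)
  then show ?thesis by blast
qed

lemma dirichlet_L_continues:
  assumes "dirichlet_character q chi"
  shows "continues_dirichlet_series chi (dirichlet_L chi)"
proof -
  have "q > 0" and "\<And>n. chi (n + q) = chi n"
    using assms unfolding dirichlet_character_def by blast+
  then have "\<exists>f. continues_dirichlet_series chi f" by (rule continues_dirichlet_series_exists)
  then show ?thesis unfolding dirichlet_L_def by (rule someI_ex)
qed

end

theory Submission
  imports Defs "HOL-Probability.Probability" "HOL-Number_Theory.Number_Theory"
begin

text \<open>
  By Fubini, the integral of the shifted moment against \<open>\<Prod> (\<bar>t\<^sub>j\<bar> + 1)\<^bsup>-1\<^esup>\<close> is the sum over \<open>d\<close> of the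
  \<open>2k\<close>-th power of \<open>A\<^sub>d = \<integral> \<bar>L(1/2 + it, \<chi>\<^bsub>8d\<^esub>)\<bar> / (1 + \<bar>t\<bar>) dt\<close> over \<open>\<bar>t\<bar> \<le> X\<^bsup>\<Delta>\<^esup>\<close>. Integrating the conditionally
  convergent Dirichlet series of \<open>L(1/2 + it, \<chi>\<^bsub>8d\<^esub>)\<close> against \<open>Y\<^bsup>it\<^esup>\<close> times a Gaussian shows that, up to a
  bounded error, \<open>A\<^sub>d\<close> dominates the character sum \<open>S\<^sub>d = \<Sum> \<chi>\<^bsub>8d\<^esub>(n) w(n)\<close>, whose positive weight \<open>w\<close>
  is of size \<open>Y\<^bsup>-1/2\<^esup>\<close> on \<open>[Y, 4Y]\<close> and decays rapidly away from \<open>Y\<close>. Take \<open>Y\<close> to be a small power of \<open>X\<close>. In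
  the \<open>2k\<close>-th moment of \<open>S\<^sub>d\<close>, tuples \<open>(n\<^sub>1, \<dots>, n\<^bsub>2k\<^esub>)\<close> whose product is not a square contribute a smaller
  power of \<open>X\<close>, because \<open>\<chi>\<^bsub>8d\<^esub>(m)\<close> is then a nontrivial character in \<open>d\<close>. The remaining terms are
  nonnegative, and there are at least \<open>c Y\<^sup>k (ln Y)\<^bsup>k(2k-1)\<^esup>\<close> tuples in \<open>[Y, 4Y]\<close> with square product, the
  exponent being the number of edges of the complete graph on \<open>2k\<close> vertices.
\<close>

section \<open>Quadratic residues\<close>

text \<open>Three difficulties shape the proof. For |t| beyond X^\<Delta> the integral gives no
  information, and L is bounded there only by a multiple of d (1 + |t|). A Gaussian beats every
  power of |t|, and |t| > X^\<Delta> makes a fixed power of |t| exceed d. The Gaussian also has a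
  positive Fourier transform, so all square products enter with the same sign. Next, a square
  product counts for d only if it is coprime to 2d. The lower bound therefore keeps only those d
  whose prime factors p have sum of 1/p at most 1/4: they form a positive proportion, and for them
  coprimality costs a constant factor. Finally, the logarithms: the variable a of an edge divides
  the two n_i at its ends. The number of free square factors of n_i has order the square root of Y
  over the edge variables at i, so a ends up with weight 1/a, and its sum gives one factor ln Y.
  Non-square products need no sharp estimate: a bound linear in the product with a power saving in X
  is enough, because Y may be as small a power of X as desired.\<close>

lemma Legendre_values: "Legendre a p \<in> {-1, 0, 1}"
  by (auto simp: Legendre_def)

lemma abs_Legendre_le: "\<bar>Legendre a p\<bar> \<le> 1"
  by (auto simp: Legendre_def)

lemma Legendre_eq_0_iff: "Legendre a p = 0 \<longleftrightarrow> p dvd a"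
  by (auto simp: Legendre_def cong_0_iff)

lemma Legendre_cong: "[a = b] (mod p) \<Longrightarrow> Legendre a p = Legendre b p"
  by (simp add: Legendre_def QuadRes_def cong_def)

text \<open>Euler's criterion gives the identity modulo p. Both sides lie in {-1, 0, 1}, so they
  differ by at most 2 < p.\<close>

lemma Legendre_mult:
  assumes p: "prime p" "2 < p"
  shows "Legendre (a * b) (int p) = Legendre a p * Legendre b p"
proof -
  have "[Legendre (a * b) p = (a * b) ^ ((p - 1) div 2)] (mod p)"
    using euler_criterion[OF p] .
  also have "(a * b) ^ ((p - 1) div 2) = a ^ ((p - 1) div 2) * b ^ ((p - 1) div 2)"
    by (rule power_mult_distrib)
  also have "[\<dots> = Legendre a p * Legendre b p] (mod p)"
    by (intro cong_mult cong_sym[OF euler_criterion[OF p]])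
  finally have "int p dvd Legendre (a * b) p - Legendre a p * Legendre b p"
    by (simp add: cong_iff_dvd_diff)
  moreover have "\<bar>Legendre (a * b) p - Legendre a p * Legendre b p\<bar> < int p"
  proof -
    have "\<bar>Legendre a p * Legendre b p\<bar> \<le> 1"
      using Legendre_values[of a p] Legendre_values[of b p] by auto
    then show ?thesis using abs_Legendre_le[of "a * b" p] p by linarith
  qed
  ultimately have "Legendre (a * b) p - Legendre a p * Legendre b p = 0"
    by (metis abs_of_nat dvd_imp_le_int not_le)
  then show ?thesis by simp
qed

lemma Legendre_one: "prime p \<Longrightarrow> 2 < p \<Longrightarrow> Legendre 1 (int p) = 1"
proof -
  assume "prime p" "2 < p"
  moreover have "QuadRes (int p) 1" unfolding QuadRes_def by (rule exI[of _ 1]) simp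
  ultimately show ?thesis by (auto simp: Legendre_def cong_0_iff)
qed

text \<open>Gauss's lemma with multiplier 2: for r = (p - 1) / 2 the doubles 2x, x <= r, need no
  reduction modulo p, and those exceeding r come from r div 2 < x <= r. Only the parity of r - r div
  2 matters.\<close>

lemma Legendre_two:
  assumes p: "prime p" "2 < p"
  shows "Legendre 2 (int p) = (if p mod 8 = 1 \<or> p mod 8 = 7 then 1 else -1)"
proof -
  interpret GAUSS p 2
    using p by unfold_locales (auto simp: cong_iff_dvd_diff dest: zdvd_imp_le)
  define r where "r = (int p - 1) div 2"
  have pr: "int p = 2 * r + 1" using p_eq2 by (simp add: r_def)
  have r0: "r > 0" using p pr by linarith
  have "C = (\<lambda>x. x * 2) ` {0<..r}"
  proof -
    have "x * 2 mod int p = x * 2" if "x \<in> {0<..r}" for x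
      using that pr by (intro mod_pos_pos_trivial) auto
    then show ?thesis unfolding C_def B_def A_def r_def[symmetric] image_image
      by (intro image_cong) auto
  qed
  then have "E = (\<lambda>x. x * 2) ` {r div 2<..r}"
    unfolding E_def r_def[symmetric] using r0 by (auto simp: image_iff)
  then have "card E = card {r div 2<..r}"
    by (simp add: card_image inj_on_def)
  then have cE: "card E = nat (r - r div 2)" by simp
  have pm: "p mod 8 = 1 \<or> p mod 8 = 3 \<or> p mod 8 = 5 \<or> p mod 8 = 7"
    using odd_p by presburger
  have "even (card E) \<longleftrightarrow> even (r - r div 2)"
    unfolding cE using r0 by (subst even_nat_iff) auto
  also have "\<dots> \<longleftrightarrow> r mod 4 = 0 \<or> r mod 4 = 3"
    by presburger
  also have "\<dots> \<longleftrightarrow> (2 * r + 1) mod 8 = 1 \<or> (2 * r + 1) mod 8 = 7"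
    by presburger
  also have "\<dots> \<longleftrightarrow> int (p mod 8) = 1 \<or> int (p mod 8) = 7"
    unfolding pr[symmetric] by (simp add: zmod_int)
  also have "\<dots> \<longleftrightarrow> p mod 8 = 1 \<or> p mod 8 = 7" by linarith
  finally show ?thesis unfolding gauss_lemma by (cases "even (card E)") simp_all
qed

text \<open>Pigeonhole: z and p - z have the same square, so the squares modulo p already come from
  {0..h}, which has h + 1 < p elements.\<close>

lemma ex_quadratic_nonresidue:
  assumes p: "prime p" "2 < p"
  shows "\<exists>u::nat. Legendre (int u) (int p) = -1"
proof (rule ccontr)
  assume no: "\<not> ?thesis"
  define h where "h = (p - 1) div 2"
  have ph: "p = 2 * h + 1"
    using prime_odd_nat[OF p] unfolding h_def by presburger
  have "{0..<p} \<subseteq> (\<lambda>x. x ^ 2 mod p) ` {0..h}"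
  proof
    fix u assume u: "u \<in> {0..<p}"
    have "Legendre (int u) (int p) \<noteq> -1" using no by blast
    then have "QuadRes (int p) (int u) \<or> u = 0"
      using u by (auto simp: Legendre_def cong_0_iff split: if_splits)
    then have "\<exists>y::int. [y ^ 2 = int u] (mod int p)"
    proof
      assume "u = 0"
      then show ?thesis by (intro exI[of _ 0]) simp
    qed (simp add: QuadRes_def)
    then obtain y :: int where y: "[y ^ 2 = int u] (mod int p)" by blast
    define z where "z = nat (y mod int p)"
    have z: "z < p" "[int z = y] (mod int p)"
      using p by (auto simp: z_def cong_def nat_less_iff)
    have "[int z ^ 2 = int u] (mod int p)"
      using cong_trans[OF cong_pow[OF z(2)] y] .
    then have zu: "[z ^ 2 = u] (mod p)"
      by (metis cong_int_iff of_nat_power)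
    show "u \<in> (\<lambda>x. x ^ 2 mod p) ` {0..h}"
    proof (cases "z \<le> h")
      case True
      with zu u show ?thesis by (auto simp: cong_def intro!: image_eqI[of _ _ z])
    next
      case False
      have "int (p - z) ^ 2 - int z ^ 2 = int p * (int p - 2 * int z)"
        using z by (simp add: of_nat_diff power2_eq_square algebra_simps)
      then have "[int (p - z) ^ 2 = int z ^ 2] (mod int p)"
        by (simp add: cong_iff_dvd_diff)
      then have "[(p - z) ^ 2 = z ^ 2] (mod p)" by (metis cong_int_iff of_nat_power)
      then have "[(p - z) ^ 2 = u] (mod p)" using zu cong_trans by blast
      then show ?thesis using u False ph z by (auto simp: cong_def intro!: image_eqI[of _ _ "p - z"])
    qed
  qed
  then have "card {0..<p} \<le> card {0..h}"
    by (meson card_image_le card_mono finite_atLeastAtMost finite_imageI le_trans)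
  then show False using ph p by simp
qed

section \<open>Completely multiplicative functions given by their values at the primes\<close>

definition cmult :: "(nat \<Rightarrow> int) \<Rightarrow> nat \<Rightarrow> int" where
  "cmult g n = (\<Prod>p\<in>prime_factors n. g p ^ multiplicity p n)"

lemma cmult_mset: "cmult g n = prod_mset (image_mset g (prime_factorization n))"
  unfolding cmult_def image_prod_mset_multiplicity
  by (intro prod.cong) (auto simp: count_prime_factorization)

lemma cmult_mult: "m > 0 \<Longrightarrow> n > 0 \<Longrightarrow> cmult g (m * n) = cmult g m * cmult g n"
  by (simp add: cmult_mset prime_factorization_mult)

lemma cmult_1 [simp]: "cmult g (Suc 0) = 1"
  by (simp add: cmult_def)

lemma cmult_prime: "prime p \<Longrightarrow> cmult g p = g p"
  by (simp add: cmult_mset prime_factorization_prime)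

text \<open>Reduces an identity of completely multiplicative functions to the primes. This is how
  reciprocity, a statement about two primes, reaches the symbol (8d/n) for all n.\<close>

lemma cmult_unique:
  assumes "h 1 = 1" "\<And>m n. m > 0 \<Longrightarrow> n > 0 \<Longrightarrow> h (m * n) = h m * h n"
    and "\<And>p. prime p \<Longrightarrow> h p = g p" and "n > 0"
  shows "cmult g n = h n"
  using \<open>n > 0\<close>
proof (induction n rule: nat_less_induct)
  case (1 n)
  show ?case
  proof (cases "n = 1")
    case True
    then show ?thesis using assms(1) by simp
  next
    case False
    then obtain p m where p: "prime p" "n = p * m"
      using prime_factor_nat by (metis dvdE)
    then have m: "m > 0" "m < n" using \<open>n > 0\<close> prime_gt_1_nat[OF p(1)] by auto
    have "cmult g n = cmult g p * cmult g m"
      unfolding p(2) using p m prime_gt_0_nat by (intro cmult_mult) auto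
    also have "\<dots> = h p * h m" using 1 m p assms(3) by (simp add: cmult_prime)
    also have "\<dots> = h n" using assms(2)[of p m] p m prime_gt_0_nat by simp
    finally show ?thesis .
  qed
qed

section \<open>The Kronecker symbol as a character of its lower argument\<close>

text \<open>The characters \<open>(2/n)\<close> and \<open>(-1/n)\<close>.\<close>

definition eps8 :: "nat \<Rightarrow> int" where
  "eps8 n = (if even n then 0 else if n mod 8 = 1 \<or> n mod 8 = 7 then 1 else -1)"

definition eps4 :: "nat \<Rightarrow> int" where
  "eps4 n = (if even n then 0 else if n mod 4 = 1 then 1 else -1)"

lemma eps8_mod: "eps8 (n mod 8) = eps8 n"
  unfolding eps8_def by (simp add: dvd_mod_iff)

lemma eps4_mod: "eps4 (n mod 4) = eps4 n"
  unfolding eps4_def by (simp add: dvd_mod_iff)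

lemma eps8_mult: "eps8 (m * n) = eps8 m * eps8 n"
proof -
  have "\<forall>a\<in>{0,1,2,3,4,5,6,7}. \<forall>b\<in>{0,1,2,3,4,5,6,7}. eps8 (a * b mod 8) = eps8 a * eps8 b"
    by (simp add: eps8_def)
  moreover have "x mod 8 \<in> {0,1,2,3,4,5,6,7}" for x :: nat
    using mod_less_divisor[of 8 x] by (simp, linarith)
  ultimately have "eps8 (m mod 8 * (n mod 8) mod 8) = eps8 (m mod 8) * eps8 (n mod 8)"
    by blast
  then show ?thesis by (simp add: eps8_mod mod_mult_eq)
qed

lemma eps4_mult: "eps4 (m * n) = eps4 m * eps4 n"
proof -
  have "\<forall>a\<in>{0,1,2,3}. \<forall>b\<in>{0,1,2,3}. eps4 (a * b mod 4) = eps4 a * eps4 b"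
    by (simp add: eps4_def)
  moreover have "x mod 4 \<in> {0,1,2,3}" for x :: nat
    using mod_less_divisor[of 4 x] by (simp, linarith)
  ultimately have "eps4 (m mod 4 * (n mod 4) mod 4) = eps4 (m mod 4) * eps4 (n mod 4)"
    by blast
  then show ?thesis by (simp add: eps4_mod mod_mult_eq)
qed

lemma eps4_odd: "odd n \<Longrightarrow> eps4 n = (-1) ^ ((n - 1) div 2)"
proof -
  assume "odd n"
  then obtain h where h: "n = 2 * h + 1" by (elim oddE)
  have "(2 * h + 1) mod 4 = 1 \<longleftrightarrow> even h" by presburger
  then show ?thesis by (simp add: eps4_def h)
qed

text \<open>The symbol \<open>(8d/n)\<close> after quadratic reciprocity, which makes its periodicity in \<open>n\<close> visible.\<close>

definition psi8 :: "nat \<Rightarrow> nat \<Rightarrow> int" where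
  "psi8 d n = eps8 n * (\<Prod>p\<in>prime_factors d. eps4 n ^ ((p - 1) div 2) * Legendre (int n) (int p))"

lemma odd_prime_factor_gt_2:
  assumes "odd (d::nat)" "p \<in> prime_factors d"
  shows "prime p" "2 < p"
proof -
  show "prime p" using assms by auto
  have "p \<noteq> 2" using assms by auto
  with prime_ge_2_nat[OF \<open>prime p\<close>] show "2 < p" by simp
qed

lemma psi8_mult:
  assumes "odd d" shows "psi8 d (m * n) = psi8 d m * psi8 d n"
proof -
  have "(\<Prod>p\<in>prime_factors d. eps4 (m * n) ^ ((p - 1) div 2) * Legendre (int (m * n)) (int p))
      = (\<Prod>p\<in>prime_factors d. (eps4 m ^ ((p - 1) div 2) * Legendre (int m) (int p)) *
            (eps4 n ^ ((p - 1) div 2) * Legendre (int n) (int p)))"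
    using odd_prime_factor_gt_2[OF assms]
    by (intro prod.cong) (auto simp: eps4_mult Legendre_mult power_mult_distrib)
  then show ?thesis unfolding psi8_def eps8_mult prod.distrib by simp
qed

lemma psi8_1: "odd d \<Longrightarrow> psi8 d 1 = 1"
  using odd_prime_factor_gt_2[of d] unfolding psi8_def
  by (auto simp: eps8_def eps4_def Legendre_one intro!: prod.neutral)

lemma psi8_periodic:
  shows "psi8 d (n + 8 * d) = psi8 d n"
proof -
  have "eps8 (n + 8 * d) = eps8 n" by (metis eps8_mod mod_mult_self2)
  moreover have "eps4 (n + 8 * d) = eps4 n"
  proof -
    have "(n + 8 * d) mod 4 = n mod 4" by presburger
    then show ?thesis by (metis eps4_mod)
  qed
  moreover have "Legendre (int (n + 8 * d)) (int p) = Legendre (int n) (int p)"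
    if "p \<in> prime_factors d" for p
    using that by (intro Legendre_cong) (auto simp: cong_iff_dvd_diff)
  ultimately show ?thesis unfolding psi8_def by simp
qed

lemma Legendre_prod:
  assumes "prime q" "2 < q"
  shows "Legendre (\<Prod>x\<in>A. f x) (int q) = (\<Prod>x\<in>A. Legendre (f x) (int q))"
  by (induction A rule: infinite_finite_induct) (auto simp: Legendre_one Legendre_mult assms)

lemma prod_prime_factors_squarefree:
  assumes "squarefree (d::nat)" shows "(\<Prod>p\<in>prime_factors d. p) = d"
proof -
  have d: "d > 0" using assms by (intro Nat.gr0I) auto
  have "(\<Prod>p\<in>prime_factors d. p) = (\<Prod>p\<in>prime_factors d. p ^ multiplicity p d)"
    using assms d by (intro prod.cong) (auto simp: squarefree_factorial_semiring')
  then show ?thesis using prime_factorization_nat[OF d] by simp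
qed

text \<open>Both sides are completely multiplicative in n and vanish at 2. At an odd prime q, (8/q)
  = (2/q)^3 = (2/q), and (d/q) is a product of (p/q) over p | d. Reciprocity turns each factor into
  (q/p) at the cost of the sign \<open>eps4 q ^ ((p - 1) div 2)\<close>; for p = q both symbols are
  0.\<close>

lemma kronecker_8_eq_psi8:
  assumes d: "odd d" "squarefree d"
  shows "kronecker (8 * int d) (int n) = psi8 d n"
proof (cases "n = 0")
  case True
  have "\<bar>8 * int d\<bar> \<noteq> 1" by presburger
  then show ?thesis using True by (simp add: kronecker_def psi8_def eps8_def)
next
  case False
  then have n: "n > 0" by simp
  have "kronecker (8 * int d) (int n) = cmult (kronecker_prime (8 * int d)) n"
    using n by (simp add: kronecker_def cmult_def)
  also have "\<dots> = psi8 d n"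
  proof (rule cmult_unique[OF psi8_1[OF d(1)] psi8_mult[OF d(1)] _ n])
    fix q :: nat assume q: "prime q"
    show "psi8 d q = kronecker_prime (8 * int d) q"
    proof (cases "q = 2")
      case True
      then show ?thesis by (simp add: kronecker_prime_def psi8_def eps8_def)
    next
      case False
      then have q2: "2 < q" using prime_ge_2_nat[OF q] by simp
      have qo: "odd q" using q q2 prime_odd_nat by blast
      have "Legendre (8 * int d) q = Legendre 2 q * (Legendre 2 q * Legendre 2 q) * Legendre (int d) q"
        using Legendre_mult[OF q q2, of 2 4] Legendre_mult[OF q q2, of 2 2] Legendre_mult[OF q q2, of 8 "int d"]
        by simp
      also have "Legendre 2 q = eps8 q"
        using qo by (simp add: Legendre_two[OF q q2] eps8_def)
      also have "eps8 q * (eps8 q * eps8 q) = eps8 q" by (simp add: eps8_def)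
      also have "Legendre (int d) q = (\<Prod>p\<in>prime_factors d. Legendre (int p) (int q))"
        using Legendre_prod[OF q q2, of int "prime_factors d"] prod_prime_factors_squarefree[OF d(2)]
        by (simp flip: of_nat_prod)
      also have "\<dots> = (\<Prod>p\<in>prime_factors d. eps4 q ^ ((p - 1) div 2) * Legendre (int q) (int p))"
      proof (rule prod.cong[OF refl])
        fix p assume "p \<in> prime_factors d"
        note p = odd_prime_factor_gt_2[OF d(1) this]
        show "Legendre (int p) (int q) = eps4 q ^ ((p - 1) div 2) * Legendre (int q) (int p)"
        proof (cases "p = q")
          case True
          have "Legendre (int p) (int p) = 0" by (simp add: Legendre_eq_0_iff)
          then show ?thesis using True by simp
        next
          case False
          have "eps4 q ^ ((p - 1) div 2) = (-1) ^ ((p - 1) div 2 * ((q - 1) div 2))"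
            by (simp add: eps4_odd[OF qo] power_mult[symmetric] mult.commute)
          also have "\<dots> = Legendre p q * Legendre q p"
            using Quadratic_Reciprocity[OF p q q2 False] by simp
          finally have "eps4 q ^ ((p - 1) div 2) * Legendre q p = Legendre p q * (Legendre q p * Legendre q p)"
            by simp
          moreover have "Legendre (int q) (int p) \<noteq> 0"
            using False p q by (auto simp: Legendre_eq_0_iff primes_dvd_imp_eq)
          then have "Legendre q p * Legendre q p = 1"
            using Legendre_values[of q p] by auto
          ultimately show ?thesis by simp
        qed
      qed
      finally show ?thesis
        using False by (simp add: kronecker_prime_def psi8_def)
    qed
  qed
  finally show ?thesis .
qed

text \<open>Multiplication by u permutes the residues modulo q and multiplies the sum by f u =
  -1.\<close>

lemma sum_multiplicative_periodic_eq_0: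
  fixes f :: "nat \<Rightarrow> int"
  assumes mult: "\<And>m n. f (m * n) = f m * f n" and per: "\<And>n. f (n + q) = f n"
    and q: "q > 0" and u: "coprime u q" "f u = -1"
  shows "(\<Sum>n<q. f n) = 0"
proof -
  have per': "f (n mod q) = f n" for n
  proof -
    have "f (r + q * t) = f r" for r t
    proof (induction t)
      case (Suc t)
      have "r + q * Suc t = (r + q * t) + q" by simp
      then show ?case using per[of "r + q * t"] Suc by (simp only:)
    qed simp
    from this[of "n mod q" "n div q"] show ?thesis by simp
  qed
  have inj: "inj_on (\<lambda>n. u * n mod q) {..<q}"
  proof (rule inj_onI)
    fix x y assume xy: "x \<in> {..<q}" "y \<in> {..<q}" "u * x mod q = u * y mod q"
    then have "[u * x = u * y] (mod q)" by (simp add: cong_def)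
    then have "[x = y] (mod q)" using u(1) by (simp add: cong_mult_lcancel_nat)
    then show "x = y" using xy by (simp add: cong_def)
  qed
  moreover have "(\<lambda>n. u * n mod q) ` {..<q} \<subseteq> {..<q}" using q by auto
  ultimately have "bij_betw (\<lambda>n. u * n mod q) {..<q} {..<q}"
    by (simp add: bij_betw_def endo_inj_surj)
  then have "(\<Sum>n<q. f n) = (\<Sum>n<q. f (u * n mod q))"
    by (rule sum.reindex_bij_betw[symmetric])
  also have "\<dots> = - (\<Sum>n<q. f n)"
    by (simp add: per' mult u(2) sum_negf)
  finally show ?thesis by simp
qed

text \<open>Whole periods sum to 0, so they can be removed until fewer than q terms remain.\<close>

lemma abs_sum_periodic_le:
  fixes f :: "nat \<Rightarrow> int"
  assumes per: "\<And>n. f (n + q) = f n" and zero: "(\<Sum>n<q. f n) = 0"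
    and bd: "\<And>n. \<bar>f n\<bar> \<le> 1" and q: "q > 0"
  shows "\<bar>\<Sum>n<N. f n\<bar> \<le> int q"
proof (induction N rule: nat_less_induct)
  case (1 N)
  show ?case
  proof (cases "N < q")
    case True
    have "\<bar>\<Sum>n<N. f n\<bar> \<le> (\<Sum>n<N. 1)" by (intro sum_abs[THEN order_trans] sum_mono bd)
    then show ?thesis using True by simp
  next
    case False
    then have N: "N = (N - q) + q" by simp
    have "(\<Sum>n<N. f n) = (\<Sum>n<q. f n) + (\<Sum>n\<in>{q..<(N - q) + q}. f n)"
      using False by (subst sum.union_disjoint[symmetric]) (auto intro!: sum.cong)
    also have "(\<Sum>n\<in>{q..<(N - q) + q}. f n) = (\<Sum>n<N - q. f (n + q))"
      using sum.shift_bounds_nat_ivl[of f 0 q "N - q"] by (simp add: lessThan_atLeast0)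
    also have "\<dots> = (\<Sum>n<N - q. f n)" by (simp add: per)
    finally show ?thesis using 1[rule_format, of "N - q"] zero q False by simp
  qed
qed

lemma abs_cmult_le: "(\<And>p. \<bar>g p\<bar> \<le> 1) \<Longrightarrow> \<bar>cmult g n\<bar> \<le> 1"
  unfolding cmult_def abs_prod power_abs by (intro prod_le_1 conjI power_le_one) auto

lemma abs_psi8_le: "\<bar>psi8 d n\<bar> \<le> 1"
proof -
  have "\<bar>\<Prod>p\<in>prime_factors d. eps4 n ^ ((p - 1) div 2) * Legendre (int n) (int p)\<bar> \<le> 1"
    unfolding abs_prod abs_mult power_abs
    by (intro prod_le_1 conjI mult_le_one power_le_one abs_Legendre_le mult_nonneg_nonneg)
       (auto simp: eps4_def)
  moreover have "\<bar>eps8 n\<bar> \<le> 1" by (simp add: eps8_def)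
  ultimately show ?thesis unfolding psi8_def abs_mult by (intro mult_le_one) auto
qed

lemma abs_sum_psi8_le:
  assumes d: "odd d"
  shows "\<bar>\<Sum>n<N. psi8 d n\<bar> \<le> int (8 * d)"
proof -
  have d0: "d > 0" using d by (intro Nat.gr0I) auto
  have "coprime 8 d" using d coprime_power_left_iff[of "2::nat" 3 d] by simp
  \<comment> \<open>A witness that the character is nontrivial for every odd d: 5 modulo 8 gives
    \<open>eps8 u = -1\<close> and \<open>eps4 u = 1\<close>, while 1 modulo d makes all Legendre
    factors 1.\<close>
  then obtain u where u: "[u = 5] (mod 8)" "[u = 1] (mod d)"
    using binary_chinese_remainder_nat by blast
  have "odd u" using u(1) unfolding cong_def by presburger
  then have "coprime u 8" using coprime_power_right_iff[of u "2::nat" 3] by simp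
  moreover have "coprime u d" using u(2) by (metis cong_imp_coprime coprime_1_left cong_sym)
  ultimately have cop: "coprime u (8 * d)" by simp
  have u8: "u mod 8 = 5" using u(1) by (simp add: cong_def)
  then have "u mod 4 = 1" "odd u" by presburger+
  then have "eps4 u = 1" by (simp add: eps4_def)
  moreover have "eps8 u = -1" using u8 \<open>odd u\<close> by (simp add: eps8_def)
  moreover have "Legendre (int u) (int p) = 1" if "p \<in> prime_factors d" for p
  proof -
    have "[u = 1] (mod p)" using that u(2) by (auto intro: cong_dvd_modulus_nat)
    then have "[int u = 1] (mod int p)" by (metis cong_int_iff of_nat_1)
    then have "Legendre (int u) (int p) = Legendre 1 (int p)" by (rule Legendre_cong)
    then show ?thesis using Legendre_one odd_prime_factor_gt_2[OF d that] by simp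
  qed
  ultimately have "psi8 d u = -1" by (simp add: psi8_def)
  then have "(\<Sum>n<8 * d. psi8 d n) = 0"
    using cop d0 by (intro sum_multiplicative_periodic_eq_0[of _ _ u] psi8_mult[OF d] psi8_periodic) auto
  then show ?thesis
    using d0 by (intro abs_sum_periodic_le psi8_periodic abs_psi8_le) auto
qed

section \<open>Character sums over odd squarefree discriminants\<close>

text \<open>The Jacobi symbol (n/m). The modulus comes first because the sums below run over n at
  fixed m.\<close>

definition jacobi :: "nat \<Rightarrow> nat \<Rightarrow> int" where
  "jacobi m n = cmult (\<lambda>p. Legendre (int n) (int p)) m"

lemma jacobi_mult: "odd m \<Longrightarrow> jacobi m (a * b) = jacobi m a * jacobi m b"
  unfolding jacobi_def cmult_def prod.distrib[symmetric]
  using odd_prime_factor_gt_2[of m]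
  by (intro prod.cong) (auto simp: Legendre_mult power_mult_distrib)

lemma jacobi_periodic: "jacobi m (n + m) = jacobi m n"
  unfolding jacobi_def cmult_def
  by (intro prod.cong refl arg_cong2[where f = power] Legendre_cong) (auto simp: cong_iff_dvd_diff)

lemma abs_jacobi_le: "\<bar>jacobi m n\<bar> \<le> 1"
  unfolding jacobi_def by (intro abs_cmult_le abs_Legendre_le)

lemma ex_odd_multiplicity:
  assumes "m > 0" "\<not> (\<exists>r. m = r ^ 2)"
  shows "\<exists>p::nat. prime p \<and> odd (multiplicity p m)"
proof -
  have "squarefree_part m \<noteq> 1"
    using assms squarefree_decompose[of m] by (metis mult_1)
  then obtain p where p: "prime p" "p dvd squarefree_part m"
    using prime_factor_nat by blast
  then have "multiplicity p (squarefree_part m) \<noteq> 0"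
    using prime_multiplicity_gt_zero_iff[of p "squarefree_part m"] by (auto simp: prime_imp_prime_elem)
  then show ?thesis
    using p prime_multiplicity_squarefree_part[OF p(1), of m] by (auto simp: odd_iff_mod_2_eq_one)
qed

text \<open>A non-square m has a prime p with odd exponent v. Choose u to be a nonresidue modulo p
  and 1 modulo the rest of m; only the factor (-1)^v = -1 survives.\<close>

lemma ex_jacobi_eq_minus_1:
  assumes m: "odd m" "\<not> (\<exists>r. m = r ^ 2)"
  shows "\<exists>u. coprime u m \<and> jacobi m u = -1"
proof -
  have m0: "m > 0" using m(1) by (intro Nat.gr0I) auto
  obtain p where p: "prime p" "odd (multiplicity p m)"
    using ex_odd_multiplicity[OF m0 m(2)] by blast
  define v where "v = multiplicity p m"
  obtain m' where m': "m = p ^ v * m'" "\<not> p dvd m'"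
    using multiplicity_decompose'[of m p] m0 p unfolding v_def by (metis not_prime_unit not_gr_zero)
  have v: "odd v" "v > 0" using p(2) by (auto simp: v_def intro!: Nat.gr0I)
  have pm: "p \<in> prime_factors m" using p v m0 m' by (auto simp: prime_factors_dvd)
  have p2: "2 < p" using odd_prime_factor_gt_2[OF m(1) pm] by simp
  obtain c where c: "Legendre (int c) (int p) = -1"
    using ex_quadratic_nonresidue[OF p(1) p2] by blast
  have cop: "coprime p m'" using m'(2) p(1) by (simp add: prime_imp_coprime)
  then obtain u where u: "[u = c] (mod p)" "[u = 1] (mod m')"
    using binary_chinese_remainder_nat by blast
  have Lp: "Legendre (int u) (int p) = -1"
    using c u(1) Legendre_cong[of "int u" "int c" "int p"] by (simp add: cong_int_iff)
  then have "\<not> int p dvd int u" using Legendre_eq_0_iff[of "int u" "int p"] by auto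
  then have "\<not> p dvd u" by simp
  then have "coprime u p" using prime_imp_coprime[OF p(1)] coprime_commute by blast
  moreover have "coprime u m'" using u(2) by (metis cong_imp_coprime coprime_1_left cong_sym)
  ultimately have "coprime u m" unfolding m'(1) by simp
  moreover have "jacobi m u = -1"
  proof -
    have "jacobi m u = Legendre (int u) (int p) ^ v *
        (\<Prod>q\<in>prime_factors m - {p}. Legendre (int u) (int q) ^ multiplicity q m)"
      unfolding jacobi_def cmult_def v_def using pm by (subst prod.remove) auto
    also have "(\<Prod>q\<in>prime_factors m - {p}. Legendre (int u) (int q) ^ multiplicity q m) = 1"
    proof (rule prod.neutral, rule ballI)
      fix q assume q: "q \<in> prime_factors m - {p}"
      then have q': "prime q" "2 < q" "q dvd m" "q \<noteq> p"
        using odd_prime_factor_gt_2[OF m(1), of q] by auto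
      then have "\<not> q dvd p ^ v" using p(1) by (metis prime_dvd_power primes_dvd_imp_eq)
      then have "q dvd m'" using q' m'(1) prime_dvd_mult_iff by blast
      then have "[u = 1] (mod q)" using u(2) by (auto intro: cong_dvd_modulus_nat)
      then have "[int u = 1] (mod int q)" by (metis cong_int_iff of_nat_1)
      then have "Legendre (int u) (int q) = Legendre 1 (int q)" by (rule Legendre_cong)
      then show "Legendre (int u) (int q) ^ multiplicity q m = 1"
        using Legendre_one[of q] q' by simp
    qed
    finally show ?thesis using v Lp by simp
  qed
  ultimately show ?thesis by blast
qed

lemma abs_sum_jacobi_le:
  assumes m: "odd m" "\<not> (\<exists>r. m = r ^ 2)"
  shows "\<bar>\<Sum>n=1..N. jacobi m n\<bar> \<le> 2 * int m"
proof -
  have m0: "m > 0" using m(1) by (intro Nat.gr0I) auto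
  obtain u where u: "coprime u m" "jacobi m u = -1" using ex_jacobi_eq_minus_1[OF m] by blast
  have "(\<Sum>n<m. jacobi m n) = 0"
    by (intro sum_multiplicative_periodic_eq_0[of _ _ u] jacobi_mult jacobi_periodic m u m0)
  then have "\<bar>\<Sum>n<Suc N. jacobi m n\<bar> \<le> int m"
    by (intro abs_sum_periodic_le jacobi_periodic abs_jacobi_le m0)
  moreover have "(\<Sum>n<Suc N. jacobi m n) = jacobi m 0 + (\<Sum>n=1..N. jacobi m n)"
  proof -
    have "{..<Suc N} = insert 0 {1..N}" by auto
    then show ?thesis by simp
  qed
  ultimately show ?thesis using abs_jacobi_le[of m 0] m0 by linarith
qed

text \<open>The even terms form \<open>jacobi m 2\<close> times a sum of the same kind up to N div
  2, so twice the bound for full intervals suffices.\<close>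

lemma abs_sum_jacobi_odd_le:
  assumes m: "odd m" "\<not> (\<exists>r. m = r ^ 2)"
  shows "\<bar>\<Sum>n | 0 < n \<and> n \<le> N \<and> odd n. jacobi m n\<bar> \<le> 4 * int m"
proof -
  have "(\<Sum>n=1..N. jacobi m n) = (\<Sum>n | 0 < n \<and> n \<le> N \<and> odd n. jacobi m n)
      + (\<Sum>n | 0 < n \<and> n \<le> N \<and> even n. jacobi m n)"
    by (subst sum.union_disjoint[symmetric]) (auto intro!: sum.cong)
  also have "(\<Sum>n | 0 < n \<and> n \<le> N \<and> even n. jacobi m n) = (\<Sum>n=1..N div 2. jacobi m (2 * n))"
    by (rule sum.reindex_bij_witness[of _ "\<lambda>n. 2 * n" "\<lambda>n. n div 2"]) auto
  also have "\<dots> = jacobi m 2 * (\<Sum>n=1..N div 2. jacobi m n)"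
    by (simp add: jacobi_mult[OF m(1)] sum_distrib_left)
  finally have *: "(\<Sum>n | 0 < n \<and> n \<le> N \<and> odd n. jacobi m n)
      = (\<Sum>n=1..N. jacobi m n) - jacobi m 2 * (\<Sum>n=1..N div 2. jacobi m n)" by simp
  have "\<bar>jacobi m 2 * (\<Sum>n=1..N div 2. jacobi m n)\<bar> \<le> 1 * (2 * int m)"
    unfolding abs_mult by (intro mult_mono abs_jacobi_le abs_sum_jacobi_le[OF m]) auto
  then show ?thesis using abs_sum_jacobi_le[OF m, of N] unfolding * by linarith
qed

section \<open>From odd integers to odd squarefree integers\<close>

lemma square_part_square_mult:
  assumes "a > 0" "squarefree d" shows "square_part (a ^ 2 * d) = (a::nat)"
proof (rule multiplicity_eq_nat)
  have d: "d > 0" using assms(2) by (intro Nat.gr0I) auto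
  show "0 < square_part (a\<^sup>2 * d)" "0 < a" using assms(1) d by (auto intro!: Nat.gr0I)
  fix p :: nat assume p: "prime p"
  have "multiplicity p d \<le> 1" using assms(2) p d by (simp add: squarefree_factorial_semiring'')
  then show "multiplicity p (square_part (a\<^sup>2 * d)) = multiplicity p a"
    using p assms(1) d
    by (simp add: prime_multiplicity_square_part prime_elem_multiplicity_mult_distrib
        prime_elem_multiplicity_power_distrib)
qed

lemma squarefree_part_square_mult:
  assumes "a > 0" "squarefree d" shows "squarefree_part (a ^ 2 * d) = (d::nat)"
  using squarefree_decompose[of "a ^ 2 * d"] square_part_square_mult[OF assms] assms(1)
  by (simp add: mult.commute)

lemma sum_odd_eq_sum_squarefree:
  fixes f :: "nat \<Rightarrow> int"
  assumes mult: "\<And>a b. f (a * b) = f a * f b"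
  shows "(\<Sum>n | 0 < n \<and> n \<le> N \<and> odd n. f n) =
    (\<Sum>a | odd a \<and> a ^ 2 \<le> N. f a ^ 2 * (\<Sum>d | 0 < d \<and> d \<le> N div a ^ 2 \<and> odd d \<and> squarefree d. f d))"
proof -
  have fin: "finite {a. odd a \<and> a ^ 2 \<le> (N::nat)}"
    by (rule finite_subset[of _ "{..N}"]) (auto intro: order_trans[OF self_le_ge2_pow[of 2]] 
        simp: power2_nat_le_imp_le)
  have pos: "(a::nat) > 0" if "odd a" for a using that by (intro Nat.gr0I) auto
  have "(\<Sum>a | odd a \<and> a ^ 2 \<le> N. f a ^ 2 * (\<Sum>d | 0 < d \<and> d \<le> N div a ^ 2 \<and> odd d \<and> squarefree d. f d))
     = (\<Sum>(a, d) \<in> (SIGMA a:{a. odd a \<and> a ^ 2 \<le> N}. {d. 0 < d \<and> d \<le> N div a ^ 2 \<and> odd d \<and> squarefree d}). f (a ^ 2 * d))"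
    unfolding sum_distrib_left by (subst sum.Sigma[OF fin]) (auto simp: mult power2_eq_square)
  also have "\<dots> = (\<Sum>n | 0 < n \<and> n \<le> N \<and> odd n. f n)"
  proof (rule sum.reindex_bij_witness[of _ "\<lambda>n. (square_part n, squarefree_part n)" "\<lambda>(a, d). a ^ 2 * d"])
    fix x assume "x \<in> (SIGMA a:{a. odd a \<and> a ^ 2 \<le> N}. {d. 0 < d \<and> d \<le> N div a ^ 2 \<and> odd d \<and> squarefree d})"
    then obtain a d where x: "x = (a, d)" "odd a" "a ^ 2 \<le> N" "0 < d" "d \<le> N div a ^ 2" "odd d" "squarefree d"
      by auto
    have a0: "a > 0" using pos x by blast
    have le: "a ^ 2 * d \<le> N" using x(5) a0 by (simp add: less_eq_div_iff_mult_less_eq mult.commute)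
    show "(case x of (a, d) \<Rightarrow> a ^ 2 * d) \<in> {n. 0 < n \<and> n \<le> N \<and> odd n}"
      using x a0 le by simp
    have "square_part (a ^ 2 * d) = a" "squarefree_part (a ^ 2 * d) = d"
      using square_part_square_mult[OF a0 x(7)] squarefree_part_square_mult[OF a0 x(7)] by simp_all
    then show "(\<lambda>n. (square_part n, squarefree_part n)) (case x of (a, d) \<Rightarrow> a ^ 2 * d) = x"
      using x by simp
    show "f (case x of (a, d) \<Rightarrow> a ^ 2 * d) = (case x of (a, d) \<Rightarrow> f (a ^ 2 * d))" using x by simp
  next
    fix n assume n: "n \<in> {n. 0 < n \<and> n \<le> N \<and> odd n}"
    have dec: "(square_part n) ^ 2 * squarefree_part n = n"
      using squarefree_decompose[of n] by (simp add: mult.commute)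
    then show "(case (square_part n, squarefree_part n) of (a, d) \<Rightarrow> a ^ 2 * d) = n" by simp
    have o: "odd (square_part n)" "odd (squarefree_part n)"
      using n dec by (metis (lifting) even_mult_iff even_power mem_Collect_eq zero_less_numeral)+
    have pp: "square_part n ^ 2 > 0" using pos[OF o(1)] by simp
    have "square_part n ^ 2 \<le> N" 
      using n dec pos[OF o(2)] by (metis (lifting) dvd_imp_le dvd_triv_left le_trans mem_Collect_eq)
    moreover have "squarefree_part n \<le> N div square_part n ^ 2"
      using n dec pp by (simp add: less_eq_div_iff_mult_less_eq mult.commute)
    ultimately show "(square_part n, squarefree_part n) \<in> (SIGMA a:{a. odd a \<and> a ^ 2 \<le> N}. {d. 0 < d \<and> d \<le> N div a ^ 2 \<and> odd d \<and> squarefree d})"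
      using o pos[OF o(2)] by auto
  qed
  finally show ?thesis by simp
qed

text \<open>Comparison with an integral: the mean value theorem for x^(-3/4) on an interval of
  length 2 bounds each term by 2/3 of the drop of that function. What matters later is that the
  total stays below 1.\<close>

lemma sum_odd_powr_le: "(\<Sum>j=1..J. real (2 * j + 1) powr (- 7/4)) \<le> 2/3 * (1 - real (2 * J + 1) powr (- 3/4))"
proof (induction J)
  case (Suc J)
  let ?u = "real (2 * J + 1)" and ?v = "real (2 * Suc J + 1)"
  have "\<exists>z. z > ?u \<and> z < ?v \<and> ?v powr (-3/4) - ?u powr (-3/4) = (?v - ?u) * ((-3/4) * z powr (-3/4 - 1))"
  proof (rule MVT2)
    fix x assume "?u \<le> x" "x \<le> ?v"
    then show "((\<lambda>x. x powr (-3/4)) has_real_derivative (-3/4) * x powr (-3/4 - 1)) (at x)"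
      by (intro has_real_derivative_powr) auto
  qed auto
  then obtain z where z: "z > ?u" "z < ?v"
    "?v powr (-3/4) - ?u powr (-3/4) = (?v - ?u) * ((-3/4) * z powr (-3/4 - 1))" by blast
  have "?v powr (-7/4) \<le> z powr (-7/4)" using z by (intro powr_mono2') auto
  then have "?v powr (-7/4) \<le> 2/3 * (?u powr (-3/4) - ?v powr (-3/4))" using z(3) by simp
  then show ?case using Suc by (simp add: algebra_simps)
qed simp

text \<open>Writing an odd number as \<open>a\<^sup>2 d\<close> with \<open>d\<close> squarefree gives the recursion
  \<open>g(N) = f(N) - \<Sum>\<^bsub>a \<ge> 3\<^esub> \<plusminus> g(N/a\<^sup>2)\<close> between the sums over squarefree and over all odd numbers, where \<open>f\<close>
  is bounded. The exponent 7/8 closes the induction because \<open>\<Sum> a\<^bsup>-7/4\<^esup>\<close> over odd \<open>a \<ge> 3\<close> is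
  less than 1.\<close>

lemma abs_sum_jacobi_squarefree_le:
  assumes m: "odd m" "\<not> (\<exists>r. m = r ^ 2)"
  shows "\<bar>real_of_int (\<Sum>d | 0 < d \<and> d \<le> N \<and> odd d \<and> squarefree d. jacobi m d)\<bar> \<le> 12 * real m * real N powr (7/8)"
proof (induction N rule: nat_less_induct)
  case (1 N)
  let ?g = "\<lambda>N. (\<Sum>d | 0 < d \<and> d \<le> N \<and> odd d \<and> squarefree d. jacobi m d)"
  show ?case
  proof (cases "N = 0")
    case True
    then have "{d. 0 < d \<and> d \<le> N \<and> odd d \<and> squarefree d} = {}" by auto
    then show ?thesis using True by (simp only: sum.empty) simp
  next
    case False
    then have N: "N \<ge> 1" by simp
    define A where "A = {a. odd a \<and> a ^ 2 \<le> N}"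
    have AN: "A \<subseteq> {..N}"
      unfolding A_def by (auto simp: power2_nat_le_imp_le)
    then have finA: "finite A" using finite_subset by blast
    have oneA: "1 \<in> A" using N by (simp add: A_def)
    have "(\<Sum>n | 0 < n \<and> n \<le> N \<and> odd n. jacobi m n) = (\<Sum>a\<in>A. jacobi m a ^ 2 * ?g (N div a ^ 2))"
      unfolding A_def by (rule sum_odd_eq_sum_squarefree[OF jacobi_mult[OF m(1)]])
    also have "\<dots> = ?g N + (\<Sum>a\<in>A - {1}. jacobi m a ^ 2 * ?g (N div a ^ 2))"
    proof -
      have "jacobi m 1 = 1"
        unfolding jacobi_def cmult_def using odd_prime_factor_gt_2[OF m(1)]
        by (intro prod.neutral) (auto simp: Legendre_one)
      then show ?thesis using sum.remove[OF finA oneA, of "\<lambda>a. jacobi m a ^ 2 * ?g (N div a ^ 2)"] by simp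
    qed
    finally have eq: "real_of_int (?g N) = real_of_int (\<Sum>n | 0 < n \<and> n \<le> N \<and> odd n. jacobi m n)
        - (\<Sum>a\<in>A - {1}. real_of_int (jacobi m a ^ 2 * ?g (N div a ^ 2)))"
      by simp
    have term_le: "\<bar>real_of_int (jacobi m a ^ 2 * ?g (N div a ^ 2))\<bar> \<le> 12 * real m * real N powr (7/8) * real a powr (-7/4)"
      if a: "a \<in> A - {1}" for a
    proof -
      have a2: "a > 1" using a unfolding A_def by (cases "a = 0") auto
      then have "a ^ 2 > 1" by (rule one_less_power) simp
      then have less: "N div a ^ 2 < N" using N by (intro div_less_dividend) auto
      have "\<bar>real_of_int (jacobi m a ^ 2 * ?g (N div a ^ 2))\<bar>
          = real_of_int \<bar>jacobi m a\<bar> ^ 2 * \<bar>real_of_int (?g (N div a ^ 2))\<bar>"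
        by (simp add: abs_mult power_abs)
      also have "\<dots> \<le> 1 * (12 * real m * real (N div a ^ 2) powr (7/8))"
        using abs_jacobi_le[of m a] 1[rule_format, OF less]
        by (intro mult_mono power_le_one) auto
      also have "real (N div a ^ 2) powr (7/8) \<le> (real N / real a ^ 2) powr (7/8)"
        using of_nat_div_le_of_nat[of N "a ^ 2", where 'a = real] by (intro powr_mono2) auto
      also have "(real N / real a ^ 2) powr (7/8) = real N powr (7/8) * real a powr (-7/4)"
      proof -
        have "(real a ^ 2) powr (7/8) = real a powr (7/4)"
          using a2 by (simp add: powr_powr flip: powr_numeral)
        then show ?thesis by (simp add: powr_divide powr_minus_divide)
      qed
      finally show ?thesis by (simp add: mult_left_mono mult.assoc)
    qed
    have "\<bar>\<Sum>a\<in>A - {1}. real_of_int (jacobi m a ^ 2 * ?g (N div a ^ 2))\<bar>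
        \<le> (\<Sum>a\<in>A - {1}. 12 * real m * real N powr (7/8) * real a powr (-7/4))"
      by (intro sum_abs[THEN order_trans] sum_mono term_le)
    also have "\<dots> = 12 * real m * real N powr (7/8) * (\<Sum>a\<in>A - {1}. real a powr (-7/4))"
      by (simp add: sum_distrib_left)
    also have "(\<Sum>a\<in>A - {1}. real a powr (-7/4)) \<le> (\<Sum>a\<in>(\<lambda>j. 2 * j + 1) ` {1..N}. real a powr (-7/4))"
    proof (rule sum_mono2)
      show "A - {1} \<subseteq> (\<lambda>j. 2 * j + 1) ` {1..N}"
      proof
        fix a assume a: "a \<in> A - {1}"
        then have "odd a" "a \<le> N" "a \<noteq> 1" using AN by (auto simp: A_def)
        then show "a \<in> (\<lambda>j. 2 * j + 1) ` {1..N}"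
          by (intro image_eqI[of _ _ "a div 2"]) (auto elim!: oddE)
      qed
    qed auto
    also have "\<dots> = (\<Sum>j=1..N. real (2 * j + 1) powr (-7/4))"
      by (subst sum.reindex) (auto simp: inj_on_def)
    also have "\<dots> \<le> 2/3"
      using sum_odd_powr_le[of N] by (rule order_trans) simp
    finally have "\<bar>\<Sum>a\<in>A - {1}. real_of_int (jacobi m a ^ 2 * ?g (N div a ^ 2))\<bar>
        \<le> 12 * real m * real N powr (7/8) * (2/3)"
      by (simp add: mult_left_mono)
    moreover have "\<bar>real_of_int (\<Sum>n | 0 < n \<and> n \<le> N \<and> odd n. jacobi m n)\<bar> \<le> 4 * real m"
      using abs_sum_jacobi_odd_le[OF m, of N] by linarith
    moreover have "4 * real m \<le> 4 * real m * real N powr (7/8)"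
      using N ge_one_powr_ge_zero[of "real N" "7/8"] by (simp add: mult_le_cancel_left1)
    \<comment> \<open>The constant 12 is the solution of 4 + (2/3) * 12 = 12.\<close>
    ultimately show ?thesis unfolding eq by linarith
  qed
qed

text \<open>Reads the symbol as a function of d at fixed m, using its definition over the primes of
  m instead of the reciprocal form.\<close>

lemma psi8_eq_jacobi:
  assumes d: "odd d" "squarefree d" and m: "odd m"
  shows "psi8 d m = jacobi m (8 * d)"
proof -
  have "m > 0" using m by (intro Nat.gr0I) auto
  then have "psi8 d m = cmult (kronecker_prime (8 * int d)) m"
    unfolding kronecker_8_eq_psi8[OF d, symmetric] by (simp add: kronecker_def cmult_def)
  also have "\<dots> = jacobi m (8 * d)"
    unfolding jacobi_def cmult_def using odd_prime_factor_gt_2[OF m]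
    by (intro prod.cong) (auto simp: kronecker_prime_def)
  finally show ?thesis .
qed

lemma abs_sum_psi8_squarefree_le:
  assumes m: "odd m" "\<not> (\<exists>r. m = r ^ 2)"
  shows "\<bar>real_of_int (\<Sum>d | 0 < d \<and> d \<le> N \<and> odd d \<and> squarefree d. psi8 d m)\<bar> \<le> 12 * real m * real N powr (7/8)"
proof -
  have "(\<Sum>d | 0 < d \<and> d \<le> N \<and> odd d \<and> squarefree d. psi8 d m)
      = jacobi m 8 * (\<Sum>d | 0 < d \<and> d \<le> N \<and> odd d \<and> squarefree d. jacobi m d)"
    unfolding sum_distrib_left
    by (intro sum.cong) (auto simp: psi8_eq_jacobi m jacobi_mult)
  then have "\<bar>real_of_int (\<Sum>d | 0 < d \<and> d \<le> N \<and> odd d \<and> squarefree d. psi8 d m)\<bar>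
     = real_of_int \<bar>jacobi m 8\<bar> * \<bar>real_of_int (\<Sum>d | 0 < d \<and> d \<le> N \<and> odd d \<and> squarefree d. jacobi m d)\<bar>"
    by (simp add: abs_mult)
  also have "\<dots> \<le> 1 * (12 * real m * real N powr (7/8))"
  proof (rule mult_mono)
    show "real_of_int \<bar>jacobi m 8\<bar> \<le> 1" using abs_jacobi_le[of m 8] by simp
  qed (rule abs_sum_jacobi_squarefree_le[OF m], auto)
  finally show ?thesis by simp
qed

section \<open>Reciprocal sums over coprime and squarefree integers\<close>

text \<open>Two solutions j differ by a multiple of p, so each block of p consecutive j contains at
  most one.\<close>

lemma card_dvd_progression:
  fixes p q r J :: nat
  assumes "coprime p q" "p > 0"
  shows "real (card {j\<in>{..<J}. p dvd r + q * j}) \<le> real J / real p + 1"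
proof -
  have eq: "x = y" if "x \<le> y" "x div p = y div p" "p dvd r + q * x" "p dvd r + q * y" for x y
  proof -
    have "p dvd (r + q * y) - (r + q * x)" using that by (intro dvd_diff_nat)
    also have "(r + q * y) - (r + q * x) = q * (y - x)" by (simp add: diff_mult_distrib2)
    finally have "p dvd y - x" using assms(1) by (simp add: coprime_dvd_mult_right_iff)
    then have "x mod p = y mod p" using that(1) by (metis mod_eq_dvd_iff_nat)
    then show ?thesis using that(2) by (metis div_mult_mod_eq)
  qed
  have "inj_on (\<lambda>j. j div p) {j\<in>{..<J}. p dvd r + q * j}"
    by (rule inj_onI) (metis (lifting) eq linear mem_Collect_eq)
  then have "card {j\<in>{..<J}. p dvd r + q * j} = card ((\<lambda>j. j div p) ` {j\<in>{..<J}. p dvd r + q * j})"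
    by (simp add: card_image)
  also have "\<dots> \<le> card {..J div p}"
    by (intro card_mono) (auto intro: div_le_mono)
  finally have "real (card {j\<in>{..<J}. p dvd r + q * j}) \<le> real (J div p) + 1" by simp
  then show ?thesis using of_nat_div_le_of_nat[of J p, where 'a = real] by linarith
qed

text \<open>Telescoping from 1/n^2 <= 1/(n - 1) - 1/n.\<close>

lemma sum_inverse_squares_le:
  assumes "P > 0" "A \<subseteq> {P<..M}"
  shows "(\<Sum>n\<in>A. 1 / real n ^ 2) \<le> 1 / real P"
proof -
  have *: "(\<Sum>n\<in>{P<..P + k}. 1 / real n ^ 2) \<le> 1 / real P - 1 / real (P + k)" for k
  proof (induction k)
    case (Suc k)
    have "{P<..P + Suc k} = insert (P + Suc k) {P<..P + k}" by auto
    moreover have "1 / real (P + Suc k) ^ 2 \<le> 1 / real (P + k) - 1 / real (P + Suc k)"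
    proof -
      have "1 / real (P + k) - 1 / real (P + Suc k) = 1 / (real (P + k) * real (P + Suc k))"
        using assms(1) by (simp add: field_simps)
      also have "\<dots> \<ge> 1 / (real (P + Suc k) * real (P + Suc k))"
        using assms(1) by (intro divide_left_mono mult_right_mono) auto
      finally show ?thesis by (simp add: power2_eq_square)
    qed
    ultimately show ?case using Suc by simp
  qed simp
  have "(\<Sum>n\<in>A. 1 / real n ^ 2) \<le> (\<Sum>n\<in>{P<..P + M}. 1 / real n ^ 2)"
    using assms by (intro sum_mono2) auto
  also have "\<dots> \<le> 1 / real P - 1 / real (P + M)" by (rule *)
  also have "\<dots> \<le> 1 / real P" by simp
  finally show ?thesis .
qed

lemma sum_UN_le:
  fixes f :: "'a \<Rightarrow> real"
  assumes "finite I" "\<And>i. i \<in> I \<Longrightarrow> finite (A i)" "\<And>i x. i \<in> I \<Longrightarrow> x \<in> A i \<Longrightarrow> f x \<ge> 0"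
  shows "sum f (\<Union>i\<in>I. A i) \<le> (\<Sum>i\<in>I. sum f (A i))"
  using assms
proof (induction I rule: finite_induct)
  case (insert j I)
  have "sum f (\<Union>i\<in>insert j I. A i) = sum f (A j \<union> (\<Union>i\<in>I. A i))" by simp
  also have "\<dots> \<le> sum f (A j) + sum f (\<Union>i\<in>I. A i)"
  proof -
    have "0 \<le> sum f (A j \<inter> (\<Union>i\<in>I. A i))" using insert.prems by (intro sum_nonneg) auto
    moreover have "sum f (A j \<union> (\<Union>i\<in>I. A i)) + sum f (A j \<inter> (\<Union>i\<in>I. A i)) = sum f (A j) + sum f (\<Union>i\<in>I. A i)"
      using insert.hyps insert.prems by (intro sum.union_inter) auto
    ultimately show ?thesis by linarith
  qed
  also have "\<dots> \<le> sum f (A j) + (\<Sum>i\<in>I. sum f (A i))" using insert by auto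
  finally show ?case using insert by simp
qed simp

lemma sum_Un_le:
  fixes f :: "'a \<Rightarrow> real"
  assumes "finite A" "finite B" "\<And>x. f x \<ge> 0"
  shows "sum f (A \<union> B) \<le> sum f A + sum f B"
  using sum.union_inter[of A B f] sum_nonneg[of "A \<inter> B" f] assms by auto

lemma coprime_fact_prime_factor:
  assumes "coprime a (fact P :: nat)" "prime p" "p dvd a" shows "P < p"
proof (rule ccontr)
  assume "\<not> P < p"
  then have "p dvd fact P" using assms(2) by (simp add: prime_dvd_fact_iff)
  with assms show False by (meson not_coprimeI not_prime_unit)
qed

text \<open>Since U is closed under divisors, a |-> a div q injects the multiples of q in U into U.
  In terms of the weight 1/a, divisibility by q thus has probability at most 1/q.\<close>

lemma sum_inverse_multiples_le:
  fixes U :: "nat set"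
  assumes fin: "finite U" and pos: "0 \<notin> U" and closed: "\<And>a b. a \<in> U \<Longrightarrow> b dvd a \<Longrightarrow> b \<in> U"
    and q: "q > 0"
  shows "(\<Sum>a | a \<in> U \<and> q dvd a. 1 / real a) \<le> (\<Sum>a\<in>U. 1 / real a) / real q"
proof -
  have "(\<Sum>a | a \<in> U \<and> q dvd a. 1 / real a) = (\<Sum>a | a \<in> U \<and> q * a \<in> U. 1 / real (q * a))"
    using q closed by (intro sum.reindex_bij_witness[of _ "\<lambda>a. q * a" "\<lambda>a. a div q"]) auto
  also have "\<dots> \<le> (\<Sum>a\<in>U. 1 / real (q * a))"
    by (rule sum_mono2) (use fin in auto)
  also have "\<dots> = (\<Sum>a\<in>U. 1 / real a) / real q"
    by (simp add: sum_divide_distrib mult.commute)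
  finally show ?thesis .
qed

lemma not_coprime_imp_prime:
  assumes "\<not> coprime (a::nat) b" shows "\<exists>p. prime p \<and> p dvd a \<and> p dvd b"
proof -
  have "gcd a b \<noteq> 1" using assms coprime_iff_gcd_eq_1 by blast
  then obtain p where "prime p" "p dvd gcd a b" using prime_factor_nat by blast
  then show ?thesis by auto
qed

lemma not_squarefree_prime:
  assumes "\<not> squarefree (a::nat)" "a > 0" shows "\<exists>p. prime p \<and> p ^ 2 dvd a"
proof -
  obtain x where x: "x ^ 2 dvd a" "\<not> x dvd 1" using assms(1) unfolding squarefree_def by blast
  then obtain p where "prime p" "p dvd x" using prime_factor_nat by (metis dvd_refl)
  then show ?thesis using x(1) dvd_power_same dvd_trans by blast
qed

text \<open>Union bound with the weight 1/a: divisibility by a prime p | d removes at most a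
  fraction 1/p, and divisibility by p^2 at most 1/p^2. As no element has a prime factor up to P, the
  second loss only involves p > P and is at most 1/P in total.\<close>

lemma sum_inverse_squarefree_coprime_ge:
  fixes U :: "nat set"
  assumes fin: "finite U" and pos: "0 \<notin> U" and closed: "\<And>a b. a \<in> U \<Longrightarrow> b dvd a \<Longrightarrow> b \<in> U"
    and large: "\<And>a p. a \<in> U \<Longrightarrow> prime p \<Longrightarrow> p dvd a \<Longrightarrow> P < p" and P: "P > 0" and d: "d > 0"
  shows "(\<Sum>a\<in>U. 1 / real a) * (1 - (\<Sum>p\<in>prime_factors d. 1 / real p) - 1 / real P)
     \<le> (\<Sum>a | a \<in> U \<and> squarefree a \<and> coprime a d. 1 / real a)"
proof -
  define S where "S = (\<Sum>a\<in>U. 1 / real a)"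
  have S0: "S \<ge> 0" unfolding S_def by (intro sum_nonneg) auto
  define A where "A = {a. a \<in> U \<and> squarefree a \<and> coprime a d}"
  define B where "B = (\<Union>p\<in>prime_factors d. {a. a \<in> U \<and> p dvd a})"
  define C where "C = (\<Union>p\<in>{P<..Max U}. {a. a \<in> U \<and> p ^ 2 dvd a})"
  have sub: "U \<subseteq> A \<union> (B \<union> C)"
  proof
    fix a assume a: "a \<in> U"
    then have a0: "a > 0" using pos by (intro Nat.gr0I) auto
    consider "a \<in> A" | "\<not> coprime a d" | "\<not> squarefree a" using a unfolding A_def by blast
    then show "a \<in> A \<union> (B \<union> C)"
    proof cases
      case 2
      then obtain p where "prime p" "p dvd a" "p dvd d"
        using not_coprime_imp_prime by blast
      then show ?thesis using a d by (auto simp: B_def prime_factors_dvd)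
    next
      case 3
      then obtain p where p: "prime p" "p ^ 2 dvd a" using not_squarefree_prime a0 by blast
      then have pa: "p dvd a" by (meson dvd_power dvd_trans zero_less_numeral)
      then have "P < p" using large a p by blast
      moreover have "p \<le> Max U" using pa a0 dvd_imp_le Max_ge[OF fin a] le_trans by blast
      ultimately show ?thesis using a p by (auto simp: C_def)
    qed auto
  qed
  have finABC: "finite A" "finite B" "finite C"
    unfolding A_def B_def C_def using fin by auto
  have "S \<le> sum (\<lambda>a. 1 / real a) (A \<union> (B \<union> C))"
    unfolding S_def using sub finABC by (intro sum_mono2) auto
  also have "\<dots> \<le> sum (\<lambda>a. 1 / real a) A + sum (\<lambda>a. 1 / real a) B + sum (\<lambda>a. 1 / real a) C"
    using sum_Un_le[of A "B \<union> C" "\<lambda>a. 1 / real a"] sum_Un_le[of B C "\<lambda>a. 1 / real a"] finABC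
    by simp
  also have "sum (\<lambda>a. 1 / real a) B \<le> (\<Sum>p\<in>prime_factors d. \<Sum>a | a \<in> U \<and> p dvd a. 1 / real a)"
    unfolding B_def using fin by (intro sum_UN_le) auto
  also have "\<dots> \<le> (\<Sum>p\<in>prime_factors d. S / real p)"
    unfolding S_def using fin pos closed prime_gt_0_nat by (intro sum_mono sum_inverse_multiples_le) auto
  also have "\<dots> = S * (\<Sum>p\<in>prime_factors d. 1 / real p)" by (simp add: sum_distrib_left)
  also have "sum (\<lambda>a. 1 / real a) C \<le> (\<Sum>p\<in>{P<..Max U}. \<Sum>a | a \<in> U \<and> p ^ 2 dvd a. 1 / real a)"
    unfolding C_def using fin by (intro sum_UN_le) auto
  also have "\<dots> \<le> (\<Sum>p\<in>{P<..Max U}. S / real (p ^ 2))"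
    unfolding S_def using fin pos closed by (intro sum_mono sum_inverse_multiples_le) auto
  also have "\<dots> = S * (\<Sum>p\<in>{P<..Max U}. 1 / real p ^ 2)" by (simp add: sum_distrib_left)
  also have "\<dots> \<le> S * (1 / real P)"
    using S0 P by (intro mult_left_mono sum_inverse_squares_le) auto
  finally show ?thesis unfolding S_def[symmetric] A_def[symmetric] by (simp add: algebra_simps)
qed

text \<open>Again a union bound, now over ordered pairs of coordinates and common primes p > P; each
  such event removes at most a fraction 1/p^2. Excluding small primes makes coprimality cheap
  without any Euler product.\<close>

lemma sum_inverse_pairwise_coprime_ge:
  fixes U :: "nat set" and E :: "'e set"
  assumes fin: "finite U" and pos: "0 \<notin> U" and closed: "\<And>a b. a \<in> U \<Longrightarrow> b dvd a \<Longrightarrow> b \<in> U"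
    and large: "\<And>a p. a \<in> U \<Longrightarrow> prime p \<Longrightarrow> p dvd a \<Longrightarrow> P < p" and P: "P > 0" and E: "finite E"
  shows "(\<Sum>a\<in>U. 1 / real a) ^ card E * (1 - real (card E) ^ 2 / real P)
     \<le> (\<Sum>a | a \<in> (E \<rightarrow>\<^sub>E U) \<and> (\<forall>e\<in>E. \<forall>f\<in>E. e \<noteq> f \<longrightarrow> coprime (a e) (a f)). \<Prod>e\<in>E. 1 / real (a e))"
proof -
  define S where "S = (\<Sum>a\<in>U. 1 / real a)"
  have S0: "S \<ge> 0" unfolding S_def by (intro sum_nonneg) auto
  define G where "G = {a. a \<in> (E \<rightarrow>\<^sub>E U) \<and> (\<forall>e\<in>E. \<forall>f\<in>E. e \<noteq> f \<longrightarrow> coprime (a e) (a f))}"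
  define R where "R = {(e, f). e \<in> E \<and> f \<in> E \<and> e \<noteq> f}"
  define D where "D = (\<lambda>((e, f), p). {a. a \<in> (E \<rightarrow>\<^sub>E U) \<and> p dvd a e \<and> p dvd a f})"
  define w where "w = (\<lambda>a. \<Prod>e\<in>E. 1 / real (a e))"
  have finPi: "finite (E \<rightarrow>\<^sub>E U)" using fin E by (simp add: finite_PiE)
  have finR: "finite R" unfolding R_def using E by (auto intro: finite_subset[of _ "E \<times> E"])
  have cardR: "card R \<le> card E ^ 2"
    unfolding R_def power2_eq_square card_cartesian_product[symmetric] using E by (intro card_mono) auto
  have w0: "w a \<ge> 0" for a unfolding w_def by (intro prod_nonneg) auto
  have sub: "(E \<rightarrow>\<^sub>E U) \<subseteq> G \<union> (\<Union>x\<in>R \<times> {P<..Max U}. D x)"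
  proof
    fix a assume a: "a \<in> E \<rightarrow>\<^sub>E U"
    show "a \<in> G \<union> (\<Union>x\<in>R \<times> {P<..Max U}. D x)"
    proof (cases "a \<in> G")
      case False
      then obtain e f where ef: "e \<in> E" "f \<in> E" "e \<noteq> f" "\<not> coprime (a e) (a f)"
        using a unfolding G_def by blast
      then obtain p where p: "prime p" "p dvd a e" "p dvd a f"
        using not_coprime_imp_prime by blast
      have ae: "a e \<in> U" using a ef by auto
      then have "a e > 0" using pos by (intro Nat.gr0I) auto
      then have "p \<le> Max U" using p dvd_imp_le Max_ge[OF fin ae] le_trans by blast
      moreover have "P < p" using large ae p by blast
      ultimately have "((e, f), p) \<in> R \<times> {P<..Max U}" using ef by (auto simp: R_def)
      moreover have "a \<in> D ((e, f), p)" unfolding D_def using a p by auto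
      ultimately show ?thesis by blast
    qed simp
  qed
  have finD: "finite (D x)" for x
    unfolding D_def using finPi by (auto split: prod.splits)
  have Dle: "sum w (D ((e, f), p)) \<le> S ^ card E * (1 / real p ^ 2)"
    if ef: "(e, f) \<in> R" and p: "p > 0" for e f p
  proof -
    have R: "e \<in> E" "f \<in> E" "e \<noteq> f" using ef by (auto simp: R_def)
    \<comment> \<open>Divisibility by p at e and f constrains these two coordinates separately, so
      the set is still a product and its weighted sum factorises.\<close>
    define V where "V = (\<lambda>g. if g = e \<or> g = f then {a. a \<in> U \<and> p dvd a} else U)"
    have "D ((e, f), p) = PiE E V"
      unfolding D_def V_def using R by (auto simp: PiE_def Pi_def split: if_splits)
    then have "sum w (D ((e, f), p)) = (\<Prod>g\<in>E. \<Sum>a\<in>V g. 1 / real a)"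
      unfolding w_def using E fin by (subst prod_sum_PiE) (auto simp: V_def)
    also have "\<dots> \<le> (\<Prod>g\<in>E. S * (if g = e \<or> g = f then 1 / real p else 1))"
    proof (rule prod_mono)
      fix g assume "g \<in> E"
      show "0 \<le> (\<Sum>a\<in>V g. 1 / real a) \<and> (\<Sum>a\<in>V g. 1 / real a) \<le> S * (if g = e \<or> g = f then 1 / real p else 1)"
        using sum_inverse_multiples_le[OF fin pos closed p] unfolding V_def S_def
        by (auto intro!: sum_nonneg)
    qed
    also have "\<dots> = S ^ card E * (\<Prod>g\<in>E. (if g = e \<or> g = f then 1 / real p else 1))"
      by (simp add: prod.distrib)
    also have "(\<Prod>g\<in>E. (if g = e \<or> g = f then 1 / real p else 1)) = (\<Prod>g\<in>{e,f}. 1 / real p)"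
      using R E by (intro prod.mono_neutral_cong_right) auto
    also have "\<dots> = 1 / real p ^ 2" using R by (simp add: power2_eq_square)
    finally show ?thesis .
  qed
  have "S ^ card E = (\<Sum>a\<in>(E \<rightarrow>\<^sub>E U). w a)"
    unfolding w_def using prod_sum_PiE[of E "\<lambda>_. U" "\<lambda>_ a. 1 / real a"] E fin
    by (simp add: S_def)
  also have "\<dots> \<le> sum w (G \<union> (\<Union>x\<in>R \<times> {P<..Max U}. D x))"
    using sub w0 finPi finR finD by (intro sum_mono2) (auto simp: G_def)
  also have "\<dots> \<le> sum w G + sum w (\<Union>x\<in>R \<times> {P<..Max U}. D x)"
    using w0 finPi finR finD by (intro sum_Un_le) (auto simp: G_def)
  also have "sum w (\<Union>x\<in>R \<times> {P<..Max U}. D x) \<le> (\<Sum>x\<in>R \<times> {P<..Max U}. sum w (D x))"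
    using w0 finR finD by (intro sum_UN_le) auto
  also have "\<dots> \<le> (\<Sum>x\<in>R \<times> {P<..Max U}. S ^ card E * (1 / real (snd x) ^ 2))"
    by (intro sum_mono) (use Dle in force)
  also have "\<dots> = (\<Sum>x\<in>R. \<Sum>p\<in>{P<..Max U}. S ^ card E * (1 / real p ^ 2))"
    unfolding sum.cartesian_product by (intro sum.cong) auto
  also have "\<dots> = S ^ card E * (real (card R) * (\<Sum>p\<in>{P<..Max U}. 1 / real p ^ 2))"
    unfolding sum_distrib_left[symmetric] by simp
  also have "\<dots> \<le> S ^ card E * (real (card E ^ 2) * (1 / real P))"
    using S0 P cardR
    by (intro mult_left_mono mult_mono sum_inverse_squares_le of_nat_mono) (auto intro!: sum_nonneg)
  finally show ?thesis unfolding S_def[symmetric] G_def[symmetric] w_def[symmetric]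
    by (simp add: algebra_simps)
qed

text \<open>A sieve by the primes of d alone. Of J >= r/2 - 2 odd numbers in the window, at most J/4
  + r/16 share a prime with d: the J/p add up to J/4, and the rounding errors, one per prime, to
  r/16. For r >= 8 at least r/16 remain.\<close>

lemma card_odd_coprime_ge:
  fixes r :: real
  assumes r: "r \<ge> 8" and d: "d > 0" "odd d" and small: "(\<Sum>p\<in>prime_factors d. 1 / real p) \<le> 1/4"
    and om: "real (card (prime_factors d)) \<le> r / 16"
  shows "r / 16 \<le> real (card {b. odd b \<and> r \<le> real b \<and> real b \<le> 2 * r \<and> coprime b d})"
proof -
  define j0 where "j0 = nat \<lceil>r / 2\<rceil>"
  define J where "J = nat \<lfloor>r / 2\<rfloor> - 1"
  have j0: "real j0 \<ge> r / 2" "real j0 \<le> r / 2 + 1" unfolding j0_def using r by linarith+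
  have J: "real J \<ge> r / 2 - 2" "real J \<le> r / 2 - 1" unfolding J_def using r by linarith+
  define W where "W = {j\<in>{..<J}. coprime (2 * (j0 + j) + 1) d}"
  define Bad where "Bad = (\<Union>p\<in>prime_factors d. {j\<in>{..<J}. p dvd (2 * j0 + 1) + 2 * j})"
  have "{..<J} \<subseteq> W \<union> Bad"
  proof
    fix j assume j: "j \<in> {..<J}"
    show "j \<in> W \<union> Bad"
    proof (cases "coprime (2 * (j0 + j) + 1) d")
      case False
      then obtain p where "prime p" "p dvd 2 * (j0 + j) + 1" "p dvd d"
        using not_coprime_imp_prime by blast
      moreover have "2 * (j0 + j) + 1 = (2 * j0 + 1) + 2 * j" by simp
      ultimately have "p \<in> prime_factors d \<and> p dvd (2 * j0 + 1) + 2 * j"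
        using d by (metis prime_factors_dvd mem_Collect_eq neq0_conv)
      then show ?thesis using j unfolding Bad_def by blast
    qed (use j in \<open>simp add: W_def\<close>)
  qed
  then have "card {..<J} \<le> card (W \<union> Bad)"
    by (intro card_mono) (auto simp: W_def Bad_def)
  also have "\<dots> \<le> card W + card Bad" by (rule card_Un_le)
  finally have JW: "real J \<le> real (card W) + real (card Bad)" by simp
  have "card Bad \<le> (\<Sum>p\<in>prime_factors d. card {j\<in>{..<J}. p dvd (2 * j0 + 1) + 2 * j})"
    unfolding Bad_def by (intro card_UN_le) auto
  then have "real (card Bad) \<le> (\<Sum>p\<in>prime_factors d. real (card {j\<in>{..<J}. p dvd (2 * j0 + 1) + 2 * j}))"
    unfolding of_nat_sum[symmetric] of_nat_le_iff .
  also have "\<dots> \<le> (\<Sum>p\<in>prime_factors d. real J / real p + 1)"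
  proof (rule sum_mono)
    fix p assume p: "p \<in> prime_factors d"
    then have "prime p" "p dvd d" by auto
    then have "odd p" using d(2) by auto
    then show "real (card {j\<in>{..<J}. p dvd (2 * j0 + 1) + 2 * j}) \<le> real J / real p + 1"
      using \<open>prime p\<close> prime_gt_0_nat by (intro card_dvd_progression) auto
  qed
  also have "\<dots> = real J * (\<Sum>p\<in>prime_factors d. 1 / real p) + real (card (prime_factors d))"
    by (simp add: sum.distrib sum_distrib_left)
  also have "\<dots> \<le> real J * (1/4) + r / 16"
    using small om by (intro add_mono mult_left_mono) auto
  finally have Wge: "r / 16 \<le> real (card W)" using JW J r by linarith
  have "card W \<le> card {b. odd b \<and> r \<le> real b \<and> real b \<le> 2 * r \<and> coprime b d}"
  proof (rule card_inj_on_le[where f = "\<lambda>j. 2 * (j0 + j) + 1"])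
    show "finite {b. odd b \<and> r \<le> real b \<and> real b \<le> 2 * r \<and> coprime b d}"
      by (rule finite_subset[of _ "{..nat \<lfloor>2 * r\<rfloor>}"]) (auto simp: le_nat_floor)
    show "(\<lambda>j. 2 * (j0 + j) + 1) ` W \<subseteq> {b. odd b \<and> r \<le> real b \<and> real b \<le> 2 * r \<and> coprime b d}"
    proof (rule image_subsetI)
      fix j assume j: "j \<in> W"
      then have "real j \<le> real J - 1" unfolding W_def by auto
      then have "real (2 * (j0 + j) + 1) \<le> 2 * r" "r \<le> real (2 * (j0 + j) + 1)"
        using j0 J by simp_all
      then show "2 * (j0 + j) + 1 \<in> {b. odd b \<and> r \<le> real b \<and> real b \<le> 2 * r \<and> coprime b d}"
        using j unfolding W_def by simp
    qed
  qed (auto simp: inj_on_def)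
  then show ?thesis using Wge by linarith
qed

section \<open>Tuples with square product\<close>

text \<open>The window [Y, 4Y] is what b in [r, 2r] yields for b^2 Y / r^2. Coprimality to 2d
  ensures that the character of d takes the value 1, not 0, at the square product.\<close>

definition square_tuples :: "'i set \<Rightarrow> nat \<Rightarrow> real \<Rightarrow> ('i \<Rightarrow> nat) set" where
  "square_tuples I d Y = {f \<in> I \<rightarrow>\<^sub>E {n. Y \<le> real n \<and> real n \<le> 4 * Y \<and> coprime n (2 * d)}. \<exists>r. (\<Prod>i\<in>I. f i) = r ^ 2}"

lemma finite_square_tuples: "finite I \<Longrightarrow> finite (square_tuples I d Y)"
proof -
  assume I: "finite I"
  have "finite {n. Y \<le> real n \<and> real n \<le> 4 * Y \<and> coprime n (2 * d)}"
    by (rule finite_subset[of _ "{..nat \<lfloor>4 * Y\<rfloor>}"]) (auto simp: le_nat_floor)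
  then have "finite (I \<rightarrow>\<^sub>E {n. Y \<le> real n \<and> real n \<le> 4 * Y \<and> coprime n (2 * d)})"
    using I by (intro finite_PiE)
  then show ?thesis unfolding square_tuples_def by (rule rev_finite_subset) auto
qed

definition edges :: "'i set \<Rightarrow> 'i set set" where
  "edges I = {e. e \<subseteq> I \<and> card e = 2}"

definition vertex_prod :: "'i set \<Rightarrow> ('i set \<Rightarrow> nat) \<Rightarrow> 'i \<Rightarrow> nat" where
  "vertex_prod I a i = (\<Prod>e | e \<in> edges I \<and> i \<in> e. a e)"

lemma finite_edges: "finite I \<Longrightarrow> finite (edges I)"
  unfolding edges_def by simp

text \<open>Every edge is counted at both of its ends, which is what makes the product of the
  constructed n_i a square.\<close>

lemma prod_vertex_prod:
  assumes I: "finite I"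
  shows "(\<Prod>i\<in>I. vertex_prod I a i) = (\<Prod>e\<in>edges I. a e) ^ 2"
proof -
  have "(\<Prod>i\<in>I. vertex_prod I a i) = (\<Prod>e\<in>edges I. \<Prod>i | i \<in> I \<and> i \<in> e. a e)"
    unfolding vertex_prod_def by (rule prod.swap_restrict[OF I finite_edges[OF I]])
  also have "\<dots> = (\<Prod>e\<in>edges I. a e ^ 2)"
  proof (rule prod.cong[OF refl])
    fix e assume e: "e \<in> edges I"
    then have "{i. i \<in> I \<and> i \<in> e} = e" unfolding edges_def by auto
    then show "(\<Prod>i | i \<in> I \<and> i \<in> e. a e) = a e ^ 2" using e by (simp add: edges_def)
  qed
  finally show ?thesis by (simp add: prod_power_distrib)
qed

text \<open>The edge e is the only one through both i and j, so the remaining factors at i and at j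
  belong to distinct edges and are coprime.\<close>

lemma gcd_vertex_prod:
  assumes I: "finite I" and e: "e \<in> edges I" "e = {i, j}" "i \<noteq> j"
    and cop: "\<And>e f. e \<in> edges I \<Longrightarrow> f \<in> edges I \<Longrightarrow> e \<noteq> f \<Longrightarrow> coprime (a e) (a f)"
  shows "a e = gcd (vertex_prod I a i) (vertex_prod I a j)"
proof -
  define R where "R = (\<lambda>i. \<Prod>f\<in>{f. f \<in> edges I \<and> i \<in> f} - {e}. a f)"
  have *: "vertex_prod I a x = a e * R x" if "x \<in> e" for x
    unfolding vertex_prod_def R_def using e that finite_edges[OF I] by (intro prod.remove) auto
  have "coprime (R i) (R j)"
    unfolding R_def
  proof (intro prod_coprime_left prod_coprime_right)
    fix f g assume f: "f \<in> {f. f \<in> edges I \<and> i \<in> f} - {e}" and g: "g \<in> {f. f \<in> edges I \<and> j \<in> f} - {e}"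
    have "f \<noteq> g"
    proof
      assume "f = g"
      then have sub: "{i, j} \<subseteq> f" and "card f = 2" using f g by (auto simp: edges_def)
      then have "finite f" using card.infinite by fastforce
      then have "{i, j} = f" using sub \<open>card f = 2\<close> e(3) by (intro card_subset_eq) auto
      then show False using f e by auto
    qed
    then show "coprime (a f) (a g)" using f g cop by auto
  qed
  then have "gcd (a e * R i) (a e * R j) = a e" by (simp flip: gcd_mult_distrib_nat)
  then show ?thesis using * e by simp
qed

lemma sqrt_prod: "sqrt (\<Prod>i\<in>A. f i) = (\<Prod>i\<in>A. sqrt (f i))"
  by (induction A rule: infinite_finite_induct) (auto simp: real_sqrt_mult)

text \<open>The tuples are parametrised as \<open>n\<^sub>i = b\<^sub>i\<^sup>2 \<Prod>\<^bsub>e \<ni> i\<^esub> a\<^sub>e\<close>, with one variable \<open>a\<^sub>e\<close> for each edge \<open>e\<close>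
  of the complete graph on \<open>I\<close> and with \<open>b\<^sub>i\<close> running over a dyadic window that places \<open>n\<^sub>i\<close> in \<open>[Y, 4Y]\<close>.
  For squarefree and pairwise coprime \<open>a\<^sub>e\<close> this is injective: \<open>b\<^sub>i\<^sup>2\<close> is the square part of \<open>n\<^sub>i\<close>,
  and \<open>a\<^sub>e\<close> is the gcd of the squarefree parts at the two ends of \<open>e\<close>.\<close>

lemma card_square_tuples_ge:
  fixes V :: "nat set"
  defines "G \<equiv> \<lambda>I. {a. a \<in> (edges I \<rightarrow>\<^sub>E V) \<and> (\<forall>e\<in>edges I. \<forall>f\<in>edges I. e \<noteq> f \<longrightarrow> coprime (a e) (a f))}"
  assumes I: "finite I" and Y: "Y > 0" and V: "finite V" "0 \<notin> V" and sqf: "\<And>a. a \<in> V \<Longrightarrow> squarefree a"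
    and cop: "\<And>a. a \<in> V \<Longrightarrow> coprime a (2 * d)"
    and d: "d > 0" "odd d" and small: "(\<Sum>p\<in>prime_factors d. 1 / real p) \<le> 1/4"
    and r8: "\<And>a i. a \<in> G I \<Longrightarrow> i \<in> I \<Longrightarrow> sqrt (Y / vertex_prod I a i) \<ge> 8"
    and om: "\<And>a i. a \<in> G I \<Longrightarrow> i \<in> I \<Longrightarrow> real (card (prime_factors d)) \<le> sqrt (Y / vertex_prod I a i) / 16"
  shows "(1/16) ^ card I * sqrt Y ^ card I * (\<Sum>a\<in>G I. \<Prod>e\<in>edges I. 1 / real (a e))
           \<le> real (card (square_tuples I d Y))"
proof -
  note finE = finite_edges[OF I]
  define P where "P = vertex_prod I"
  define r where "r = (\<lambda>a i. sqrt (Y / P a i))"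
  define W where "W = (\<lambda>a i. {b. odd b \<and> r a i \<le> real b \<and> real b \<le> 2 * r a i \<and> coprime b d})"
  define \<Phi> where "\<Phi> = (\<lambda>(a, b). \<lambda>i\<in>I. b i ^ 2 * P a i)"
  have G_mem: "a \<in> (edges I \<rightarrow>\<^sub>E V)" "\<And>e. e \<in> edges I \<Longrightarrow> a e \<in> V"
    "\<And>e f. e \<in> edges I \<Longrightarrow> f \<in> edges I \<Longrightarrow> e \<noteq> f \<Longrightarrow> coprime (a e) (a f)" if "a \<in> G I" for a
    using that unfolding G_def by auto
  have finG: "finite (G I)"
    by (rule finite_subset[of _ "edges I \<rightarrow>\<^sub>E V"]) (use finE V in \<open>auto simp: G_def intro: finite_PiE\<close>)
  have V0: "a > 0" if "a \<in> V" for a using that V(2) by (intro Nat.gr0I) auto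
  have P0: "P a i > 0" if "a \<in> G I" for a i
    unfolding P_def vertex_prod_def using G_mem(2)[OF that] V0 by (intro prod_pos) auto
  have Psqf: "squarefree (P a i)" if "a \<in> G I" for a i
    unfolding P_def vertex_prod_def using G_mem[OF that] sqf
    by (intro squarefree_prod_coprime) auto
  have Pcop: "coprime (P a i) (2 * d)" if "a \<in> G I" for a i
    unfolding P_def vertex_prod_def using G_mem[OF that] cop by (intro prod_coprime_left) auto
  have finW: "finite (W a i)" for a i
    unfolding W_def by (rule finite_subset[of _ "{..nat \<lfloor>2 * r a i\<rfloor>}"]) (auto simp: le_nat_floor)
  have Wcard: "r a i / 16 \<le> real (card (W a i))" if "a \<in> G I" "i \<in> I" for a i
    unfolding W_def using r8[OF that] om[OF that] d small by (intro card_odd_coprime_ge) (auto simp: r_def P_def)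
  have Wpos: "b > 0" if "b \<in> W a i" for a i b using that unfolding W_def by (intro Nat.gr0I) auto
  have inj: "inj_on \<Phi> (SIGMA a:G I. PiE I (W a))"
  proof (rule inj_onI)
    fix x y assume x: "x \<in> (SIGMA a:G I. PiE I (W a))" and y: "y \<in> (SIGMA a:G I. PiE I (W a))"
      and xy: "\<Phi> x = \<Phi> y"
    obtain a b where ab: "x = (a, b)" "a \<in> G I" "b \<in> PiE I (W a)" using x by blast
    obtain a' b' where ab': "y = (a', b')" "a' \<in> G I" "b' \<in> PiE I (W a')" using y by blast
    have *: "b i = b' i \<and> P a i = P a' i" if i: "i \<in> I" for i
    proof -
      have eq: "b i ^ 2 * P a i = b' i ^ 2 * P a' i"
        using fun_cong[OF xy, of i] i unfolding ab(1) ab'(1) \<Phi>_def by simp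
      have b0: "b i > 0" "b' i > 0"
        using Wpos[of "b i" a i] Wpos[of "b' i" a' i] ab(3) ab'(3) i by auto
      have "square_part (b i ^ 2 * P a i) = b i" "square_part (b' i ^ 2 * P a' i) = b' i"
        "squarefree_part (b i ^ 2 * P a i) = P a i" "squarefree_part (b' i ^ 2 * P a' i) = P a' i"
        using b0 Psqf[OF ab(2)] Psqf[OF ab'(2)] square_part_square_mult squarefree_part_square_mult by blast+
      then show ?thesis using eq by simp
    qed
    have "a e = a' e" if e: "e \<in> edges I" for e
    proof -
      obtain i j where ij: "e = {i, j}" "i \<noteq> j" using e unfolding edges_def card_2_iff by blast
      then have "i \<in> I" "j \<in> I" using e unfolding edges_def by auto
      then have "gcd (vertex_prod I a i) (vertex_prod I a j) = gcd (vertex_prod I a' i) (vertex_prod I a' j)"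
        using * unfolding P_def by simp
      moreover have "a e = gcd (vertex_prod I a i) (vertex_prod I a j)"
        by (rule gcd_vertex_prod[OF I e ij]) (rule G_mem(3)[OF ab(2)])
      moreover have "a' e = gcd (vertex_prod I a' i) (vertex_prod I a' j)"
        by (rule gcd_vertex_prod[OF I e ij]) (rule G_mem(3)[OF ab'(2)])
      ultimately show ?thesis by simp
    qed
    then have aa: "a = a'" using PiE_ext[OF G_mem(1)[OF ab(2)] G_mem(1)[OF ab'(2)]] by blast
    then have "b' \<in> PiE I (W a)" using ab'(3) by simp
    then have "b = b'" using PiE_ext[OF ab(3)] * by blast
    then show "x = y" using ab(1) ab'(1) aa by simp
  qed
  have img: "\<Phi> ` (SIGMA a:G I. PiE I (W a)) \<subseteq> square_tuples I d Y"
  proof (rule image_subsetI)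
    fix x assume "x \<in> (SIGMA a:G I. PiE I (W a))"
    then obtain a b where ab: "x = (a, b)" "a \<in> G I" "b \<in> PiE I (W a)" by blast
    have "Y \<le> real (b i ^ 2 * P a i) \<and> real (b i ^ 2 * P a i) \<le> 4 * Y \<and> coprime (b i ^ 2 * P a i) (2 * d)"
      if i: "i \<in> I" for i
    proof -
      have b: "odd (b i)" "r a i \<le> real (b i)" "real (b i) \<le> 2 * r a i" "coprime (b i) d"
        using ab(3) i unfolding W_def by auto
      have r0: "r a i \<ge> 0" unfolding r_def using Y by simp
      have r2: "r a i ^ 2 * real (P a i) = Y" unfolding r_def using Y P0[OF ab(2), of i] by simp
      have "r a i ^ 2 \<le> real (b i) ^ 2" "real (b i) ^ 2 \<le> (2 * r a i) ^ 2"
        using b r0 by (intro power_mono; simp)+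
      then have "r a i ^ 2 * real (P a i) \<le> real (b i) ^ 2 * real (P a i)"
        "real (b i) ^ 2 * real (P a i) \<le> (2 * r a i) ^ 2 * real (P a i)"
        by (intro mult_right_mono; simp)+
      moreover have "(2 * r a i) ^ 2 * real (P a i) = 4 * Y" using r2 by (simp add: power_mult_distrib)
      moreover have "coprime (b i) (2 * d)" using b by simp
      ultimately show ?thesis using r2 Pcop[OF ab(2), of i] by simp
    qed
    moreover have "(\<Prod>i\<in>I. \<Phi> x i) = ((\<Prod>i\<in>I. b i) * (\<Prod>e\<in>edges I. a e)) ^ 2"
      unfolding ab(1) \<Phi>_def power_mult_distrib prod_vertex_prod[OF I, symmetric] P_def
      by (simp add: prod.distrib prod_power_distrib)
    ultimately show "\<Phi> x \<in> square_tuples I d Y"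
      unfolding square_tuples_def ab(1) \<Phi>_def by (auto simp: PiE_iff)
  qed
  have "real (card (SIGMA a:G I. PiE I (W a))) = (\<Sum>a\<in>G I. real (card (PiE I (W a))))"
    using finG finW I by (subst card_SigmaI) (auto intro: finite_PiE)
  also have "\<dots> = (\<Sum>a\<in>G I. \<Prod>i\<in>I. real (card (W a i)))"
    using I by (simp add: card_PiE)
  also have "\<dots> \<ge> (\<Sum>a\<in>G I. \<Prod>i\<in>I. r a i / 16)"
  proof (intro sum_mono prod_mono conjI)
    show "0 \<le> r a i / 16" for a i using Y by (simp add: r_def)
  qed (rule Wcard)
  also have "(\<Sum>a\<in>G I. \<Prod>i\<in>I. r a i / 16)
      = (\<Sum>a\<in>G I. (1/16) ^ card I * sqrt Y ^ card I * (\<Prod>e\<in>edges I. 1 / real (a e)))"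
  proof (rule sum.cong[OF refl])
    fix a assume a: "a \<in> G I"
    have "(\<Prod>i\<in>I. r a i / 16) = (1/16) ^ card I * sqrt Y ^ card I / (\<Prod>i\<in>I. sqrt (real (P a i)))"
    proof -
      have "(\<Prod>i\<in>I. r a i / 16) = (\<Prod>i\<in>I. (1/16) * sqrt Y / sqrt (real (P a i)))"
        unfolding r_def by (simp add: real_sqrt_divide mult.commute)
      then show ?thesis by (simp only: prod_dividef prod_constant power_mult_distrib)
    qed
    \<comment> \<open>Here the weights 1/a_e arise: the product of the window sizes contains the
      square root of the product of all \<open>P a i\<close>, which is exactly the product of the
      a_e.\<close>
    also have "(\<Prod>i\<in>I. sqrt (real (P a i))) = sqrt (real (\<Prod>i\<in>I. P a i))"
      by (simp add: sqrt_prod)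
    also have "\<dots> = real (\<Prod>e\<in>edges I. a e)"
      unfolding P_def prod_vertex_prod[OF I] of_nat_power by (simp only: real_sqrt_abs abs_of_nat)
    finally show "(\<Prod>i\<in>I. r a i / 16) = (1/16) ^ card I * sqrt Y ^ card I * (\<Prod>e\<in>edges I. 1 / real (a e))"
      by (simp add: prod_dividef)
  qed
  also have "\<dots> = (1/16) ^ card I * sqrt Y ^ card I * (\<Sum>a\<in>G I. \<Prod>e\<in>edges I. 1 / real (a e))"
    by (simp add: sum_distrib_left)
  also have "real (card (SIGMA a:G I. PiE I (W a))) \<le> real (card (square_tuples I d Y))"
    using card_inj_on_le[OF inj img finite_square_tuples[OF I]] by simp
  finally show ?thesis by simp
qed

section \<open>Choice of parameters in the tuple construction\<close>

lemma coprime_mult_add_one: "coprime (j * Q + 1) (Q::nat)"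
proof (rule coprimeI)
  fix c assume "c dvd j * Q + 1" "c dvd Q"
  then show "is_unit c" using dvd_add_right_iff[of c "j * Q" 1] by simp
qed

text \<open>The single residue class 1 modulo Q already gives a logarithm: j Q + 1 <= 2 Q j reduces
  it to a harmonic sum. The factor 1/(2Q) is harmless because Q will be fixed.\<close>

lemma sum_inverse_coprime_ge:
  fixes Q Z :: nat
  assumes Q: "Q > 0" and Z: "Z > 0"
  shows "ln (real Z / real Q) / (2 * real Q) \<le> (\<Sum>a | a \<in> {1..Z} \<and> coprime a Q. 1 / real a)"
proof -
  define J where "J = (Z - 1) div Q"
  have "J * Q \<le> Z - 1" unfolding J_def by (rule div_times_less_eq_dividend)
  then have JQ: "J * Q + 1 \<le> Z" using Z by linarith
  have "Z - 1 < Suc J * Q" unfolding J_def using Q dividend_less_div_times[of Q "Z - 1"] by simp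
  then have "Z \<le> Suc J * Q" by linarith
  then have "real Z \<le> real (Suc J) * real Q" by (metis of_nat_le_iff of_nat_mult)
  then have ZQ: "real Z / real Q \<le> real J + 1" using Q by (simp add: divide_le_eq add.commute)
  have "ln (real Z / real Q) \<le> ln (real J + 1)" using ZQ Q Z by simp
  also have "\<dots> \<le> harm J" by (rule ln_le_harm)
  finally have "ln (real Z / real Q) / (2 * real Q) \<le> harm J / (2 * real Q)"
    by (intro divide_right_mono) auto
  also have "\<dots> = (\<Sum>j=1..J. 1 / (2 * real Q * real j))"
    unfolding harm_def by (simp add: sum_divide_distrib inverse_eq_divide mult_ac)
  also have "\<dots> \<le> (\<Sum>j=1..J. 1 / real (j * Q + 1))"
  proof (rule sum_mono)
    fix j assume "j \<in> {1..J}"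
    then have j: "j > 0" by simp
    then have "1 * 1 \<le> real j * real Q" using Q by (intro mult_mono) auto
    then show "1 / (2 * real Q * real j) \<le> 1 / real (j * Q + 1)"
      using Q j by (intro divide_left_mono mult_pos_pos) (auto simp: algebra_simps)
  qed
  also have "\<dots> = (\<Sum>a\<in>(\<lambda>j. j * Q + 1) ` {1..J}. 1 / real a)"
    using Q by (subst sum.reindex) (auto simp: inj_on_def)
  also have "\<dots> \<le> (\<Sum>a | a \<in> {1..Z} \<and> coprime a Q. 1 / real a)"
  proof (rule sum_mono2)
    show "(\<lambda>j. j * Q + 1) ` {1..J} \<subseteq> {a. a \<in> {1..Z} \<and> coprime a Q}"
    proof (rule image_subsetI)
      fix j assume "j \<in> {1..J}"
      then have "j * Q \<le> J * Q" by (intro mult_right_mono) auto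
      then have "j * Q + 1 \<le> Z" using JQ by linarith
      then show "j * Q + 1 \<in> {a. a \<in> {1..Z} \<and> coprime a Q}"
        using coprime_mult_add_one[of j Q] by simp
    qed
  qed auto
  finally show ?thesis .
qed

lemma vertex_prod_le:
  assumes I: "finite I" and Z: "Z \<ge> 1" and a: "\<And>e. e \<in> edges I \<Longrightarrow> a e \<le> Z"
  shows "vertex_prod I a i \<le> Z ^ card I"
proof -
  have "{e. e \<in> edges I \<and> i \<in> e} \<subseteq> (\<lambda>j. {i, j}) ` I"
  proof
    fix e assume e: "e \<in> {e. e \<in> edges I \<and> i \<in> e}"
    then obtain x y where "e = {x, y}" unfolding edges_def card_2_iff by blast
    then show "e \<in> (\<lambda>j. {i, j}) ` I" using e unfolding edges_def by auto
  qed
  then have "card {e. e \<in> edges I \<and> i \<in> e} \<le> card ((\<lambda>j. {i, j}) ` I)"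
    using I by (intro card_mono) auto
  also have "\<dots> \<le> card I" by (rule card_image_le[OF I])
  finally have c: "card {e. e \<in> edges I \<and> i \<in> e} \<le> card I" .
  have "vertex_prod I a i \<le> (\<Prod>e | e \<in> edges I \<and> i \<in> e. Z)"
    unfolding vertex_prod_def using a by (intro prod_mono) auto
  also have "\<dots> = Z ^ card {e. e \<in> edges I \<and> i \<in> e}" by simp
  also have "\<dots> \<le> Z ^ card I" using c Z by (intro power_increasing) auto
  finally show ?thesis .
qed

text \<open>The constant c must not depend on d. The edge variables avoid all primes up to P and the
  primes of d; their reciprocal sum is still of order ln Y uniformly in the admissible d, and there
  is one such sum for each edge.\<close>

lemma eventually_card_square_tuples_ge:
  assumes I: "finite I" "I \<noteq> {}"
  shows "\<exists>c>0. \<forall>\<^sub>F Y in at_top. \<forall>d. odd d \<longrightarrow> (\<Sum>p\<in>prime_factors d. 1 / real p) \<le> 1/4 \<longrightarrow>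
    real (card (prime_factors d)) \<le> Y powr (1/4) / 16 \<longrightarrow>
    c * (sqrt Y ^ card I * ln Y ^ card (edges I)) \<le> real (card (square_tuples I d Y))"
proof -
  define m where "m = card I"
  define N where "N = card (edges I)"
  \<comment> \<open>The summand 2 N^2 keeps the loss from pairwise coprimality below one half; the
    summand 4 gives 1/P <= 1/4, so that together with the primes of d at most half of the reciprocal
    sum is lost.\<close>
  define P where "P = 2 * N ^ 2 + 4"
  define Q :: nat where "Q = fact P"
  have m: "m > 0" using I by (simp add: m_def card_gt_0_iff)
  have P: "P > 0" "P \<ge> 4" by (simp_all add: P_def)
  have Q: "Q > 0" by (simp add: Q_def)
  have evQ: "even Q" unfolding Q_def using P by (intro dvd_fact) auto
  define c where "c = (1/16) ^ m * (1 / (16 * real m * real Q)) ^ N / 2"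
  have c: "c > 0" unfolding c_def using m Q by simp
  have ev1: "\<forall>\<^sub>F Y in at_top. Y powr (1 / (2 * real m)) \<ge> 1"
    using m by real_asymp
  have ev2: "\<forall>\<^sub>F Y in at_top. ln (Y powr (1 / (2 * real m)) / 2 / real Q) \<ge> ln Y / (4 * real m)"
  proof -
    have "\<forall>\<^sub>F Y in at_top. c \<le> ln Y" for c :: real by real_asymp
    from this[of "4 * real m * ln (2 * real Q)"] eventually_gt_at_top[of "0::real"] show ?thesis
    proof eventually_elim
      case (elim Y)
      have "ln (Y powr (1 / (2 * real m)) / 2 / real Q) = ln Y / (2 * real m) - ln (2 * real Q)"
        using elim(2) Q by (simp add: ln_div ln_mult)
      moreover have "ln (2 * real Q) \<le> ln Y / (4 * real m)" using elim(1) m by (simp add: field_simps)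
      ultimately show ?case by (simp add: field_simps)
    qed
  qed
  have ev3: "\<forall>\<^sub>F Y in at_top. Y powr (1/4) \<ge> (8::real)" by real_asymp
  have ev4: "\<forall>\<^sub>F Y in at_top. Y \<ge> (1::real)" by real_asymp
  have "\<forall>\<^sub>F Y in at_top. \<forall>d. odd d \<longrightarrow> (\<Sum>p\<in>prime_factors d. 1 / real p) \<le> 1/4 \<longrightarrow>
    real (card (prime_factors d)) \<le> Y powr (1/4) / 16 \<longrightarrow>
    c * (sqrt Y ^ card I * ln Y ^ card (edges I)) \<le> real (card (square_tuples I d Y))"
    using ev1 ev2 ev3 ev4
  proof eventually_elim
    case (elim Y)
    show ?case
    proof (intro allI impI)
      fix d :: nat
      assume d: "odd d" and small: "(\<Sum>p\<in>prime_factors d. 1 / real p) \<le> 1/4"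
        and om: "real (card (prime_factors d)) \<le> Y powr (1/4) / 16"
      have d0: "d > 0" using d by (intro Nat.gr0I) auto
      \<comment> \<open>Edge variables up to Y^(1/(2m)): a product of at most m of them is at most
        Y^(1/2), so every window for b_i starts at Y^(1/4) or beyond.\<close>
      define Z where "Z = nat \<lfloor>Y powr (1 / (2 * real m))\<rfloor>"
      have Z1: "Z \<ge> 1" unfolding Z_def using elim(1) by (simp add: le_nat_floor)
      have Zle: "real Z \<le> Y powr (1 / (2 * real m))" unfolding Z_def using elim(1) by linarith
      have Zge: "real Z \<ge> Y powr (1 / (2 * real m)) / 2"
      proof -
        have "real Z > Y powr (1 / (2 * real m)) - 1" unfolding Z_def using elim(1) by linarith
        moreover have "real Z \<ge> 1" using Z1 by simp
        ultimately show ?thesis by linarith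
      qed
      define U where "U = {a. a \<in> {1..Z} \<and> coprime a Q}"
      define V where "V = {a. a \<in> U \<and> squarefree a \<and> coprime a d}"
      define SU where "SU = (\<Sum>a\<in>U. 1 / real a)"
      define SV where "SV = (\<Sum>a\<in>V. 1 / real a)"
      have U: "finite U" "0 \<notin> U" "\<And>a b. a \<in> U \<Longrightarrow> b dvd a \<Longrightarrow> b \<in> U"
        unfolding U_def by (auto intro: dvd_imp_le dvd_pos_nat order_trans coprime_divisors[of _ _ Q Q] 
            simp: Suc_le_eq)
      have V: "finite V" "0 \<notin> V" "\<And>a b. a \<in> V \<Longrightarrow> b dvd a \<Longrightarrow> b \<in> V"
        unfolding V_def using U by (auto intro: squarefree_mono coprime_divisors[of _ _ d d])
      have largeU: "P < p" if "a \<in> U" "prime p" "p dvd a" for a p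
        using that unfolding U_def Q_def by (auto intro: coprime_fact_prime_factor)
      have largeV: "P < p" if "a \<in> V" "prime p" "p dvd a" for a p
        using that largeU unfolding V_def by auto
      have SU: "SU \<ge> ln Y / (8 * real m * real Q)"
      proof -
        have "ln Y / (4 * real m) \<le> ln (Y powr (1 / (2 * real m)) / 2 / real Q)" by (rule elim(2))
        also have "\<dots> \<le> ln (real Z / real Q)"
        proof -
          have "0 < Y powr (1 / (2 * real m)) / 2 / real Q" using Q elim(1) by (intro divide_pos_pos) linarith+
          moreover have "Y powr (1 / (2 * real m)) / 2 / real Q \<le> real Z / real Q"
            using Zge by (rule divide_right_mono) simp
          ultimately show ?thesis by (subst ln_le_cancel_iff) linarith+
        qed
        finally have "ln Y / (4 * real m) / (2 * real Q) \<le> ln (real Z / real Q) / (2 * real Q)"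
          by (intro divide_right_mono) auto
        also have "\<dots> \<le> SU" unfolding SU_def U_def using Q Z1 by (intro sum_inverse_coprime_ge) auto
        finally show ?thesis by (simp add: mult.assoc)
      qed
      have lnY: "ln Y \<ge> 0" using elim(4) by simp
      then have SU0: "SU \<ge> 0" unfolding SU_def by (intro sum_nonneg) auto
      have "SU * (1/2) \<le> SU * (1 - (\<Sum>p\<in>prime_factors d. 1 / real p) - 1 / real P)"
      proof (rule mult_left_mono[OF _ SU0])
        have "1 / real P \<le> 1/4" using P by (simp add: divide_le_eq)
        then show "1/2 \<le> 1 - (\<Sum>p\<in>prime_factors d. 1 / real p) - 1 / real P" using small by linarith
      qed
      also have "\<dots> \<le> SV" unfolding SU_def SV_def V_def
        using U largeU P d0 by (intro sum_inverse_squarefree_coprime_ge) auto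
      finally have SV: "SV \<ge> ln Y * (1 / (16 * real m * real Q))" using SU by simp
      define G where "G = {a. a \<in> (edges I \<rightarrow>\<^sub>E V) \<and> (\<forall>e\<in>edges I. \<forall>f\<in>edges I. e \<noteq> f \<longrightarrow> coprime (a e) (a f))}"
      have "(ln Y * (1 / (16 * real m * real Q))) ^ N * (1/2) \<le> SV ^ N * (1 - real N ^ 2 / real P)"
      proof (intro mult_mono power_mono SV)
        have "2 * real N ^ 2 \<le> real P" by (simp add: P_def)
        then have "real N ^ 2 / real P \<le> 1/2" using P(1) by (simp add: pos_divide_le_eq)
        then show "1/2 \<le> 1 - real N ^ 2 / real P" by linarith
        show "0 \<le> SV ^ N" unfolding SV_def by (intro zero_le_power sum_nonneg) auto
      qed (use lnY in auto)
      also have "\<dots> \<le> (\<Sum>a\<in>G. \<Prod>e\<in>edges I. 1 / real (a e))"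
        unfolding SV_def N_def G_def
        using V largeV P finite_edges[OF I(1)] by (intro sum_inverse_pairwise_coprime_ge) auto
      finally have Gge: "(ln Y * (1 / (16 * real m * real Q))) ^ N * (1/2) \<le> (\<Sum>a\<in>G. \<Prod>e\<in>edges I. 1 / real (a e))" .
      have rge: "Y powr (1/4) \<le> sqrt (Y / vertex_prod I a i)" if a: "a \<in> G" for a i
      proof -
        have aV: "a e \<in> V" if "e \<in> edges I" for e using a that unfolding G_def by auto
        have "vertex_prod I a i \<le> Z ^ card I"
          using aV by (intro vertex_prod_le[OF I(1) Z1]) (auto simp: V_def U_def)
        then have "real (vertex_prod I a i) \<le> real Z ^ m"
          unfolding m_def by (metis of_nat_le_iff of_nat_power)
        also have "\<dots> \<le> (Y powr (1 / (2 * real m))) ^ m" using Zle by (intro power_mono) auto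
        also have "\<dots> = Y powr (1/2)"
          using elim(4) m by (subst powr_realpow[symmetric]) (auto simp: powr_powr)
        finally have le: "real (vertex_prod I a i) \<le> Y powr (1/2)" .
        have pos: "vertex_prod I a i > 0"
          unfolding vertex_prod_def
        proof (rule prod_pos)
          fix e assume "e \<in> {e. e \<in> edges I \<and> i \<in> e}"
          then have "a e \<in> V" using aV by simp
          then show "0 < a e" using V(2) by (cases "a e = 0") auto
        qed
        have "Y powr (1/4) = sqrt (Y powr (1/2))" 
          using elim(4) by (simp add: powr_half_sqrt[symmetric] powr_powr)
        also have "Y powr (1/2) = Y / Y powr (1/2)"
          using elim(4) by (simp add: powr_half_sqrt real_div_sqrt)
        also have "sqrt (Y / Y powr (1/2)) \<le> sqrt (Y / vertex_prod I a i)"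
          using le pos elim(4) by (intro real_sqrt_le_mono divide_left_mono) auto
        finally show ?thesis .
      qed
      have "c * (sqrt Y ^ card I * ln Y ^ card (edges I))
          = (1/16) ^ card I * sqrt Y ^ card I * ((ln Y * (1 / (16 * real m * real Q))) ^ N * (1/2))"
        unfolding c_def m_def[symmetric] N_def[symmetric] power_mult_distrib by simp
      also have "\<dots> \<le> (1/16) ^ card I * sqrt Y ^ card I * (\<Sum>a\<in>G. \<Prod>e\<in>edges I. 1 / real (a e))"
        using Gge elim(4) by (intro mult_left_mono) auto
      also have "\<dots> \<le> real (card (square_tuples I d Y))"
        unfolding G_def
      proof (rule card_square_tuples_ge[OF I(1) _ V(1,2) _ _ d0 d small], fold G_def)
        show "coprime a (2 * d)" if "a \<in> V" for a
        proof -
          have "coprime a Q" "coprime a d" using that by (auto simp: V_def U_def)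
          moreover from this have "coprime a 2" using evQ coprime_divisors[of a a 2 Q] by simp
          ultimately show ?thesis by simp
        qed
        show "8 \<le> sqrt (Y / vertex_prod I a i)" if "a \<in> G" for a i
          using rge[OF that, of i] elim(3) by linarith
        show "real (card (prime_factors d)) \<le> sqrt (Y / vertex_prod I a i) / 16" if "a \<in> G" for a i
          using rge[OF that, of i] om by linarith
      qed (use elim(4) in \<open>auto simp: V_def\<close>)
      finally show "c * (sqrt Y ^ card I * ln Y ^ card (edges I)) \<le> real (card (square_tuples I d Y))" .
    qed
  qed
  with c show ?thesis by blast
qed

section \<open>Discriminants whose primes have a small reciprocal sum\<close>

lemma sum_inverse_le_ln: "M > 0 \<Longrightarrow> (\<Sum>n=1..M. 1 / real n) \<le> 1 + ln (real M)"
proof (induction M)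
  case (Suc M)
  show ?case
  proof (cases "M = 0")
    case False
    have "ln (real M / real (Suc M)) \<le> real M / real (Suc M) - 1"
      using False by (intro ln_le_minus_one) auto
    also have "\<dots> = - (1 / real (Suc M))" by (simp add: field_simps)
    finally have "1 / real (Suc M) \<le> ln (real (Suc M)) - ln (real M)" using False by (simp add: ln_div)
    then show ?thesis using Suc False by simp
  qed simp
qed simp

lemma card_prime_factors_le:
  assumes "d > 0" shows "real (card (prime_factors d)) \<le> log 2 (real d)"
proof -
  have "2 ^ card (prime_factors d) \<le> (\<Prod>p\<in>prime_factors d. p ^ multiplicity p d)"
    unfolding prod_constant[symmetric]
  proof (rule prod_mono)
    fix p assume p: "p \<in> prime_factors d"
    then have "prime p" "multiplicity p d \<noteq> 0" by (auto simp: prime_factors_multiplicity)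
    then have p2: "2 \<le> p" by (intro prime_ge_2_nat)
    then have "p \<le> p ^ multiplicity p d"
      using \<open>multiplicity p d \<noteq> 0\<close> by (intro self_le_power) auto
    then show "0 \<le> (2::nat) \<and> 2 \<le> p ^ multiplicity p d" using p2 by linarith
  qed
  also have "\<dots> = d" using prime_factorization_nat[OF assms] by simp
  finally have "real (2 ^ card (prime_factors d)) \<le> real d" by (simp only: of_nat_le_iff)
  then have "2 powr real (card (prime_factors d)) \<le> real d" by (simp add: powr_realpow)
  then show ?thesis using assms by (simp add: le_log_iff)
qed

text \<open>The numbers 1 + Q j with Q = P! have no prime factor up to P. Among them few are
  divisible by a square, and the average over j of the sum of 1/p is essentially a sum of 1/p^2 over
  p > P, hence small; Markov's inequality then removes few of them.\<close>

lemma eventually_card_discriminants_ge: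
  "\<exists>c>0. \<forall>\<^sub>F X in at_top. c * X \<le>
     real (card {d. 0 < d \<and> real d \<le> X \<and> odd d \<and> squarefree d \<and> (\<Sum>p\<in>prime_factors d. 1 / real p) \<le> 1/4})"
proof -
  \<comment> \<open>With P = 20 the square divisors cost J/20 and Markov's inequality 4J/20, up to
    lower order terms, which leaves 3J/4.\<close>
  obtain P :: nat where P: "P = 20" by blast
  define Q :: nat where "Q = fact P"
  have Q: "Q > 0" by (simp add: Q_def)
  have evQ: "even Q" unfolding Q_def P by (intro dvd_fact) auto
  have ev1: "\<forall>\<^sub>F X in at_top. 1 / (2 * real Q) * X \<le> (X / real Q - 1) * (3/4) - sqrt X - 4 * (1 + ln X)"
  proof -
    have c: "\<forall>\<^sub>F X in at_top. c \<le> sqrt X" for c by real_asymp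
    have "\<forall>\<^sub>F X in at_top. sqrt X + 4 * ln X + 5 \<le> 2 * sqrt X" by real_asymp
    with c[of "8 * real Q"] eventually_gt_at_top[of "0::real"] show ?thesis
    proof eventually_elim
      case (elim X)
      have "8 * real Q * sqrt X \<le> sqrt X * sqrt X" using elim by (intro mult_right_mono) auto
      then have "8 * real Q * sqrt X \<le> X" using elim by simp
      define u where "u = X / real Q"
      have "2 * sqrt X \<le> u / 4" using \<open>8 * real Q * sqrt X \<le> X\<close> Q by (simp add: u_def field_simps)
      moreover have "1 / (2 * real Q) * X = u / 2" by (simp add: u_def)
      moreover have "u / 2 \<le> (u - 1) * (3/4) - sqrt X - 4 * (1 + ln X)"
        using \<open>2 * sqrt X \<le> u / 4\<close> elim(3) by argo
      ultimately show ?case unfolding u_def by linarith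
    qed
  qed
  have ev2: "\<forall>\<^sub>F X in at_top. X \<ge> (1::real)" by real_asymp
  have "\<forall>\<^sub>F X in at_top. 1 / (2 * real Q) * X \<le>
     real (card {d. 0 < d \<and> real d \<le> X \<and> odd d \<and> squarefree d \<and> (\<Sum>p\<in>prime_factors d. 1 / real p) \<le> 1/4})"
    using ev1 ev2
  proof eventually_elim
    case (elim X)
    define J where "J = nat \<lfloor>X / real Q\<rfloor>"
    have J: "real J \<le> X / real Q" "real J \<ge> X / real Q - 1"
    proof -
      have "0 \<le> X / real Q" using elim(2) Q by simp
      then show "real J \<le> X / real Q" "real J \<ge> X / real Q - 1" unfolding J_def by linarith+
    qed
    define q where "q = (\<lambda>j. 1 + Q * j)"
    have qX: "real (q j) \<le> X" if "j < J" for j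
    proof -
      have "1 + Q * j \<le> Q * Suc j" using Q by simp
      also have "\<dots> \<le> Q * J" using that by (intro mult_left_mono) auto
      finally have "real (q j) \<le> real Q * real J" unfolding q_def by (metis of_nat_le_iff of_nat_mult)
      also have "\<dots> \<le> X" using J(1) Q by (simp add: field_simps)
      finally show ?thesis .
    qed
    have large: "P < p" if "prime p" "p dvd q j" for p j
    proof -
      have "coprime (q j) Q" unfolding q_def
        using coprime_mult_add_one[of j Q] by (simp add: add.commute mult.commute)
      then show ?thesis using that unfolding Q_def by (intro coprime_fact_prime_factor) auto
    qed
    have copQ: "coprime p Q" if "prime p" "P < p" for p
    proof -
      have "\<not> p dvd Q" unfolding Q_def using that by (simp add: prime_dvd_fact_iff)
      then show ?thesis using that prime_imp_coprime by blast
    qed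
    define s where "s = nat \<lfloor>sqrt X\<rfloor>"
    define M where "M = nat \<lfloor>X\<rfloor>"
    have s: "real s \<le> sqrt X" unfolding s_def using elim(2) by (simp add: of_nat_floor)
    have M: "real M \<le> X" "M > 0" unfolding M_def using elim(2) by (simp_all add: of_nat_floor)
    define \<sigma> where "\<sigma> = (\<lambda>j. \<Sum>p\<in>prime_factors (q j). 1 / real p)"
    define Good where "Good = {j\<in>{..<J}. squarefree (q j) \<and> \<sigma> j \<le> 1/4}"
    define B1 where "B1 = (\<Union>p\<in>{p\<in>{P<..s}. prime p}. {j\<in>{..<J}. p ^ 2 dvd q j})"
    define B2 where "B2 = {j\<in>{..<J}. \<sigma> j > 1/4}"
    have "{..<J} \<subseteq> Good \<union> (B1 \<union> B2)"
    proof
      fix j assume j: "j \<in> {..<J}"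
      have "j \<in> B1" if ns: "\<not> squarefree (q j)"
      proof -
        obtain p where p: "prime p" "p ^ 2 dvd q j"
          using not_squarefree_prime[OF ns] by (auto simp: q_def)
        then have "p dvd q j" by (meson dvd_power dvd_trans zero_less_numeral)
        then have "P < p" using large p by blast
        moreover have "p ^ 2 \<le> q j" using p by (intro dvd_imp_le) (auto simp: q_def)
        then have "real p ^ 2 \<le> X" using qX[of j] j by (metis lessThan_iff of_nat_le_iff of_nat_power order_trans)
        then have "real p \<le> sqrt X" by (intro real_le_rsqrt)
        then have "p \<le> s" unfolding s_def by (simp add: le_nat_floor)
        ultimately show ?thesis using p j by (auto simp: B1_def)
      qed
      then show "j \<in> Good \<union> (B1 \<union> B2)" using j by (auto simp: Good_def B2_def)
    qed
    then have "card {..<J} \<le> card (Good \<union> (B1 \<union> B2))"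
      by (intro card_mono) (auto simp: Good_def B1_def B2_def)
    also have "\<dots> \<le> card Good + card (B1 \<union> B2)" by (rule card_Un_le)
    also have "\<dots> \<le> card Good + (card B1 + card B2)" using card_Un_le by (intro add_left_mono)
    finally have "card {..<J} \<le> card Good + (card B1 + card B2)" .
    then have Jle: "real J \<le> real (card Good) + real (card B1) + real (card B2)" by simp
    have B1: "real (card B1) \<le> real J * (1 / real P) + sqrt X"
    proof -
      have "card B1 \<le> (\<Sum>p\<in>{p\<in>{P<..s}. prime p}. card {j\<in>{..<J}. p ^ 2 dvd q j})"
        unfolding B1_def by (intro card_UN_le) auto
      then have "real (card B1) \<le> (\<Sum>p\<in>{p\<in>{P<..s}. prime p}. real (card {j\<in>{..<J}. p ^ 2 dvd q j}))"
        unfolding of_nat_sum[symmetric] of_nat_le_iff .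
      also have "\<dots> \<le> (\<Sum>p\<in>{p\<in>{P<..s}. prime p}. real J / real (p ^ 2) + 1)"
        unfolding q_def using copQ prime_gt_0_nat by (intro sum_mono card_dvd_progression) auto
      also have "\<dots> = real J * (\<Sum>p\<in>{p\<in>{P<..s}. prime p}. 1 / real p ^ 2) + real (card {p\<in>{P<..s}. prime p})"
        by (simp add: sum.distrib sum_distrib_left)
      also have "\<dots> \<le> real J * (1 / real P) + real (card {P<..s})"
        by (intro add_mono mult_left_mono sum_inverse_squares_le of_nat_mono card_mono) (auto simp: P)
      also have "\<dots> \<le> real J * (1 / real P) + sqrt X" using s by simp
      finally show ?thesis .
    qed
    have B2: "real (card B2) \<le> 4 * (real J * (1 / real P) + (1 + ln X))"
    proof -
      \<comment> \<open>Markov's inequality for \<sigma>, followed by an exchange of the sums over j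
        and p; p ranges up to M, whence the term 1 + ln X from the rounding errors.\<close>
      have "real (card B2) = (\<Sum>j\<in>B2. 1)" by simp
      also have "\<dots> \<le> (\<Sum>j\<in>B2. 4 * \<sigma> j)" by (intro sum_mono) (auto simp: B2_def)
      also have "\<dots> \<le> (\<Sum>j<J. 4 * \<sigma> j)"
        by (intro sum_mono2) (auto simp: B2_def \<sigma>_def intro!: sum_nonneg)
      also have "\<dots> = 4 * (\<Sum>j<J. \<sigma> j)" by (simp add: sum_distrib_left)
      also have "(\<Sum>j<J. \<sigma> j) = (\<Sum>j<J. \<Sum>p | p \<in> {p\<in>{P<..M}. prime p} \<and> p dvd q j. 1 / real p)"
      proof (rule sum.cong[OF refl])
        fix j assume j: "j \<in> {..<J}"
        have "prime_factors (q j) = {p. p \<in> {p\<in>{P<..M}. prime p} \<and> p dvd q j}"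
        proof -
          have "p \<le> M" if "p dvd q j" for p
          proof -
            have "p \<le> q j" using that by (intro dvd_imp_le) (auto simp: q_def)
            then have "real p \<le> X" using qX[of j] j by (metis lessThan_iff of_nat_le_iff order_trans)
            then show ?thesis unfolding M_def by (simp add: le_nat_floor)
          qed
          moreover have "q j \<noteq> 0" by (simp add: q_def)
          ultimately show ?thesis using large by (auto simp: prime_factors_dvd)
        qed
        then show "\<sigma> j = (\<Sum>p | p \<in> {p\<in>{P<..M}. prime p} \<and> p dvd q j. 1 / real p)"
          unfolding \<sigma>_def by simp
      qed
      also have "\<dots> = (\<Sum>p\<in>{p\<in>{P<..M}. prime p}. \<Sum>j | j \<in> {..<J} \<and> p dvd q j. 1 / real p)"
        by (rule sum.swap_restrict) auto
      also have "\<dots> = (\<Sum>p\<in>{p\<in>{P<..M}. prime p}. real (card {j\<in>{..<J}. p dvd q j}) * (1 / real p))"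
        by simp
      also have "\<dots> \<le> (\<Sum>p\<in>{p\<in>{P<..M}. prime p}. (real J / real p + 1) * (1 / real p))"
        unfolding q_def using copQ prime_gt_0_nat
        by (intro sum_mono mult_right_mono card_dvd_progression) auto
      also have "\<dots> = real J * (\<Sum>p\<in>{p\<in>{P<..M}. prime p}. 1 / real p ^ 2) + (\<Sum>p\<in>{p\<in>{P<..M}. prime p}. 1 / real p)"
        unfolding sum_distrib_left sum.distrib[symmetric]
        by (intro sum.cong refl) (simp add: add_divide_distrib power2_eq_square)
      also have "\<dots> \<le> real J * (1 / real P) + (\<Sum>p=1..M. 1 / real p)"
        by (intro add_mono mult_left_mono sum_inverse_squares_le sum_mono2) (auto simp: P)
      also have "\<dots> \<le> real J * (1 / real P) + (1 + ln X)"
      proof -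
        have "ln (real M) \<le> ln X" using M elim(2) by (subst ln_le_cancel_iff) auto
        then show ?thesis using sum_inverse_le_ln[OF M(2)] by linarith
      qed
      finally show ?thesis by simp
    qed
    have "1 / (2 * real Q) * X \<le> real (card Good)"
    proof -
      have arith: "z \<le> g" if "j \<le> g + b1 + b2" "b1 \<le> j * (1/20) + s" "b2 \<le> 4 * (j * (1/20) + l)"
        "z \<le> (u - 1) * (3/4) - s - 4 * l" "u - 1 \<le> j" for z g j b1 b2 s l u :: real
        using that by argo
      have P20: "real P = 20" by (simp add: P)
      show ?thesis
        by (rule arith[OF Jle B1[unfolded P20] B2[unfolded P20] elim(1) J(2)])
    qed
    also have "card Good \<le> card {d. 0 < d \<and> real d \<le> X \<and> odd d \<and> squarefree d \<and> (\<Sum>p\<in>prime_factors d. 1 / real p) \<le> 1/4}"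
    proof (rule card_inj_on_le[where f = q])
      show "finite {d. 0 < d \<and> real d \<le> X \<and> odd d \<and> squarefree d \<and> (\<Sum>p\<in>prime_factors d. 1 / real p) \<le> 1/4}"
        by (rule finite_subset[of _ "{..M}"]) (auto simp: M_def le_nat_floor)
      show "inj_on q Good" using Q by (auto simp: inj_on_def q_def)
      show "q ` Good \<subseteq> {d. 0 < d \<and> real d \<le> X \<and> odd d \<and> squarefree d \<and> (\<Sum>p\<in>prime_factors d. 1 / real p) \<le> 1/4}"
      proof (rule image_subsetI)
        fix j assume "j \<in> Good"
        then have "j < J" "squarefree (q j)" "\<sigma> j \<le> 1/4" by (auto simp: Good_def)
        moreover have "odd (q j)" "0 < q j" using evQ by (simp_all add: q_def)
        ultimately show "q j \<in> {d. 0 < d \<and> real d \<le> X \<and> odd d \<and> squarefree d \<and> (\<Sum>p\<in>prime_factors d. 1 / real p) \<le> 1/4}"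
          using qX unfolding \<sigma>_def by simp
      qed
    qed
    finally show ?case by simp
  qed
  then show ?thesis using Q by (intro exI[of _ "1 / (2 * real Q)"]) simp
qed

section \<open>Dirichlet $L$-functions on the critical line\<close>

definition dirichlet_psum :: "(nat \<Rightarrow> complex) \<Rightarrow> nat \<Rightarrow> complex \<Rightarrow> complex" where
  "dirichlet_psum chi N s = (\<Sum>n<N. chi (Suc n) * of_nat (Suc n) powr (- s))"

text \<open>The term after summation by parts. With bounded partial sums of chi this series
  converges absolutely for Re s > 0, where the Dirichlet series itself may converge only
  conditionally.\<close>

definition abel_term :: "(nat \<Rightarrow> complex) \<Rightarrow> nat \<Rightarrow> complex \<Rightarrow> complex" where
  "abel_term chi m s = (\<Sum>n<Suc m. chi (Suc n)) * (of_nat (Suc m) powr (- s) - of_nat (Suc (Suc m)) powr (- s))"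

lemma dirichlet_psum_abel:
  "dirichlet_psum chi N s = (\<Sum>m<N. abel_term chi m s) + (\<Sum>n<N. chi (Suc n)) * of_nat (Suc N) powr (- s)"
  by (induction N) (simp_all add: dirichlet_psum_def abel_term_def algebra_simps)

lemma norm_abel_term_le:
  assumes bd: "\<And>N. norm (\<Sum>n<N. chi (Suc n)) \<le> q" and s: "Re s > 0"
  shows "norm (abel_term chi m s) \<le> q * norm s * real (Suc m) powr (- Re s - 1)"
proof -
  have "norm (of_real (real (Suc m) + 1) powr (-s) - of_real (real (Suc m)) powr (-s))
      \<le> norm s * real (Suc m) powr (- Re s - 1) * 1"
    using s by (intro powr_step_bound) auto
  then have *: "norm (of_nat (Suc m) powr (- s) - of_nat (Suc (Suc m)) powr (- s) :: complex)
      \<le> norm s * real (Suc m) powr (- Re s - 1)"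
    by (simp add: norm_minus_commute add_ac)
  have "0 \<le> q" using bd[of 0] by simp
  then have "norm (abel_term chi m s) \<le> q * (norm s * real (Suc m) powr (- Re s - 1))"
    unfolding abel_term_def norm_mult using * by (intro mult_mono bd) auto
  then show ?thesis by (simp add: mult.assoc)
qed

lemma summable_Suc_powr:
  assumes "(r::real) > 0" shows "summable (\<lambda>m. real (Suc m) powr (- r - 1))"
proof -
  have "summable (\<lambda>n. real n powr (- r - 1))" using assms by (subst summable_real_powr_iff) auto
  then show ?thesis by (subst summable_Suc_iff)
qed

text \<open>\<open>dirichlet_L\<close> is defined by choice, so its values are reached through a
  concrete continuation and uniqueness. The boundary term of the summation by parts tends to 0 for
  Re s > 0, so the partial sums of the Dirichlet series have the same limit.\<close>

lemma continues_abel_series: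
  assumes bd: "\<And>N. norm (\<Sum>n<N. chi (Suc n)) \<le> q"
  shows "continues_dirichlet_series chi (\<lambda>s. \<Sum>m. abel_term chi m s)"
    and "Re s > 0 \<Longrightarrow> (\<lambda>N. dirichlet_psum chi N s) \<longlonglongrightarrow> (\<Sum>m. abel_term chi m s)"
proof -
  have q: "0 \<le> q" using bd[of 0] by simp
  show lim: "(\<lambda>N. dirichlet_psum chi N s) \<longlonglongrightarrow> (\<Sum>m. abel_term chi m s)" if s: "Re s > 0" for s
  proof -
    have "summable (\<lambda>m. abel_term chi m s)"
      by (rule summable_comparison_test'[OF summable_mult[OF summable_Suc_powr[OF s]]])
         (rule norm_abel_term_le[OF bd s])
    then have "(\<lambda>N. \<Sum>m<N. abel_term chi m s) \<longlonglongrightarrow> (\<Sum>m. abel_term chi m s)"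
      by (rule summable_LIMSEQ)
    moreover have "(\<lambda>N. (\<Sum>n<N. chi (Suc n)) * of_nat (Suc N) powr (- s)) \<longlonglongrightarrow> 0"
    proof (rule Lim_null_comparison)
      show "(\<lambda>N. q * real (Suc N) powr (- Re s)) \<longlonglongrightarrow> 0"
        using s by real_asymp
      have "norm ((\<Sum>n<N. chi (Suc n)) * of_nat (Suc N) powr (- s)) \<le> q * real (Suc N) powr (- Re s)" for N
      proof -
        have "norm (of_nat (Suc N) powr (- s) :: complex) = real (Suc N) powr (- Re s)"
          by (subst norm_powr_real_powr) auto
        then show ?thesis unfolding norm_mult using q by (intro mult_mono bd) auto
      qed
      then show "\<forall>\<^sub>F N in sequentially. norm ((\<Sum>n<N. chi (Suc n)) * of_nat (Suc N) powr (- s))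
          \<le> q * real (Suc N) powr (- Re s)" by simp
    qed
    ultimately show ?thesis unfolding dirichlet_psum_abel using tendsto_add by fastforce
  qed
  have "(\<lambda>s. \<Sum>m. abel_term chi m s) holomorphic_on L_domain"
  proof (rule holomorphic_uniform_sequence[OF open_L_domain, where f = "\<lambda>n s. \<Sum>m<n. abel_term chi m s"])
    show "(\<lambda>s. \<Sum>m<n. abel_term chi m s) holomorphic_on L_domain" for n
      unfolding abel_term_def by (intro holomorphic_intros)
    fix z assume z: "z \<in> L_domain"
    obtain d0 where d0: "d0 > 0" "cball z d0 \<subseteq> L_domain"
      using open_L_domain z open_contains_cball by blast
    define r where "r = Re z / 2"
    define d where "d = min d0 r"
    have r0: "r > 0" using z by (simp add: r_def L_domain_def)
    have d: "d > 0" "cball z d \<subseteq> L_domain" using d0 r0 by (auto simp: d_def)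
    have Rew: "Re w \<ge> r" "norm w \<le> norm z + d" if "w \<in> cball z d" for w
    proof -
      have *: "norm (z - w) \<le> d" using that by (simp add: dist_norm)
      have "\<bar>Re (z - w)\<bar> \<le> d" using abs_Re_le_cmod[of "z - w"] * by linarith
      moreover have "d \<le> r" by (simp add: d_def)
      ultimately show "Re w \<ge> r" unfolding r_def minus_complex.simps by linarith
      have "norm w \<le> norm z + norm (z - w)" using norm_triangle_sub[of w z] by (simp only: norm_minus_commute)
      then show "norm w \<le> norm z + d" using * by linarith
    qed
    have "uniform_limit (cball z d) (\<lambda>n s. \<Sum>m<n. abel_term chi m s) (\<lambda>s. \<Sum>m. abel_term chi m s) sequentially"
    proof (rule Weierstrass_m_test)
      show "norm (abel_term chi m w) \<le> q * (norm z + d) * real (Suc m) powr (- r - 1)" if w: "w \<in> cball z d" for m w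
      proof -
        have "norm (abel_term chi m w) \<le> q * norm w * real (Suc m) powr (- Re w - 1)"
          using Rew[OF w] r0 by (intro norm_abel_term_le bd) auto
        also have "\<dots> \<le> q * (norm z + d) * real (Suc m) powr (- r - 1)"
          using Rew[OF w] q d by (intro mult_mono powr_mono) auto
        finally show ?thesis .
      qed
    qed (intro summable_mult summable_Suc_powr r0)
    with d show "\<exists>d>0. cball z d \<subseteq> L_domain \<and> uniform_limit (cball z d)
        (\<lambda>n s. \<Sum>m<n. abel_term chi m s) (\<lambda>s. \<Sum>m. abel_term chi m s) sequentially" by blast
  qed
  then show "continues_dirichlet_series chi (\<lambda>s. \<Sum>m. abel_term chi m s)"
    unfolding continues_dirichlet_series_def sums_def using lim by (auto simp: dirichlet_psum_def)
qed

lemma critical_line_in_L_domain: "1 / 2 + \<i> * of_real t \<in> L_domain"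
  by (auto simp: L_domain_def complex_eq_iff)

lemma continues_dirichlet_L:
  assumes bd: "\<And>N. norm (\<Sum>n<N. chi (Suc n)) \<le> q"
  shows "continues_dirichlet_series chi (dirichlet_L chi)"
proof -
  have "\<exists>f. continues_dirichlet_series chi f" using continues_abel_series(1)[OF bd] by blast
  then show ?thesis unfolding dirichlet_L_def by (rule someI_ex)
qed

lemma dirichlet_psum_tendsto_dirichlet_L:
  assumes bd: "\<And>N. norm (\<Sum>n<N. chi (Suc n)) \<le> q"
  shows "(\<lambda>N. dirichlet_psum chi N (1 / 2 + \<i> * of_real t)) \<longlonglongrightarrow> dirichlet_L chi (1 / 2 + \<i> * of_real t)"
proof -
  have "dirichlet_L chi (1 / 2 + \<i> * of_real t) = (\<Sum>m. abel_term chi m (1 / 2 + \<i> * of_real t))"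
    using continues_dirichlet_series_unique[OF continues_dirichlet_L[OF bd] continues_abel_series(1)[OF bd]]
      critical_line_in_L_domain by blast
  then show ?thesis using continues_abel_series(2)[OF bd, of "1 / 2 + \<i> * of_real t"] by simp
qed

text \<open>The series is the value of zeta at 3/2 and bounds the Abel terms on the critical line;
  the summand 1 is for the boundary term.\<close>

definition line_const :: real where
  "line_const = 1 + (\<Sum>m. real (Suc m) powr (- (1/2) - 1))"

lemma line_const_ge_1: "line_const \<ge> 1"
proof -
  have "summable (\<lambda>m. real (Suc m) powr (- (1/2) - 1))" by (rule summable_Suc_powr) simp
  then have "0 \<le> (\<Sum>m. real (Suc m) powr (- (1/2) - 1))" by (rule suminf_nonneg) simp
  then show ?thesis unfolding line_const_def by linarith
qed

text \<open>Uniformity in N is the point: this is the majorant for dominated convergence. The linear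
  growth in q and t is crude, but a Gaussian tolerates it.\<close>

lemma norm_dirichlet_psum_le:
  assumes bd: "\<And>N. norm (\<Sum>n<N. chi (Suc n)) \<le> q"
  shows "norm (dirichlet_psum chi N (1 / 2 + \<i> * of_real t)) \<le> q * line_const * (1 + \<bar>t\<bar>)"
proof -
  define s where "s = 1 / 2 + \<i> * complex_of_real t"
  have s: "Re s = 1/2" by (simp add: s_def)
  have q: "0 \<le> q" using bd[of 0] by simp
  have ns: "norm s \<le> 1 + \<bar>t\<bar>"
  proof -
    have "norm s \<le> norm (1/2 :: complex) + norm (\<i> * complex_of_real t)" unfolding s_def by (rule norm_triangle_ineq)
    then show ?thesis by (simp add: norm_mult)
  qed
  have "norm (\<Sum>m<N. abel_term chi m s) \<le> (\<Sum>m<N. q * norm s * real (Suc m) powr (- (1/2) - 1))"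
    using norm_abel_term_le[OF bd, of s] s by (intro sum_norm_le) auto
  also have "\<dots> = q * norm s * (\<Sum>m<N. real (Suc m) powr (- (1/2) - 1))" by (simp add: sum_distrib_left)
  also have "\<dots> \<le> q * (1 + \<bar>t\<bar>) * (\<Sum>m. real (Suc m) powr (- (1/2) - 1))"
    using q ns summable_Suc_powr[of "1/2"]
    by (intro mult_mono sum_le_suminf) (auto intro!: sum_nonneg)
  finally have 1: "norm (\<Sum>m<N. abel_term chi m s) \<le> q * (1 + \<bar>t\<bar>) * (\<Sum>m. real (Suc m) powr (- (1/2) - 1))" .
  have "norm (of_nat (Suc N) powr (- s) :: complex) = real (Suc N) powr (- (1/2))"
    by (subst norm_powr_real_powr) (auto simp: s)
  also have "\<dots> \<le> 1 + \<bar>t\<bar>"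
    using powr_mono[of "-(1/2)" 0 "real (Suc N)"] by simp
  finally have 2: "norm ((\<Sum>n<N. chi (Suc n)) * of_nat (Suc N) powr (- s)) \<le> q * (1 + \<bar>t\<bar>)"
    unfolding norm_mult using q by (intro mult_mono bd) auto
  have "norm (dirichlet_psum chi N s) \<le> norm (\<Sum>m<N. abel_term chi m s) + norm ((\<Sum>n<N. chi (Suc n)) * of_nat (Suc N) powr (- s))"
    unfolding dirichlet_psum_abel by (rule norm_triangle_ineq)
  also have "\<dots> \<le> q * line_const * (1 + \<bar>t\<bar>)"
    using 1 2 unfolding line_const_def by (simp add: algebra_simps)
  finally show ?thesis unfolding s_def .
qed

lemma norm_dirichlet_L_le:
  assumes bd: "\<And>N. norm (\<Sum>n<N. chi (Suc n)) \<le> q"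
  shows "norm (dirichlet_L chi (1 / 2 + \<i> * of_real t)) \<le> q * line_const * (1 + \<bar>t\<bar>)"
  by (rule LIMSEQ_le_const2[OF tendsto_norm[OF dirichlet_psum_tendsto_dirichlet_L[OF bd]]])
     (use norm_dirichlet_psum_le[OF bd] in blast)

lemma continuous_dirichlet_L:
  assumes bd: "\<And>N. norm (\<Sum>n<N. chi (Suc n)) \<le> q"
  shows "continuous_on UNIV (\<lambda>t. dirichlet_L chi (1 / 2 + \<i> * of_real t))"
proof -
  have "continuous_on L_domain (dirichlet_L chi)"
    using continues_dirichlet_L[OF bd] unfolding continues_dirichlet_series_def
    by (auto intro: holomorphic_on_imp_continuous_on)
  then show ?thesis
    by (rule continuous_on_compose2) (intro continuous_intros, use critical_line_in_L_domain in blast)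
qed

text \<open>The Fourier transform of the standard normal density, evaluated at \<open>ln (Y / n)\<close>, times \<open>n\<^bsup>-1/2\<^esup>\<close>.\<close>

definition gauss_weight :: "real \<Rightarrow> nat \<Rightarrow> real" where
  "gauss_weight Y n = real n powr (- (1/2)) * exp (- (ln (real n / Y) ^ 2 / 2))"

section \<open>Gaussian averages on the critical line\<close>

lemma integral_gauss_phase:
  "has_bochner_integral lborel (\<lambda>t. std_normal_density t *\<^sub>R exp (\<i> * of_real (t * a)))
     (complex_of_real (exp (- (a ^ 2 / 2))))"
proof -
  have "integrable lborel (\<lambda>t. std_normal_density t *\<^sub>R exp (\<i> * of_real (t * a)))"
  proof (rule Bochner_Integration.integrable_bound)
    show "integrable lborel (\<lambda>t. std_normal_density t * \<bar>t\<bar> ^ 0)" by (rule integrable_std_normal_moment_abs)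
    show "AE t in lborel. norm (std_normal_density t *\<^sub>R exp (\<i> * complex_of_real (t * a)))
        \<le> norm (std_normal_density t * \<bar>t\<bar> ^ 0)"
      by simp
  qed simp
  moreover have "(LINT t|lborel. std_normal_density t *\<^sub>R exp (\<i> * of_real (t * a))) = of_real (exp (- (a ^ 2 / 2)))"
  proof -
    have "char std_normal_distribution a = (LINT t|lborel. std_normal_density t *\<^sub>R exp (\<i> * of_real (a * t)))"
      unfolding char_def by (subst integral_density) auto
    then show ?thesis unfolding char_std_normal_distribution by (simp add: mult.commute)
  qed
  ultimately show ?thesis by (simp add: has_bochner_integral_iff)
qed

text \<open>The twist by Y^(it) combines with n^(-it) to the phase t ln(Y/n), so the characteristic
  function of the normal distribution produces a weight centred at n = Y.\<close>

lemma integral_dirichlet_psum_gauss: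
  assumes Y: "Y > 0"
  shows "has_bochner_integral lborel
     (\<lambda>t. std_normal_density t *\<^sub>R (exp (\<i> * of_real (t * ln Y)) * dirichlet_psum chi N (1 / 2 + \<i> * of_real t)))
     (\<Sum>n<N. chi (Suc n) * of_real (gauss_weight Y (Suc n)))"
proof -
  have phase: "of_nat (Suc n) powr (- (1 / 2 + \<i> * complex_of_real t))
      = of_real (real (Suc n) powr (- (1/2))) * exp (- (\<i> * of_real (t * ln (real (Suc n)))))" for n t
  proof -
    have "of_nat (Suc n) powr (- (1 / 2 + \<i> * complex_of_real t))
      = of_real (real (Suc n)) powr (of_real (-(1/2))) * of_nat (Suc n) powr (- (\<i> * complex_of_real t))"
      by (simp flip: powr_add)
    also have "complex_of_real (real (Suc n)) powr (of_real (-(1/2))) = of_real (real (Suc n) powr (- (1/2)))"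
      by (subst powr_of_real) auto
    also have "complex_of_nat (Suc n) powr (- (\<i> * complex_of_real t)) = exp (- (\<i> * complex_of_real t) * Ln (of_real (real (Suc n))))"
      unfolding powr_def using of_nat_neq_0[where 'a = complex, of n] by (simp del: of_nat_Suc)
    also have "Ln (of_real (real (Suc n))) = of_real (ln (real (Suc n)))" by (rule Ln_of_real) simp
    finally show ?thesis by (simp add: mult_ac)
  qed
  have "has_bochner_integral lborel
     (\<lambda>t. \<Sum>n<N. chi (Suc n) * of_real (real (Suc n) powr (- (1/2))) *
        (std_normal_density t *\<^sub>R exp (\<i> * of_real (t * ln (Y / real (Suc n))))))
     (\<Sum>n<N. chi (Suc n) * of_real (real (Suc n) powr (- (1/2))) * of_real (exp (- (ln (Y / real (Suc n)) ^ 2 / 2))))"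
    by (intro has_bochner_integral_sum has_bochner_integral_mult_right integral_gauss_phase)
  moreover have "(\<Sum>n<N. chi (Suc n) * of_real (real (Suc n) powr (- (1/2))) * of_real (exp (- (ln (Y / real (Suc n)) ^ 2 / 2))))
      = (\<Sum>n<N. chi (Suc n) * of_real (gauss_weight Y (Suc n)))"
  proof (rule sum.cong[OF refl])
    fix n
    have "ln (Y / real (Suc n)) = - ln (real (Suc n) / Y)" using Y by (simp add: ln_div)
    then have "ln (Y / real (Suc n)) ^ 2 = ln (real (Suc n) / Y) ^ 2" by simp
    then show "chi (Suc n) * of_real (real (Suc n) powr (- (1/2))) * of_real (exp (- (ln (Y / real (Suc n)) ^ 2 / 2)))
        = chi (Suc n) * of_real (gauss_weight Y (Suc n))"
      unfolding gauss_weight_def by simp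
  qed
  moreover have "(\<Sum>n<N. chi (Suc n) * of_real (real (Suc n) powr (- (1/2))) *
        (std_normal_density t *\<^sub>R exp (\<i> * of_real (t * ln (Y / real (Suc n))))))
     = std_normal_density t *\<^sub>R (exp (\<i> * of_real (t * ln Y)) * dirichlet_psum chi N (1 / 2 + \<i> * of_real t))" for t
  proof -
    have "chi (Suc n) * of_real (real (Suc n) powr (- (1/2))) *
        (std_normal_density t *\<^sub>R exp (\<i> * of_real (t * ln (Y / real (Suc n)))))
      = std_normal_density t *\<^sub>R (exp (\<i> * of_real (t * ln Y)) * (chi (Suc n) * of_nat (Suc n) powr (- (1 / 2 + \<i> * complex_of_real t))))" for n
    proof -
      have "exp (\<i> * of_real (t * ln (Y / real (Suc n)))) = exp (\<i> * of_real (t * ln Y)) * exp (- (\<i> * of_real (t * ln (real (Suc n)))))"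
      proof -
        have "ln (Y / real (Suc n)) = ln Y - ln (real (Suc n))" using Y by (simp add: ln_div del: of_nat_Suc)
        then have "t * ln (Y / real (Suc n)) = t * ln Y - t * ln (real (Suc n))"
          by (simp only: right_diff_distrib)
        then show ?thesis by (simp only: of_real_diff right_diff_distrib exp_diff exp_minus divide_inverse)
      qed
      then show ?thesis unfolding phase by (simp add: scaleR_conv_of_real mult_ac)
    qed
    then show ?thesis unfolding dirichlet_psum_def by (simp only: sum_distrib_left scaleR_sum_right)
  qed
  ultimately show ?thesis by (simp only:)
qed

lemma gauss_sums_tendsto:
  assumes bd: "\<And>N. norm (\<Sum>n<N. chi (Suc n)) \<le> q" and Y: "Y > 0"
  shows "(\<lambda>N. \<Sum>n<N. chi (Suc n) * of_real (gauss_weight Y (Suc n))) \<longlonglongrightarrow>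
     (LINT t|lborel. std_normal_density t *\<^sub>R (exp (\<i> * of_real (t * ln Y)) * dirichlet_L chi (1 / 2 + \<i> * of_real t)))"
proof -
  let ?f = "\<lambda>t. std_normal_density t *\<^sub>R (exp (\<i> * of_real (t * ln Y)) * dirichlet_L chi (1 / 2 + \<i> * of_real t))"
  let ?g = "\<lambda>N t. std_normal_density t *\<^sub>R (exp (\<i> * of_real (t * ln Y)) * dirichlet_psum chi N (1 / 2 + \<i> * of_real t))"
  have "(\<lambda>N. LINT t|lborel. ?g N t) \<longlonglongrightarrow> (LINT t|lborel. ?f t)"
  proof (rule integral_dominated_convergence)
    have "(\<lambda>t. dirichlet_L chi (1 / 2 + \<i> * of_real t)) \<in> borel_measurable lborel"
      using continuous_dirichlet_L[OF bd] by (simp add: borel_measurable_continuous_onI)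
    then show "?f \<in> borel_measurable lborel" by measurable
    show "?g N \<in> borel_measurable lborel" for N
      by (rule borel_measurable_integrable) (use integral_dirichlet_psum_gauss[OF Y] has_bochner_integral_iff in blast)
    show "integrable lborel (\<lambda>t. q * line_const * (std_normal_density t * \<bar>t\<bar> ^ 0 + std_normal_density t * \<bar>t\<bar> ^ 1))"
      by (intro integrable_mult_right Bochner_Integration.integrable_add integrable_std_normal_moment_abs)
    show "AE t in lborel. (\<lambda>N. ?g N t) \<longlonglongrightarrow> ?f t"
      by (intro AE_I2 tendsto_intros dirichlet_psum_tendsto_dirichlet_L[OF bd])
    fix N
    have "norm (?g N t) \<le> q * line_const * (std_normal_density t * \<bar>t\<bar> ^ 0 + std_normal_density t * \<bar>t\<bar> ^ 1)" for t
    proof -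
      have "norm (?g N t) = std_normal_density t * norm (dirichlet_psum chi N (1 / 2 + \<i> * of_real t))"
        by (simp add: norm_mult)
      also have "\<dots> \<le> std_normal_density t * (q * line_const * (1 + \<bar>t\<bar>))"
        by (intro mult_left_mono norm_dirichlet_psum_le[OF bd]) auto
      finally show ?thesis by (simp add: algebra_simps)
    qed
    then show "AE t in lborel. norm (?g N t) \<le> q * line_const * (std_normal_density t * \<bar>t\<bar> ^ 0 + std_normal_density t * \<bar>t\<bar> ^ 1)"
      by simp
  qed
  moreover have "(LINT t|lborel. ?g N t) = (\<Sum>n<N. chi (Suc n) * of_real (gauss_weight Y (Suc n)))" for N
    using integral_dirichlet_psum_gauss[OF Y] by (rule has_bochner_integral_integral_eq)
  ultimately show ?thesis by simp
qed

lemma gauss_weight_nonneg: "gauss_weight Y n \<ge> 0"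
  by (simp add: gauss_weight_def)

lemma gauss_weight_le_1: "n > 0 \<Longrightarrow> gauss_weight Y n \<le> 1"
  unfolding gauss_weight_def using powr_mono[of "-(1/2)" 0 "real n"]
  by (intro mult_le_one) auto

text \<open>For n >= Y^2 one has ln(n/Y) >= (ln n)/2. That explains the 8 in place of 2 and gives a
  majorant of the weights that is free of Y.\<close>

definition gauss_tail :: real where
  "gauss_tail = (\<Sum>n. real (Suc n) powr (- (1/2)) * exp (- (ln (real (Suc n)) ^ 2 / 8)))"

lemma summable_gauss_tail:
  "summable (\<lambda>n. real (Suc n) powr (- (1/2)) * exp (- (ln (real (Suc n)) ^ 2 / 8)))"
proof (rule summable_comparison_test_ev)
  show "summable (\<lambda>n. real (Suc n) powr (- 1 - 1))" by (rule summable_Suc_powr) simp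
  have "\<forall>\<^sub>F n in sequentially. exp 16 \<le> real (Suc n)" by real_asymp
  then show "\<forall>\<^sub>F n in sequentially. norm (real (Suc n) powr (- (1/2)) * exp (- (ln (real (Suc n)) ^ 2 / 8)))
      \<le> real (Suc n) powr (- 1 - 1)"
  proof eventually_elim
    case (elim n)
    define x where "x = real (Suc n)"
    have x: "x \<ge> 1" "ln x \<ge> 16" using elim by (auto simp: x_def ln_ge_iff)
    \<comment> \<open>The threshold exp 16 serves here: (ln x)^2 / 8 >= 2 ln x, so the term is at
      most x^(-2).\<close>
    have "16 * ln x \<le> ln x ^ 2" using x by (simp add: power2_eq_square mult_right_mono)
    then have "exp (- (ln x ^ 2 / 8)) \<le> exp (- 2 * ln x)" by simp
    also have "\<dots> = x powr (- 1 - 1)" using x by (simp add: powr_def)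
    finally have "x powr (- (1/2)) * exp (- (ln x ^ 2 / 8)) \<le> 1 * x powr (- 1 - 1)"
      using x powr_mono[of "-(1/2)" 0 x] by (intro mult_mono) auto
    then show ?case unfolding x_def[symmetric] by simp
  qed
qed

lemma gauss_weight_tail_le:
  assumes Y: "Y \<ge> 1" and n: "real n \<ge> Y ^ 2"
  shows "gauss_weight Y n \<le> real n powr (- (1/2)) * exp (- (ln (real n) ^ 2 / 8))"
proof -
  have n1: "real n \<ge> 1" using n one_le_power[OF Y, of 2] by linarith
  have "ln (Y ^ 2) \<le> ln (real n)" using n n1 Y by (subst ln_le_cancel_iff) auto
  then have "ln Y \<le> ln (real n) / 2" using Y by (simp add: ln_realpow)
  then have "ln (real n) / 2 \<le> ln (real n / Y)" using Y n1 by (simp add: ln_div)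
  then have "(ln (real n) / 2) ^ 2 \<le> ln (real n / Y) ^ 2" using n1 by (intro power_mono) auto
  then show ?thesis unfolding gauss_weight_def
    by (intro mult_left_mono) (auto simp: power_divide)
qed

text \<open>Truncating at N >= Y^2 costs at most \<open>gauss_tail\<close>, whatever Y, N and the
  conductor are. A finite sum is wanted because its powers will be expanded.\<close>

lemma norm_gauss_sum_le:
  assumes bd: "\<And>N. norm (\<Sum>n<N. chi (Suc n)) \<le> q" and le1: "\<And>n. norm (chi n) \<le> 1"
    and Y: "Y \<ge> 1" and N: "real N \<ge> Y ^ 2"
  shows "norm (\<Sum>n<N. chi (Suc n) * of_real (gauss_weight Y (Suc n))) \<le>
     (LINT t|lborel. std_normal_density t * norm (dirichlet_L chi (1 / 2 + \<i> * of_real t))) + gauss_tail"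
proof -
  let ?S = "\<lambda>N. \<Sum>n<N. chi (Suc n) * of_real (gauss_weight Y (Suc n))"
  let ?I = "LINT t|lborel. std_normal_density t *\<^sub>R (exp (\<i> * of_real (t * ln Y)) * dirichlet_L chi (1 / 2 + \<i> * of_real t))"
  have tail: "norm (?S M - ?S N) \<le> gauss_tail" if "M \<ge> N" for M
  proof -
    have "?S M - ?S N = (\<Sum>n\<in>{N..<M}. chi (Suc n) * of_real (gauss_weight Y (Suc n)))"
      using that by (simp add: sum_diff_nat_ivl lessThan_atLeast0)
    also have "norm \<dots> \<le> (\<Sum>n\<in>{N..<M}. real (Suc n) powr (- (1/2)) * exp (- (ln (real (Suc n)) ^ 2 / 8)))"
    proof (rule sum_norm_le)
      fix n assume n: "n \<in> {N..<M}"
      have "norm (chi (Suc n) * of_real (gauss_weight Y (Suc n))) \<le> 1 * gauss_weight Y (Suc n)"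
        unfolding norm_mult using le1 gauss_weight_nonneg by (intro mult_mono) auto
      also have "\<dots> \<le> real (Suc n) powr (- (1/2)) * exp (- (ln (real (Suc n)) ^ 2 / 8))"
        using gauss_weight_tail_le[OF Y, of "Suc n"] N n by simp
      finally show "norm (chi (Suc n) * of_real (gauss_weight Y (Suc n)))
          \<le> real (Suc n) powr (- (1/2)) * exp (- (ln (real (Suc n)) ^ 2 / 8))" .
    qed
    also have "\<dots> \<le> gauss_tail" unfolding gauss_tail_def
      by (intro sum_le_suminf summable_gauss_tail) auto
    finally show ?thesis .
  qed
  have "(\<lambda>M. norm (?S M - ?S N)) \<longlonglongrightarrow> norm (?I - ?S N)"
    using gauss_sums_tendsto[OF bd, of Y] Y by (intro tendsto_intros) auto
  then have "norm (?I - ?S N) \<le> gauss_tail"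
    by (rule LIMSEQ_le_const2) (use tail in blast)
  moreover have "norm ?I \<le> (LINT t|lborel. std_normal_density t * norm (dirichlet_L chi (1 / 2 + \<i> * of_real t)))"
  proof -
    define f where "f = (\<lambda>t. std_normal_density t *\<^sub>R (exp (\<i> * of_real (t * ln Y)) * dirichlet_L chi (1 / 2 + \<i> * of_real t)))"
    have "norm (f t) = std_normal_density t * norm (dirichlet_L chi (1 / 2 + \<i> * of_real t))" for t
      unfolding f_def by (simp add: norm_mult)
    then show ?thesis using integral_norm_bound[of lborel f] unfolding f_def[symmetric] by simp
  qed
  moreover have "norm (?S N) \<le> norm ?I + norm (?I - ?S N)"
    using norm_triangle_sub[of "?S N" ?I] by (simp only: norm_minus_commute)
  ultimately show ?thesis by linarith
qed

section \<open>Moments\<close>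

definition discs :: "real \<Rightarrow> nat set" where
  "discs X = {d. 0 < d \<and> real d \<le> X \<and> odd d \<and> squarefree d}"

lemma finite_discs: "finite (discs X)"
  by (rule finite_subset[of _ "{..nat \<lfloor>X\<rfloor>}"]) (auto simp: discs_def le_nat_floor)

lemma card_discs_le: "X \<ge> 0 \<Longrightarrow> real (card (discs X)) \<le> X"
proof -
  assume X: "X \<ge> 0"
  have "card (discs X) \<le> card {1..nat \<lfloor>X\<rfloor>}"
    by (intro card_mono) (auto simp: discs_def le_nat_floor)
  then show ?thesis using X by simp linarith
qed

lemma chi8_eq_psi8: "d \<in> discs X \<Longrightarrow> chi8 d n = of_int (psi8 d n)"
  by (simp add: chi8_def kronecker_8_eq_psi8 discs_def)

lemma psi8_0: "psi8 d 0 = 0"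
  by (simp add: psi8_def eps8_def)

lemma norm_sum_chi8_le:
  assumes d: "d \<in> discs X"
  shows "norm (\<Sum>n<N. chi8 d (Suc n)) \<le> 8 * real d"
proof -
  have "(\<Sum>n<N. psi8 d (Suc n)) = (\<Sum>n<Suc N. psi8 d n)"
    by (subst sum.lessThan_Suc_shift) (simp add: psi8_0)
  then have "\<bar>\<Sum>n<N. psi8 d (Suc n)\<bar> \<le> int (8 * d)"
    using abs_sum_psi8_le[of d "Suc N"] d by (simp add: discs_def)
  moreover have "(\<Sum>n<N. chi8 d (Suc n)) = of_int (\<Sum>n<N. psi8 d (Suc n))"
    using chi8_eq_psi8[OF d] by simp
  ultimately have "norm (\<Sum>n<N. chi8 d (Suc n)) \<le> real_of_int (int (8 * d))"
    by (simp only: norm_of_int of_int_abs[symmetric] of_int_le_iff)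
  then show ?thesis by simp
qed

definition L_abs :: "nat \<Rightarrow> real \<Rightarrow> real" where
  "L_abs d t = norm (dirichlet_L (chi8 d) (1 / 2 + \<i> * of_real t))"

definition L_mean :: "nat \<Rightarrow> real \<Rightarrow> real" where
  "L_mean d T = (LINT t|lborel. indicator {-T..T} t * (L_abs d t / (1 + \<bar>t\<bar>)))"

lemma L_abs_nonneg: "L_abs d t \<ge> 0"
  by (simp add: L_abs_def)

lemma L_abs_le: "d \<in> discs X \<Longrightarrow> L_abs d t \<le> 8 * real d * line_const * (1 + \<bar>t\<bar>)"
  unfolding L_abs_def by (rule norm_dirichlet_L_le[OF norm_sum_chi8_le])

lemma continuous_L_abs: "d \<in> discs X \<Longrightarrow> continuous_on UNIV (L_abs d)"
  unfolding L_abs_def by (intro continuous_on_norm continuous_dirichlet_L[OF norm_sum_chi8_le])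

lemma measurable_L_abs: "d \<in> discs X \<Longrightarrow> L_abs d \<in> borel_measurable borel"
  using continuous_L_abs by (intro borel_measurable_continuous_onI) auto

lemma integrable_L_mean:
  assumes d: "d \<in> discs X"
  shows "integrable lborel (\<lambda>t. indicator {-T..T} t * (L_abs d t / (1 + \<bar>t\<bar>)))"
proof -
  have "continuous_on {-T..T} (\<lambda>t. L_abs d t / (1 + \<bar>t\<bar>))"
    using continuous_on_subset[OF continuous_L_abs[OF d]] by (intro continuous_intros) auto
  from borel_integrable_compact[OF _ this]
  show ?thesis by (simp add: indicator_def if_distrib[of "\<lambda>x. x * _"] cong: if_cong)
qed

lemma L_mean_integrand_nonneg: "0 \<le> indicator A t * (L_abs d t / (1 + \<bar>t\<bar>))"
  by (intro mult_nonneg_nonneg divide_nonneg_nonneg L_abs_nonneg) (auto simp: indicator_def)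

lemma nn_integral_L_mean:
  assumes d: "d \<in> discs X"
  shows "(\<integral>\<^sup>+ t. ennreal (indicator {-T..T} t * (L_abs d t / (1 + \<bar>t\<bar>))) \<partial>lborel) = ennreal (L_mean d T)"
  unfolding L_mean_def
  by (intro nn_integral_eq_integral integrable_L_mean[OF d] AE_I2 L_mean_integrand_nonneg)

lemma L_mean_nonneg: "L_mean d T \<ge> 0"
  unfolding L_mean_def by (intro Bochner_Integration.integral_nonneg L_mean_integrand_nonneg)

text \<open>The link between the Gaussian and the weight 1/(1 + |t|) of the theorem, from |t| <= t^2
  + 1/4 and 1 + t^2/2 <= exp(t^2/2).\<close>

lemma std_normal_density_le: "std_normal_density t \<le> 2 / (1 + \<bar>t\<bar>)"
proof -
  have "1 / sqrt (2 * pi) \<le> 1"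
  proof -
    have "1 \<le> 2 * pi" using pi_gt3 by linarith
    then show ?thesis by (simp add: divide_le_eq)
  qed
  then have "std_normal_density t \<le> 1 * exp (- t\<^sup>2 / 2)"
    unfolding std_normal_density_def by (intro mult_right_mono) auto
  also have "\<dots> = 1 / exp (t\<^sup>2 / 2)"
    unfolding minus_divide_left[symmetric] exp_minus by (simp add: inverse_eq_divide)
  also have "\<dots> \<le> 1 / ((1 + \<bar>t\<bar>) / 2)"
  proof (intro divide_left_mono)
    have "(\<bar>t\<bar> - 1/2)\<^sup>2 = t\<^sup>2 - \<bar>t\<bar> + 1/4" by (simp add: power2_diff power_divide)
    then have "\<bar>t\<bar> \<le> t\<^sup>2 + 1/4" using zero_le_power2[of "\<bar>t\<bar> - 1/2"] by linarith
    moreover have "1 + t\<^sup>2 / 2 \<le> exp (t\<^sup>2 / 2)" by (rule exp_ge_add_one_self)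
    ultimately show "(1 + \<bar>t\<bar>) / 2 \<le> exp (t\<^sup>2 / 2)" using zero_le_power2[of t] by argo
  qed auto
  finally show ?thesis by simp
qed

text \<open>It is essential that C depends on \<Delta> alone: its contribution to the moment, summed
  over at most X discriminants, is then O(X) and loses against X times a power of ln X.\<close>

lemma gauss_sum_le_L_mean:
  assumes Delta: "\<Delta> > 0"
  shows "\<exists>C\<ge>0. \<forall>X\<ge>1. \<forall>d\<in>discs X. \<forall>Y\<ge>1. \<forall>N. real N \<ge> Y ^ 2 \<longrightarrow>
     \<bar>\<Sum>n=1..N. real_of_int (psi8 d n) * gauss_weight Y n\<bar> \<le> 2 * L_mean d (X powr \<Delta>) + C"
proof -
  define r where "r = nat \<lceil>1 / \<Delta>\<rceil>"
  have r: "\<Delta> * real r \<ge> 1"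
  proof -
    have "1 / \<Delta> \<le> real r" unfolding r_def by linarith
    then show ?thesis using Delta by (simp add: field_simps)
  qed
  define h where "h = (\<lambda>t. 8 * line_const * (std_normal_density t * \<bar>t\<bar> ^ r + std_normal_density t * \<bar>t\<bar> ^ Suc r))"
  have h_int: "integrable lborel h" unfolding h_def
    by (intro integrable_mult_right Bochner_Integration.integrable_add integrable_std_normal_moment_abs)
  have h0: "h t \<ge> 0" for t unfolding h_def using line_const_ge_1 by (intro mult_nonneg_nonneg add_nonneg_nonneg) auto
  have tail0: "gauss_tail \<ge> 0" unfolding gauss_tail_def by (intro suminf_nonneg summable_gauss_tail) auto
  define C where "C = (LINT t|lborel. h t) + gauss_tail"
  have "C \<ge> 0" unfolding C_def using h0 tail0 by (intro add_nonneg_nonneg) auto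
  moreover have "\<bar>\<Sum>n=1..N. real_of_int (psi8 d n) * gauss_weight Y n\<bar> \<le> 2 * L_mean d (X powr \<Delta>) + C"
    if X: "X \<ge> 1" and d: "d \<in> discs X" and Y: "Y \<ge> 1" and N: "real N \<ge> Y ^ 2" for X d Y N
  proof -
    define T where "T = X powr \<Delta>"
    \<comment> \<open>The moment \<open>\<bar>t\<bar>\<^bsup>r\<^esup>\<close> of the normal density absorbs the conductor outside \<open>[-T, T]\<close>, since \<open>T\<^bsup>r\<^esup> \<ge> X\<close>.\<close>
    have T: "T > 0" "T ^ r \<ge> X"
    proof -
      show "T > 0" using X by (simp add: T_def)
      have "X powr 1 \<le> X powr (\<Delta> * real r)" using X r by (intro powr_mono) auto
      also have "\<dots> = T ^ r" using X by (simp add: T_def powr_powr[symmetric] powr_realpow)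
      finally show "T ^ r \<ge> X" using X by simp
    qed
    have pt: "std_normal_density t * L_abs d t \<le> 2 * (indicator {-T..T} t * (L_abs d t / (1 + \<bar>t\<bar>))) + h t" for t
    proof (cases "\<bar>t\<bar> \<le> T")
      case True
      then have "indicator {-T..T} t = (1::real)" by (auto simp: indicator_def)
      moreover have "std_normal_density t * L_abs d t \<le> 2 / (1 + \<bar>t\<bar>) * L_abs d t"
        by (intro mult_right_mono std_normal_density_le L_abs_nonneg)
      ultimately show ?thesis using h0[of t] by simp
    next
      case False
      then have "T ^ r \<le> \<bar>t\<bar> ^ r" using T by (intro power_mono) auto
      then have dt: "real d \<le> \<bar>t\<bar> ^ r" using T(2) d unfolding discs_def by simp
      have "L_abs d t \<le> 8 * real d * line_const * (1 + \<bar>t\<bar>)" by (rule L_abs_le[OF d])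
      also have "\<dots> \<le> 8 * \<bar>t\<bar> ^ r * line_const * (1 + \<bar>t\<bar>)"
        using dt line_const_ge_1 by (intro mult_right_mono mult_left_mono) auto
      finally have "std_normal_density t * L_abs d t \<le> std_normal_density t * (8 * \<bar>t\<bar> ^ r * line_const * (1 + \<bar>t\<bar>))"
        by (intro mult_left_mono) auto
      also have "\<dots> = h t" by (simp add: h_def algebra_simps)
      finally show ?thesis using L_mean_integrand_nonneg[of "{-T..T}" t d] by linarith
    qed
    have le_q: "std_normal_density t * L_abs d t
        \<le> 8 * real d * line_const * (std_normal_density t * \<bar>t\<bar> ^ 0 + std_normal_density t * \<bar>t\<bar> ^ 1)" for t
      using mult_left_mono[OF L_abs_le[OF d, of t], of "std_normal_density t"] by (simp add: algebra_simps)
    have "integrable lborel (\<lambda>t. std_normal_density t * L_abs d t)"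
    proof (rule Bochner_Integration.integrable_bound)
      show "integrable lborel (\<lambda>t. 8 * real d * line_const * (std_normal_density t * \<bar>t\<bar> ^ 0 + std_normal_density t * \<bar>t\<bar> ^ 1))"
        by (intro integrable_mult_right Bochner_Integration.integrable_add integrable_std_normal_moment_abs)
      show "(\<lambda>t. std_normal_density t * L_abs d t) \<in> borel_measurable lborel"
        using measurable_L_abs[OF d] by measurable
      have "norm (std_normal_density t * L_abs d t)
        \<le> norm (8 * real d * line_const * (std_normal_density t * \<bar>t\<bar> ^ 0 + std_normal_density t * \<bar>t\<bar> ^ 1))" for t
      proof -
        have "norm (std_normal_density t * L_abs d t) = std_normal_density t * L_abs d t"
          using L_abs_nonneg[of d t] by simp
        then show ?thesis using order_trans[OF le_q[of t] abs_ge_self] by (simp only: real_norm_def)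
      qed
      then show "AE t in lborel. norm (std_normal_density t * L_abs d t)
        \<le> norm (8 * real d * line_const * (std_normal_density t * \<bar>t\<bar> ^ 0 + std_normal_density t * \<bar>t\<bar> ^ 1))"
        by (intro AE_I2)
    qed
    then have "(LINT t|lborel. std_normal_density t * L_abs d t)
       \<le> (LINT t|lborel. 2 * (indicator {-T..T} t * (L_abs d t / (1 + \<bar>t\<bar>))) + h t)"
      by (intro integral_mono Bochner_Integration.integrable_add integrable_mult_right
          integrable_L_mean[OF d] h_int pt)
    also have "\<dots> = 2 * L_mean d T + (LINT t|lborel. h t)"
      unfolding L_mean_def
      by (subst Bochner_Integration.integral_add)
         (intro integrable_mult_right integrable_L_mean[OF d] h_int, rule h_int, simp only: integral_mult_right_zero)
    finally have *: "(LINT t|lborel. std_normal_density t * L_abs d t) \<le> 2 * L_mean d T + (LINT t|lborel. h t)" .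
    have "norm (\<Sum>n<N. chi8 d (Suc n) * of_real (gauss_weight Y (Suc n)))
        \<le> (LINT t|lborel. std_normal_density t * L_abs d t) + gauss_tail"
      unfolding L_abs_def
    proof (rule norm_gauss_sum_le[OF norm_sum_chi8_le[OF d] _ Y N])
      show "norm (chi8 d n) \<le> 1" for n
        using abs_psi8_le[of d n] by (simp add: chi8_eq_psi8[OF d])
    qed
    moreover have "(\<Sum>n<N. chi8 d (Suc n) * of_real (gauss_weight Y (Suc n)))
        = of_real (\<Sum>n=1..N. real_of_int (psi8 d n) * gauss_weight Y n)"
    proof -
      have "(\<Sum>n=1..N. real_of_int (psi8 d n) * gauss_weight Y n)
          = (\<Sum>n<N. real_of_int (psi8 d (Suc n)) * gauss_weight Y (Suc n))"
        by (rule sum.reindex_bij_witness[of _ Suc "\<lambda>n. n - 1"]) auto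
      then show ?thesis by (simp add: chi8_eq_psi8[OF d])
    qed
    ultimately show ?thesis using * unfolding C_def T_def by (simp only: norm_of_real)
  qed
  ultimately show ?thesis by blast
qed

section \<open>Even moments of the weighted character sums\<close>

lemma psi8_square_eq_1:
  assumes d: "odd d" and n: "coprime n (2 * d)"
  shows "psi8 d n ^ 2 = 1"
proof -
  have n2: "odd n" "coprime n d" using n by auto
  have "Legendre (int n) (int p) \<noteq> 0" if "p \<in> prime_factors d" for p
  proof -
    have "prime p" "p dvd d" using that by auto
    then have "\<not> p dvd n" using n2(2) by (meson coprime_common_divisor_nat not_prime_1 coprime_common_divisor not_prime_unit)
    then show ?thesis by (simp add: Legendre_eq_0_iff)
  qed
  moreover have "eps8 n \<noteq> 0" "eps4 n \<noteq> 0" using n2 by (auto simp: eps8_def eps4_def)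
  ultimately have "psi8 d n \<noteq> 0" by (simp add: psi8_def)
  with abs_psi8_le[of d n] have "psi8 d n = 1 \<or> psi8 d n = -1" by linarith
  then show ?thesis by auto
qed

lemma psi8_prod:
  assumes d: "odd d" and I: "finite I"
  shows "psi8 d (\<Prod>i\<in>I. f i) = (\<Prod>i\<in>I. psi8 d (f i))"
  using I by (induction I rule: finite_induct) (simp_all add: psi8_1[OF d, simplified] psi8_mult[OF d])

lemma psi8_even: "even n \<Longrightarrow> psi8 d n = 0"
  by (simp add: psi8_def eps8_def)

text \<open>The value of sqrt Y times the Gaussian weight at n = 4Y, the right end of the window,
  where it is smallest.\<close>

definition gauss_const :: real where
  "gauss_const = exp (- (ln 4 ^ 2 / 2)) / 2"

lemma gauss_weight_ge:
  assumes Y: "Y > 0" and n: "Y \<le> real n" "real n \<le> 4 * Y"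
  shows "gauss_const / sqrt Y \<le> gauss_weight Y n"
proof -
  have "1 / (2 * sqrt Y) = (4 * Y) powr (- (1/2))"
    using Y by (simp add: powr_minus_divide powr_half_sqrt real_sqrt_mult)
  also have "\<dots> \<le> real n powr (- (1/2))" using Y n by (intro powr_mono2') auto
  finally have 1: "1 / (2 * sqrt Y) \<le> real n powr (- (1/2))" .
  have "ln (real n / Y) \<ge> 0" "ln (real n / Y) \<le> ln 4"
    using Y n by (auto simp: field_simps intro!: ln_ge_zero)
  then have "ln (real n / Y) ^ 2 \<le> ln 4 ^ 2" by (intro power_mono) auto
  then have 2: "exp (- (ln 4 ^ 2 / 2)) \<le> exp (- (ln (real n / Y) ^ 2 / 2))" by simp
  have "1 / (2 * sqrt Y) * exp (- (ln 4 ^ 2 / 2)) \<le> gauss_weight Y n"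
    unfolding gauss_weight_def using 1 2 by (intro mult_mono) auto
  then show ?thesis by (simp add: gauss_const_def)
qed

text \<open>At a square the character is itself a square, so every term with square product is
  nonnegative for every d. Restricting to the discriminants in D' and to tuples in the window
  coprime to 2d therefore only lowers that part of the sum.\<close>

lemma moment_gauss_sum_ge:
  fixes I :: "'i set" and Y :: real
  defines "S \<equiv> \<lambda>d N. \<Sum>n=1..N. real_of_int (psi8 d n) * gauss_weight Y n"
  assumes I: "finite I" "even (card I)" and Y: "Y > 0" and N: "4 * Y \<le> real N" "N > 0" and X: "X \<ge> 1"
    and D: "D' \<subseteq> discs X"
  shows "(gauss_const / sqrt Y) ^ card I * (\<Sum>d\<in>D'. real (card (square_tuples I d Y)))
       - 12 * real N ^ (2 * card I) * X powr (7/8) \<le> (\<Sum>d\<in>discs X. S d N ^ card I)"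
proof -
  define \<Omega> where "\<Omega> = (I \<rightarrow>\<^sub>E {1..N})"
  define W where "W = (\<lambda>f. \<Prod>i\<in>I. gauss_weight Y (f i))"
  define R where "R = (\<lambda>f. \<Sum>d\<in>discs X. real_of_int (psi8 d (\<Prod>i\<in>I. f i)))"
  define Sq where "Sq = {f\<in>\<Omega>. \<exists>r. (\<Prod>i\<in>I. f i) = r ^ 2}"
  have fin\<Omega>: "finite \<Omega>" unfolding \<Omega>_def using I by (intro finite_PiE) auto
  have card\<Omega>: "card \<Omega> = N ^ card I" unfolding \<Omega>_def using I by (simp add: card_PiE)
  have odd_d: "odd d" if "d \<in> discs X" for d using that by (simp add: discs_def)
  have W0: "W f \<ge> 0" for f unfolding W_def by (intro prod_nonneg) (auto intro: gauss_weight_nonneg)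
  have W1: "W f \<le> 1" if "f \<in> \<Omega>" for f
    unfolding W_def
  proof (rule prod_le_1)
    fix i assume "i \<in> I"
    then have "f i > 0" using that unfolding \<Omega>_def by (auto simp: Suc_le_eq)
    then show "0 \<le> gauss_weight Y (f i) \<and> gauss_weight Y (f i) \<le> 1"
      using gauss_weight_nonneg gauss_weight_le_1 by blast
  qed
  have expand: "S d N ^ card I = (\<Sum>f\<in>\<Omega>. W f * real_of_int (psi8 d (\<Prod>i\<in>I. f i)))" if d: "d \<in> discs X" for d
  proof -
    have "S d N ^ card I = (\<Prod>i\<in>I. S d N)" by simp
    also have "\<dots> = (\<Sum>f\<in>\<Omega>. \<Prod>i\<in>I. real_of_int (psi8 d (f i)) * gauss_weight Y (f i))"
      unfolding S_def \<Omega>_def using I by (intro prod_sum_PiE) auto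
    also have "\<dots> = (\<Sum>f\<in>\<Omega>. W f * real_of_int (psi8 d (\<Prod>i\<in>I. f i)))"
      by (simp add: psi8_prod[OF odd_d[OF d] I(1)] W_def prod.distrib mult.commute)
    finally show ?thesis .
  qed
  have "(\<Sum>d\<in>discs X. S d N ^ card I) = (\<Sum>d\<in>discs X. \<Sum>f\<in>\<Omega>. W f * real_of_int (psi8 d (\<Prod>i\<in>I. f i)))"
    using expand by simp
  also have "\<dots> = (\<Sum>f\<in>\<Omega>. W f * R f)"
    unfolding R_def sum_distrib_left by (rule sum.swap)
  also have "\<dots> = (\<Sum>f\<in>Sq. W f * R f) + (\<Sum>f\<in>\<Omega> - Sq. W f * R f)"
    using sum.subset_diff[of Sq \<Omega> "\<lambda>f. W f * R f"] fin\<Omega> by (simp add: Sq_def)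
  finally have total: "(\<Sum>d\<in>discs X. S d N ^ card I) = (\<Sum>f\<in>Sq. W f * R f) + (\<Sum>f\<in>\<Omega> - Sq. W f * R f)" .
  \<comment> \<open>Both the number of tuples and the product m in the character sum bound are at
    most \<open>N ^ card I\<close>, which explains the exponent \<open>2 * card I\<close>. For even
    m the character vanishes.\<close>
  have offdiag: "- (12 * real N ^ (2 * card I) * X powr (7/8)) \<le> (\<Sum>f\<in>\<Omega> - Sq. W f * R f)"
  proof -
    have "\<bar>W f * R f\<bar> \<le> 12 * real N ^ card I * X powr (7/8)" if f: "f \<in> \<Omega> - Sq" for f
    proof -
      define m where "m = (\<Prod>i\<in>I. f i)"
      have "m \<le> (\<Prod>i\<in>I. N)" unfolding m_def using f by (intro prod_mono) (auto simp: \<Omega>_def)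
      then have "m \<le> N ^ card I" by simp
      then have mN: "real m \<le> real N ^ card I" by (metis of_nat_le_iff of_nat_power)
      have ns: "\<not> (\<exists>r. m = r ^ 2)" using f by (auto simp: Sq_def m_def)
      have "\<bar>R f\<bar> \<le> 12 * real m * X powr (7/8)"
      proof (cases "odd m")
        case True
        define M where "M = nat \<lfloor>X\<rfloor>"
        have "discs X = {d. 0 < d \<and> d \<le> M \<and> odd d \<and> squarefree d}"
          unfolding discs_def M_def using X by (auto simp: le_nat_floor) linarith
        then have "R f = real_of_int (\<Sum>d | 0 < d \<and> d \<le> M \<and> odd d \<and> squarefree d. psi8 d m)"
          unfolding R_def m_def by simp
        then have "\<bar>R f\<bar> \<le> 12 * real m * real M powr (7/8)"
          using abs_sum_psi8_squarefree_le[OF True ns, of M] by simp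
        also have "\<dots> \<le> 12 * real m * X powr (7/8)"
          using X by (intro mult_left_mono powr_mono2) (auto simp: M_def)
        finally show ?thesis .
      next
        case False
        then show ?thesis unfolding R_def m_def[symmetric] by (simp add: psi8_even)
      qed
      also have "\<dots> \<le> 12 * real N ^ card I * X powr (7/8)"
        using mN by (intro mult_right_mono mult_left_mono) auto
      finally have "\<bar>W f\<bar> * \<bar>R f\<bar> \<le> 1 * (12 * real N ^ card I * X powr (7/8))"
        using W0[of f] W1[of f] f by (intro mult_mono) auto
      then show ?thesis by (simp add: abs_mult)
    qed
    then have "\<bar>\<Sum>f\<in>\<Omega> - Sq. W f * R f\<bar> \<le> (\<Sum>f\<in>\<Omega> - Sq. 12 * real N ^ card I * X powr (7/8))"
      by (intro sum_abs[THEN order_trans] sum_mono) auto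
    also have "\<dots> \<le> real (card \<Omega>) * (12 * real N ^ card I * X powr (7/8))"
      using fin\<Omega> card_mono[OF fin\<Omega>, of "\<Omega> - Sq"] by (simp add: mult_right_mono)
    also have "\<dots> = 12 * real N ^ (2 * card I) * X powr (7/8)"
      unfolding card\<Omega> mult_2 power_add by simp
    finally show ?thesis by linarith
  qed
  have "(gauss_const / sqrt Y) ^ card I * (\<Sum>d\<in>D'. real (card (square_tuples I d Y)))
      = (\<Sum>d\<in>D'. \<Sum>f\<in>square_tuples I d Y. (gauss_const / sqrt Y) ^ card I)"
    by (simp add: sum_distrib_left mult.commute)
  also have "\<dots> \<le> (\<Sum>d\<in>D'. \<Sum>f\<in>Sq. W f * real_of_int (psi8 d (\<Prod>i\<in>I. f i)))"
  proof (rule sum_mono)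
    fix d assume "d \<in> D'"
    then have d: "d \<in> discs X" using D by blast
    have sub: "square_tuples I d Y \<subseteq> Sq"
    proof
      fix f assume f: "f \<in> square_tuples I d Y"
      have "f i \<in> {1..N}" if "i \<in> I" for i
      proof -
        have "Y \<le> real (f i)" "real (f i) \<le> 4 * Y" using f that by (auto simp: square_tuples_def)
        then have "0 < real (f i)" "real (f i) \<le> real N" using Y N by linarith+
        then show ?thesis by (simp add: Suc_le_eq)
      qed
      moreover have "f \<in> extensional I" using f unfolding square_tuples_def PiE_def by simp
      ultimately have "f \<in> \<Omega>" unfolding \<Omega>_def by (simp add: PiE_iff)
      then show "f \<in> Sq" using f by (simp add: square_tuples_def Sq_def)
    qed
    have nonneg: "0 \<le> W f * real_of_int (psi8 d (\<Prod>i\<in>I. f i))" if f: "f \<in> Sq" for f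
    proof -
      obtain r where "(\<Prod>i\<in>I. f i) = r ^ 2" using f by (auto simp: Sq_def)
      then have "psi8 d (\<Prod>i\<in>I. f i) = psi8 d r ^ 2" using psi8_mult[OF odd_d[OF d]] by (simp add: power2_eq_square)
      then show ?thesis using W0 by simp
    qed
    have "(\<Sum>f\<in>square_tuples I d Y. (gauss_const / sqrt Y) ^ card I)
       \<le> (\<Sum>f\<in>square_tuples I d Y. W f * real_of_int (psi8 d (\<Prod>i\<in>I. f i)))"
    proof (rule sum_mono)
      fix f assume f: "f \<in> square_tuples I d Y"
      have fi: "Y \<le> real (f i)" "real (f i) \<le> 4 * Y" "coprime (f i) (2 * d)" if "i \<in> I" for i
        using f that unfolding square_tuples_def by auto
      obtain r where r: "(\<Prod>i\<in>I. f i) = r ^ 2" using f by (auto simp: square_tuples_def)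
      have "coprime (\<Prod>i\<in>I. f i) (2 * d)" using fi by (intro prod_coprime_left)
      then have "coprime r (2 * d)" unfolding r by simp
      then have "psi8 d (\<Prod>i\<in>I. f i) = 1"
        unfolding r power2_eq_square psi8_mult[OF odd_d[OF d]]
        using psi8_square_eq_1[OF odd_d[OF d]] by (simp add: power2_eq_square)
      moreover have "(\<Prod>i\<in>I. gauss_const / sqrt Y) \<le> W f"
        unfolding W_def using fi gauss_weight_ge[OF Y] Y by (intro prod_mono) (auto simp: gauss_const_def)
      ultimately show "(gauss_const / sqrt Y) ^ card I \<le> W f * real_of_int (psi8 d (\<Prod>i\<in>I. f i))" by simp
    qed
    also have "\<dots> \<le> (\<Sum>f\<in>Sq. W f * real_of_int (psi8 d (\<Prod>i\<in>I. f i)))"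
      using sub nonneg fin\<Omega> by (intro sum_mono2) (auto simp: Sq_def)
    finally show "(\<Sum>f\<in>square_tuples I d Y. (gauss_const / sqrt Y) ^ card I)
       \<le> (\<Sum>f\<in>Sq. W f * real_of_int (psi8 d (\<Prod>i\<in>I. f i)))" .
  qed
  also have "\<dots> \<le> (\<Sum>d\<in>discs X. \<Sum>f\<in>Sq. W f * real_of_int (psi8 d (\<Prod>i\<in>I. f i)))"
  proof (rule sum_mono2[OF finite_discs D])
    fix d assume d: "d \<in> discs X - D'"
    show "0 \<le> (\<Sum>f\<in>Sq. W f * real_of_int (psi8 d (\<Prod>i\<in>I. f i)))"
    proof (rule sum_nonneg)
      fix f assume "f \<in> Sq"
      then obtain r where "(\<Prod>i\<in>I. f i) = r ^ 2" by (auto simp: Sq_def)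
      then have "psi8 d (\<Prod>i\<in>I. f i) = psi8 d r ^ 2" using psi8_mult[OF odd_d] d by (simp add: power2_eq_square)
      then show "0 \<le> W f * real_of_int (psi8 d (\<Prod>i\<in>I. f i))" using W0 by simp
    qed
  qed
  also have "\<dots> = (\<Sum>f\<in>Sq. W f * R f)"
    unfolding R_def sum_distrib_left by (rule sum.swap)
  finally show ?thesis using offdiag unfolding total by linarith
qed

lemma card_edges_even: "k \<ge> 1 \<Longrightarrow> card (edges {1..2 * k}) = 2 * k ^ 2 - k"
proof -
  have "card (edges {1..2 * k}) = (2 * k) choose 2"
    unfolding edges_def using n_subsets[of "{1..2 * k}" 2] by simp
  also have "\<dots> = k * (2 * k - 1)" by (simp add: choose_two)
  finally show ?thesis by (simp add: power2_eq_square diff_mult_distrib2)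
qed

lemma sum_power_le:
  fixes x y :: real
  assumes "x \<ge> 0" "y \<ge> 0" shows "(x + y) ^ n \<le> 2 ^ n * (x ^ n + y ^ n)"
proof -
  have "(x + y) ^ n \<le> (2 * max x y) ^ n" using assms by (intro power_mono) auto
  also have "\<dots> = 2 ^ n * max x y ^ n" by (rule power_mult_distrib)
  also have "max x y ^ n \<le> x ^ n + y ^ n" using assms by (simp add: max_def)
  finally show ?thesis by simp
qed

text \<open>On \<open>[Y, 4Y]\<close> the weights to the power 2k give Y^(-k), which cancels the Y^k
  in the number of tuples. What remains is a constant times (ln Y)^E for each of the order of X good
  discriminants, and ln Y = \<delta> ln X.\<close>

lemma eventually_moment_L_mean_ge:
  assumes k: "k \<ge> 1" and Delta: "\<Delta> > 0"
  shows "\<exists>c>0. \<forall>\<^sub>F X in at_top. c * (X * ln X ^ (2 * k ^ 2 - k)) \<le>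
           (\<Sum>d\<in>discs X. L_mean d (X powr \<Delta>) ^ (2 * k))"
proof -
  define I where "I = {1..2 * k}"
  have I: "finite I" "I \<noteq> {}" "card I = 2 * k" "even (card I)" using k by (auto simp: I_def)
  define E where "E = 2 * k ^ 2 - k"
  have E: "card (edges I) = E" "E \<ge> 1"
  proof -
    show "card (edges I) = E" unfolding I_def E_def by (rule card_edges_even[OF k])
    have "k * 1 \<le> k * k" using k by (intro mult_left_mono) auto
    then show "E \<ge> 1" using k unfolding E_def power2_eq_square by linarith
  qed
  define \<delta> where "\<delta> = 1 / (128 * real k)"
    \<comment> \<open>With \<open>Y = X\<^bsup>\<delta>\<^esup>\<close> the off-diagonal terms are at most \<open>Y\<^bsup>8k\<^esup> X\<^bsup>7/8\<^esup> = X\<^bsup>15/16\<^esup>\<close> up to a constant.\<close>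
  have \<delta>: "\<delta> > 0" using k by (simp add: \<delta>_def)
  obtain c1 where c1: "c1 > 0" and tuples: "\<forall>\<^sub>F Y in at_top. \<forall>d. odd d \<longrightarrow> (\<Sum>p\<in>prime_factors d. 1 / real p) \<le> 1/4 \<longrightarrow>
    real (card (prime_factors d)) \<le> Y powr (1/4) / 16 \<longrightarrow>
    c1 * (sqrt Y ^ (2 * k) * ln Y ^ E) \<le> real (card (square_tuples I d Y))"
    using eventually_card_square_tuples_ge[OF I(1,2)] unfolding I(3) E(1) by blast
  define G where "G = (\<lambda>X. {d. 0 < d \<and> real d \<le> X \<and> odd d \<and> squarefree d \<and> (\<Sum>p\<in>prime_factors d. 1 / real p) \<le> 1/4})"
  obtain c2 where c2: "c2 > 0" and goodd: "\<forall>\<^sub>F X in at_top. c2 * X \<le> real (card (G X))"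
    using eventually_card_discriminants_ge unfolding G_def by blast
  obtain C where C: "C \<ge> 0" and gauss: "\<And>X d Y N. X \<ge> 1 \<Longrightarrow> d \<in> discs X \<Longrightarrow> Y \<ge> 1 \<Longrightarrow> real N \<ge> Y ^ 2 \<Longrightarrow>
     \<bar>\<Sum>n=1..N. real_of_int (psi8 d n) * gauss_weight Y n\<bar> \<le> 2 * L_mean d (X powr \<Delta>) + C"
    using gauss_sum_le_L_mean[OF Delta] by blast
  have gc: "gauss_const > 0" by (simp add: gauss_const_def)
  define c3 where "c3 = gauss_const ^ (2 * k) * c1 * c2 * \<delta> ^ E"
  have c3: "c3 > 0" unfolding c3_def using gc c1 c2 \<delta> by simp
  \<comment> \<open>K X collects everything of order X: the off-diagonal terms and the contribution
    of C. Since E >= 1, it is absorbed as soon as ln X >= 2 K / c3.\<close>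
  define K where "K = 12 * 2 ^ (4 * k) + (2 * C) ^ (2 * k)"
  have lim: "filterlim (\<lambda>X::real. X powr \<delta>) at_top at_top" using \<delta> by real_asymp
  have ev_tuples: "\<forall>\<^sub>F X in at_top. \<forall>d. odd d \<longrightarrow> (\<Sum>p\<in>prime_factors d. 1 / real p) \<le> 1/4 \<longrightarrow>
    real (card (prime_factors d)) \<le> (X powr \<delta>) powr (1/4) / 16 \<longrightarrow>
    c1 * (sqrt (X powr \<delta>) ^ (2 * k) * ln (X powr \<delta>) ^ E) \<le> real (card (square_tuples I d (X powr \<delta>)))"
    by (rule eventually_compose_filterlim[OF tuples lim])
  have ev_Y: "\<forall>\<^sub>F X in at_top. 4 \<le> X powr \<delta>" using lim unfolding filterlim_at_top by blast
  \<comment> \<open>The tuple count requires at most Y^(1/4) / 16 prime factors of d; log 2 X bounds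
    their number and is smaller than any power of X.\<close>
  have ev_log: "\<forall>\<^sub>F X in at_top. log 2 X \<le> X powr (\<delta> / 4) / 16" using \<delta> by real_asymp
  have ev_K: "\<forall>\<^sub>F X in at_top. 2 * K / c3 \<le> ln (X::real)"
  proof -
    have "\<forall>\<^sub>F X in at_top. z \<le> ln X" for z :: real by real_asymp
    then show ?thesis .
  qed
  have ev_ln: "\<forall>\<^sub>F X in at_top. 1 \<le> ln (X::real)" by real_asymp
  have "\<forall>\<^sub>F X in at_top. c3 / (2 * 4 ^ (2 * k)) * (X * ln X ^ E) \<le> (\<Sum>d\<in>discs X. L_mean d (X powr \<Delta>) ^ (2 * k))"
    using ev_tuples goodd ev_Y ev_log ev_K ev_ln eventually_ge_at_top[of 1]
  proof eventually_elim
    case (elim X)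
    define Y where "Y = X powr \<delta>"
    define N where "N = nat \<lceil>Y ^ 2\<rceil>"
    define S where "S = (\<lambda>d. \<Sum>n=1..N. real_of_int (psi8 d n) * gauss_weight Y n)"
    define A where "A = (\<lambda>d. L_mean d (X powr \<Delta>))"
    have X: "X \<ge> 1" by (rule elim(7))
    have Y: "Y \<ge> 4" using elim(3) by (simp add: Y_def)
    \<comment> \<open>With Y >= 4 the window \<open>[Y, 4Y]\<close> lies below the truncation point
      N >= Y^2.\<close>
    have YY: "4 * Y \<le> Y ^ 2" using Y by (simp add: power2_eq_square mult_right_mono)
    have N: "Y ^ 2 \<le> real N" "real N \<le> 2 * Y ^ 2"
    proof -
      show "Y ^ 2 \<le> real N" unfolding N_def by linarith
      have "1 \<le> Y ^ 2" using YY Y by linarith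
      then show "real N \<le> 2 * Y ^ 2" unfolding N_def by linarith
    qed
    have GX: "G X \<subseteq> discs X" unfolding G_def discs_def by auto
    have finG: "finite (G X)" by (rule finite_subset[OF GX finite_discs])
    have lnY: "ln Y = \<delta> * ln X" using X by (simp add: Y_def)
    have lnX: "ln X ^ E \<ge> ln X" "ln X \<ge> 1"
    proof -
      show "ln X \<ge> 1" by (rule elim(6))
      then show "ln X ^ E \<ge> ln X" using E(2) power_increasing[of 1 E "ln X"] by simp
    qed
    have "c1 * (sqrt Y ^ (2 * k) * ln Y ^ E) \<le> real (card (square_tuples I d Y))" if d: "d \<in> G X" for d
    proof -
      have d': "d > 0" "real d \<le> X" "odd d" "(\<Sum>p\<in>prime_factors d. 1 / real p) \<le> 1/4"
        using d unfolding G_def by auto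
      have "real (card (prime_factors d)) \<le> log 2 (real d)" by (rule card_prime_factors_le[OF d'(1)])
      also have "\<dots> \<le> log 2 X" using d' by (subst log_le_cancel_iff) auto
      also have "\<dots> \<le> X powr (\<delta> / 4) / 16" by (rule elim(4))
      also have "X powr (\<delta> / 4) = Y powr (1/4)" by (simp add: Y_def powr_powr)
      finally show ?thesis using elim(1) d' unfolding Y_def by blast
    qed
    then have "(\<Sum>d\<in>G X. c1 * (sqrt Y ^ (2 * k) * ln Y ^ E)) \<le> (\<Sum>d\<in>G X. real (card (square_tuples I d Y)))"
      by (intro sum_mono)
    then have tup: "real (card (G X)) * (c1 * (sqrt Y ^ (2 * k) * ln Y ^ E)) \<le> (\<Sum>d\<in>G X. real (card (square_tuples I d Y)))"
      by simp
    have "c3 * (X * ln X ^ E) = (gauss_const / sqrt Y) ^ (2 * k) * ((c2 * X) * (c1 * (sqrt Y ^ (2 * k) * ln Y ^ E)))"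
      unfolding c3_def lnY power_divide power_mult_distrib using Y by simp
    also have "\<dots> \<le> (gauss_const / sqrt Y) ^ (2 * k) * (real (card (G X)) * (c1 * (sqrt Y ^ (2 * k) * ln Y ^ E)))"
      using elim(2) c1 gc Y X by (intro mult_left_mono mult_right_mono) auto
    also have "\<dots> \<le> (gauss_const / sqrt Y) ^ (2 * k) * (\<Sum>d\<in>G X. real (card (square_tuples I d Y)))"
      using gc Y by (intro mult_left_mono tup) auto
    finally have main: "c3 * (X * ln X ^ E) \<le> (gauss_const / sqrt Y) ^ (2 * k) * (\<Sum>d\<in>G X. real (card (square_tuples I d Y)))" .
    have err: "12 * real N ^ (2 * (2 * k)) * X powr (7/8) \<le> 12 * 2 ^ (4 * k) * X"
    proof -
      have "real N ^ (2 * (2 * k)) \<le> (2 * Y ^ 2) ^ (2 * (2 * k))" by (intro power_mono N) simp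
      also have "\<dots> = (2 * Y ^ 2) ^ (4 * k)" by simp
      also have "\<dots> = 2 ^ (4 * k) * Y ^ (8 * k)" by (simp add: power_mult_distrib flip: power_mult)
      also have "Y ^ (8 * k) = X powr (1/16)"
        using X k unfolding Y_def by (subst powr_realpow[symmetric]) (auto simp: powr_powr \<delta>_def)
      finally have "12 * real N ^ (2 * (2 * k)) * X powr (7/8) \<le> 12 * (2 ^ (4 * k) * X powr (1/16)) * X powr (7/8)"
        by (intro mult_right_mono mult_left_mono) auto
      also have "\<dots> = 12 * 2 ^ (4 * k) * X powr (15/16)" by (simp add: powr_add[symmetric])
      also have "X powr (15/16) \<le> X powr 1" using X by (intro powr_mono) auto
      finally show ?thesis using X by simp
    qed
    have Sle: "S d ^ (2 * k) \<le> 4 ^ (2 * k) * A d ^ (2 * k) + (2 * C) ^ (2 * k)" if d: "d \<in> discs X" for d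
    proof -
      have "\<bar>S d\<bar> \<le> 2 * A d + C" unfolding S_def A_def using Y N by (intro gauss[OF X d]) auto
      then have "\<bar>S d\<bar> ^ (2 * k) \<le> (2 * A d + C) ^ (2 * k)" by (intro power_mono) auto
      also have "\<dots> \<le> 2 ^ (2 * k) * ((2 * A d) ^ (2 * k) + C ^ (2 * k))"
        using C L_mean_nonneg by (intro sum_power_le) (auto simp: A_def)
      also have "\<dots> = 4 ^ (2 * k) * A d ^ (2 * k) + (2 * C) ^ (2 * k)"
      proof -
        have "(4::real) ^ (2 * k) = 2 ^ (2 * k) * 2 ^ (2 * k)" by (simp flip: power_mult_distrib)
        then show ?thesis by (simp only: power_mult_distrib distrib_left mult.assoc)
      qed
      finally show ?thesis by (simp add: power_even_abs)
    qed
    have "c3 * (X * ln X ^ E) - 12 * 2 ^ (4 * k) * X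
        \<le> (gauss_const / sqrt Y) ^ card I * (\<Sum>d\<in>G X. real (card (square_tuples I d Y)))
           - 12 * real N ^ (2 * card I) * X powr (7/8)"
      using main err unfolding I(3) by linarith
    also have "\<dots> \<le> (\<Sum>d\<in>discs X. S d ^ card I)"
      unfolding S_def using Y N YY by (intro moment_gauss_sum_ge I(1,4) X GX) auto
    also have "\<dots> \<le> (\<Sum>d\<in>discs X. 4 ^ (2 * k) * A d ^ (2 * k) + (2 * C) ^ (2 * k))"
      unfolding I(3) by (intro sum_mono Sle)
    also have "\<dots> = 4 ^ (2 * k) * (\<Sum>d\<in>discs X. A d ^ (2 * k)) + real (card (discs X)) * (2 * C) ^ (2 * k)"
      by (simp add: sum.distrib sum_distrib_left)
    also have "real (card (discs X)) * (2 * C) ^ (2 * k) \<le> X * (2 * C) ^ (2 * k)"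
      using card_discs_le[of X] X C by (intro mult_right_mono) auto
    finally have "c3 * (X * ln X ^ E) - K * X \<le> 4 ^ (2 * k) * (\<Sum>d\<in>discs X. A d ^ (2 * k))"
      unfolding K_def by (simp add: algebra_simps)
    moreover have "K * X \<le> c3 / 2 * (X * ln X ^ E)"
    proof -
      have "K \<le> c3 / 2 * ln X" using elim(5) c3 by (simp add: field_simps)
      also have "\<dots> \<le> c3 / 2 * ln X ^ E" using lnX c3 by (intro mult_left_mono) auto
      finally have "K * X \<le> c3 / 2 * ln X ^ E * X" using X by (intro mult_right_mono) auto
      then show ?thesis by (simp add: mult_ac)
    qed
    ultimately have "c3 / 2 * (X * ln X ^ E) \<le> 4 ^ (2 * k) * (\<Sum>d\<in>discs X. A d ^ (2 * k))" by linarith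
    then show ?case unfolding A_def by (simp add: field_simps)
  qed
  moreover have "c3 / (2 * 4 ^ (2 * k)) > 0" using c3 by simp
  ultimately show ?thesis unfolding E_def by blast
qed

section \<open>From the moment to the integral over the box\<close>

lemma shifted_moment_eq:
  "shifted_moment k t X = (\<Sum>d\<in>discs X. \<Prod>j\<in>{1..2*k}. L_abs d (t j))"
  unfolding shifted_moment_def discs_def L_abs_def by (simp add: prod_norm)

lemma nn_integral_prod_L_mean:
  assumes d: "d \<in> discs X"
  shows "(\<integral>\<^sup>+ t. (\<Prod>j\<in>{1..2*k}. ennreal (indicator {-T..T} (t j) * (L_abs d (t j) / (1 + \<bar>t j\<bar>)))) \<partial>(\<Pi>\<^sub>M j\<in>{1..2*k}. lborel))
     = ennreal (L_mean d T ^ (2 * k))"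
proof -
  interpret product_sigma_finite "\<lambda>_::nat. lborel :: real measure" ..
  have [measurable]: "L_abs d \<in> borel_measurable borel" by (rule measurable_L_abs[OF d])
  have "(\<integral>\<^sup>+ t. (\<Prod>j\<in>{1..2*k}. ennreal (indicator {-T..T} (t j) * (L_abs d (t j) / (1 + \<bar>t j\<bar>)))) \<partial>(\<Pi>\<^sub>M j\<in>{1..2*k}. lborel))
     = (\<Prod>j\<in>{1..2*k}. \<integral>\<^sup>+ x. ennreal (indicator {-T..T} x * (L_abs d x / (1 + \<bar>x\<bar>))) \<partial>lborel)"
    by (rule product_nn_integral_prod) auto
  also have "\<dots> = ennreal (L_mean d T) ^ (2 * k)"
    unfolding nn_integral_L_mean[OF d] by simp
  also have "\<dots> = ennreal (L_mean d T ^ (2 * k))" using L_mean_nonneg by (simp add: ennreal_power)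
  finally show ?thesis .
qed

text \<open>No measurability of \<open>G\<close> is available; monotonicity of the (lower) integral suffices, since the
  minorant \<open>shifted_moment\<close> is measurable.\<close>

lemma moment_L_mean_le_nn_integral:
  assumes C: "C > 0" and F: "F > 0" and G: "\<And>t. G t > 0"
    and le: "\<And>t. t \<in> shift_box k T \<Longrightarrow> shifted_moment k t X \<le> C * (F * G t)"
  shows "ennreal (1 / (C * F) * (\<Sum>d\<in>discs X. L_mean d T ^ (2 * k)))
    \<le> (\<integral>\<^sup>+ t \<in> shift_box k T. ennreal (G t / (\<Prod>j\<in>{1..2*k}. (\<bar>t j\<bar> + 1))) \<partial>(\<Pi>\<^sub>M j\<in>{1..2*k}. lborel))"
proof -
  let ?M = "\<Pi>\<^sub>M j\<in>{1..2*k}. (lborel :: real measure)"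
  let ?h = "\<lambda>d t. \<Prod>j\<in>{1..2*k}. ennreal (indicator {-T..T} (t j) * (L_abs d (t j) / (1 + \<bar>t j\<bar>)))"
  have meas: "?h d \<in> borel_measurable ?M" if "d \<in> discs X" for d
  proof -
    have [measurable]: "L_abs d \<in> borel_measurable borel" by (rule measurable_L_abs[OF that])
    show ?thesis by measurable
  qed
  have "ennreal (1 / (C * F) * (\<Sum>d\<in>discs X. L_mean d T ^ (2 * k)))
     = ennreal (1 / (C * F)) * (\<Sum>d\<in>discs X. ennreal (L_mean d T ^ (2 * k)))"
  proof -
    have "(\<Sum>d\<in>discs X. ennreal (L_mean d T ^ (2 * k))) = ennreal (\<Sum>d\<in>discs X. L_mean d T ^ (2 * k))"
      by (intro sum_ennreal zero_le_power L_mean_nonneg)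
    then show ?thesis using C F by (simp only: ennreal_mult sum_nonneg zero_le_power L_mean_nonneg
        zero_le_divide_1_iff mult_nonneg_nonneg less_imp_le)
  qed
  also have "\<dots> = ennreal (1 / (C * F)) * (\<Sum>d\<in>discs X. \<integral>\<^sup>+ t. ?h d t \<partial>?M)"
    using nn_integral_prod_L_mean by (intro arg_cong2[where f = "(*)"] sum.cong) auto
  also have "\<dots> = (\<integral>\<^sup>+ t. ennreal (1 / (C * F)) * (\<Sum>d\<in>discs X. ?h d t) \<partial>?M)"
    using meas by (simp add: nn_integral_sum nn_integral_cmult)
  also have "\<dots> \<le> (\<integral>\<^sup>+ t \<in> shift_box k T. ennreal (G t / (\<Prod>j\<in>{1..2*k}. (\<bar>t j\<bar> + 1))) \<partial>?M)"
  proof (rule nn_integral_mono)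
    fix t assume "t \<in> space ?M"
    \<comment> \<open>Points of the product space are extensional, so a point outside the box must
      have a coordinate outside [-T, T], where the integrand on the left vanishes.\<close>
    then have t: "t \<in> extensional {1..2*k}" by (simp add: space_PiM PiE_def)
    show "ennreal (1 / (C * F)) * (\<Sum>d\<in>discs X. ?h d t)
        \<le> ennreal (G t / (\<Prod>j\<in>{1..2*k}. (\<bar>t j\<bar> + 1))) * indicator (shift_box k T) t"
    proof (cases "t \<in> shift_box k T")
      case True
      then have ind: "indicator {-T..T} (t j) = (1::real)" if "j \<in> {1..2*k}" for j
        using that unfolding shift_box_def by (auto simp: indicator_def)
      define P where "P = (\<Prod>j\<in>{1..2*k}. (\<bar>t j\<bar> + 1))"
      have P: "P > 0" unfolding P_def by (intro prod_pos) auto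
      have hd: "?h d t = ennreal ((\<Prod>j\<in>{1..2*k}. L_abs d (t j)) / P)" for d
      proof -
        have "?h d t = (\<Prod>j\<in>{1..2*k}. ennreal (L_abs d (t j) / (\<bar>t j\<bar> + 1)))"
          using ind by (intro prod.cong) (auto simp: add.commute)
        also have "\<dots> = ennreal (\<Prod>j\<in>{1..2*k}. L_abs d (t j) / (\<bar>t j\<bar> + 1))"
          by (intro prod_ennreal) (auto simp: L_abs_nonneg)
        finally show ?thesis by (simp add: P_def prod_dividef)
      qed
      have "ennreal (1 / (C * F)) * (\<Sum>d\<in>discs X. ?h d t)
          = ennreal (1 / (C * F)) * ennreal (\<Sum>d\<in>discs X. (\<Prod>j\<in>{1..2*k}. L_abs d (t j)) / P)"
        unfolding hd using P by (subst sum_ennreal) (auto intro!: divide_nonneg_nonneg prod_nonneg L_abs_nonneg)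
      also have "(\<Sum>d\<in>discs X. (\<Prod>j\<in>{1..2*k}. L_abs d (t j)) / P) = shifted_moment k t X / P"
        by (simp add: shifted_moment_eq sum_divide_distrib)
      also have "ennreal (1 / (C * F)) * ennreal (shifted_moment k t X / P)
          = ennreal (1 / (C * F) * (shifted_moment k t X / P))"
        using C F by (intro ennreal_mult'[symmetric]) simp
      also have "\<dots> \<le> ennreal (1 / (C * F) * (C * (F * G t) / P))"
        using C F P le[OF True] by (intro ennreal_leI mult_left_mono divide_right_mono) auto
      also have "1 / (C * F) * (C * (F * G t) / P) = G t / P" using C F by simp
      finally show ?thesis using True by (simp add: P_def)
    next
      case False
      then obtain j where j: "j \<in> {1..2*k}" "t j \<notin> {-T..T}"
        using t unfolding shift_box_def PiE_iff by blast
      then have "?h d t = 0" for d by (intro prod_zero bexI[of _ j]) auto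
      then have "(\<Sum>d\<in>discs X. ?h d t) = 0" by (simp only: sum.neutral_const)
      then show ?thesis by (simp only: mult_zero_right zero_le)
    qed
  qed
  finally show ?thesis .
qed

theorem theorem1p3:
  fixes k :: nat and \<Delta> :: real
    and F :: "real \<Rightarrow> real" and G :: "real \<Rightarrow> (nat \<Rightarrow> real) \<Rightarrow> real"
  assumes k: "k \<ge> 1"
    and Delta: "0 < \<Delta>" "\<Delta> \<le> 1"
    and GRH: "generalized_riemann_hypothesis"
    and F_pos: "\<And>X. F X > 0"
    and G_pos: "\<And>X t. G X t > 0"
    and asymp: "\<exists>c>0. \<exists>C>0. \<forall>\<^sub>F X in at_top. \<forall>t\<in>shift_box k (X powr \<Delta>).
                  c * (F X * G X t) \<le> shifted_moment k t X \<and>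
                  shifted_moment k t X \<le> C * (F X * G X t)"
  shows "\<exists>c>0. \<forall>\<^sub>F X in at_top.
           ennreal (c * (X * ln X ^ (2 * k^2 - k) / F X))
             \<le> (\<integral>\<^sup>+ t \<in> shift_box k (X powr \<Delta>).
                   ennreal (G X t / (\<Prod>j\<in>{1..2*k}. (\<bar>t j\<bar> + 1))) \<partial>(\<Pi>\<^sub>M j\<in>{1..2*k}. lborel))"
proof -
  obtain c' C where C: "C > 0" and both: "\<forall>\<^sub>F X in at_top. \<forall>t\<in>shift_box k (X powr \<Delta>).
      c' * (F X * G X t) \<le> shifted_moment k t X \<and> shifted_moment k t X \<le> C * (F X * G X t)"
    using asymp by blast
  \<comment> \<open>The upper bound for the moment is a lower bound for G, so the final constant is
    c / C.\<close>
  have up: "\<forall>\<^sub>F X in at_top. \<forall>t\<in>shift_box k (X powr \<Delta>). shifted_moment k t X \<le> C * (F X * G X t)"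
    by (rule eventually_mono[OF both]) blast
  obtain c where c: "c > 0" and low: "\<forall>\<^sub>F X in at_top. c * (X * ln X ^ (2 * k ^ 2 - k)) \<le>
      (\<Sum>d\<in>discs X. L_mean d (X powr \<Delta>) ^ (2 * k))"
    using eventually_moment_L_mean_ge[OF k Delta(1)] by blast
  have "\<forall>\<^sub>F X in at_top. ennreal (c / C * (X * ln X ^ (2 * k^2 - k) / F X))
             \<le> (\<integral>\<^sup>+ t \<in> shift_box k (X powr \<Delta>).
                   ennreal (G X t / (\<Prod>j\<in>{1..2*k}. (\<bar>t j\<bar> + 1))) \<partial>(\<Pi>\<^sub>M j\<in>{1..2*k}. lborel))"
    using up low
  proof eventually_elim
    case (elim X)
    have "c / C * (X * ln X ^ (2 * k^2 - k) / F X) = 1 / (C * F X) * (c * (X * ln X ^ (2 * k^2 - k)))"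
      by simp
    also have "\<dots> \<le> 1 / (C * F X) * (\<Sum>d\<in>discs X. L_mean d (X powr \<Delta>) ^ (2 * k))"
      using elim(2) C F_pos[of X] by (intro mult_left_mono) auto
    finally have "ennreal (c / C * (X * ln X ^ (2 * k^2 - k) / F X))
        \<le> ennreal (1 / (C * F X) * (\<Sum>d\<in>discs X. L_mean d (X powr \<Delta>) ^ (2 * k)))"
      by (rule ennreal_leI)
    also have "\<dots> \<le> (\<integral>\<^sup>+ t \<in> shift_box k (X powr \<Delta>).
                   ennreal (G X t / (\<Prod>j\<in>{1..2*k}. (\<bar>t j\<bar> + 1))) \<partial>(\<Pi>\<^sub>M j\<in>{1..2*k}. lborel))"
      using elim(1) by (intro moment_L_mean_le_nn_integral C F_pos G_pos) auto
    finally show ?case .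
  qed
  then show ?thesis using c C by (intro exI[of _ "c / C"]) auto
qed

end
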